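(* Let $k\ge 1$ be an integer and let $G$ be a $2k$-edge connected locally finite graph with at most countably many ends. Then $G$ admits an end faithful spanning tree packing of cardinality $k-1$, i.e. there is a set of $k-1$ pairwise edge disjoint spanning trees of $G$ each of which is an end faithful subgraph of $G$.
   Context: Graphs are multigraphs: parallel edges are allowed, loops are not. A locally finite graph is an infinite graph in which every vertex is incident with only finitely many edges. A graph is $m$-edge connected if it is connected and cannot be disconnected by removing fewer than $m$ edges. A ray is a one-sided infinite path; a tail of a ray is a subray. Two rays are equivalent if there is no finite set $S$ of edges such that tails of the two rays lie in different components of $G-S$. The equivalence classes are the ends of $G$; $\Omega(G)$ is the set of ends; an $\omega$-ray is a ray belonging to the end $\omega$. A spanning tree is an ordinary (graph theoretical) spanning tree. A subgraph $H$ of $G$ is end faithful if it contains an $\omega$-ray for every end $\omega$ of $G$ and any two rays in $H$ which lie in the same end of $G$ also lie in the same end of $H$ (equivalently, the natural map $\Omega(H)\to\Omega(G)$ is a homeomorphism of end spaces). *)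

theory Defs
  imports Main "HOL-Library.Countable_Set"
begin

record ('v, 'e) mgraph =
  verts :: "'v set"
  edges :: "'e set"
  endpts :: "'e \<Rightarrow> 'v set"

text \<open>Edges are objects of their own, so parallel edges are allowed; two distinct endpoints per
  edge exclude loops.\<close>

definition multigraph :: "('v, 'e) mgraph \<Rightarrow> bool" where
  "multigraph G \<longleftrightarrow> (\<forall>e\<in>edges G. endpts G e \<subseteq> verts G \<and> card (endpts G e) = 2)"

definition subgraph :: "('v, 'e) mgraph \<Rightarrow> ('v, 'e) mgraph \<Rightarrow> bool" where
  "subgraph H G \<longleftrightarrow>
     multigraph H \<and> verts H \<subseteq> verts G \<and> edges H \<subseteq> edges G \<and> endpts H = endpts G"

definition delete_edges :: "('v, 'e) mgraph \<Rightarrow> 'e set \<Rightarrow> ('v, 'e) mgraph" where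
  "delete_edges G S = G\<lparr>edges := edges G - S\<rparr>"

definition locally_finite :: "('v, 'e) mgraph \<Rightarrow> bool" where
  "locally_finite G \<longleftrightarrow>
     infinite (verts G) \<and> (\<forall>v\<in>verts G. finite {e \<in> edges G. v \<in> endpts G e})"

definition adjacency :: "('v, 'e) mgraph \<Rightarrow> ('v \<times> 'v) set" where
  "adjacency G = {(u, v). \<exists>e\<in>edges G. endpts G e = {u, v}}"

definition connected_graph :: "('v, 'e) mgraph \<Rightarrow> bool" where
  "connected_graph G \<longleftrightarrow>
     verts G \<noteq> {} \<and> (\<forall>u\<in>verts G. \<forall>v\<in>verts G. (u, v) \<in> (adjacency G)\<^sup>*)"

definition edge_connected :: "nat \<Rightarrow> ('v, 'e) mgraph \<Rightarrow> bool" where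
  "edge_connected m G \<longleftrightarrow>
     connected_graph G \<and>
     (\<forall>S. S \<subseteq> edges G \<and> finite S \<and> card S < m \<longrightarrow> connected_graph (delete_edges G S))"

definition component :: "('v, 'e) mgraph \<Rightarrow> ('v, 'e) mgraph \<Rightarrow> bool" where
  "component C G \<longleftrightarrow>
     subgraph C G \<and> connected_graph C \<and>
     (\<forall>D. subgraph D G \<and> connected_graph D \<and> subgraph C D \<longrightarrow> D = C)"

text \<open>A ray is given by its vertex sequence together with its edge sequence; the latter is needed
  because of parallel edges. As a subgraph, a ray determines both sequences.\<close>

type_synonym ('v, 'e) ray = "(nat \<Rightarrow> 'v) \<times> (nat \<Rightarrow> 'e)"

definition rays :: "('v, 'e) mgraph \<Rightarrow> ('v, 'e) ray set" where
  "rays G = {(x, f). inj x \<and>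
     (\<forall>i. x i \<in> verts G \<and> f i \<in> edges G \<and> endpts G (f i) = {x i, x (Suc i)})}"

definition tail :: "nat \<Rightarrow> ('v, 'e) ray \<Rightarrow> ('v, 'e) ray" where
  "tail n r = (\<lambda>i. fst r (i + n), \<lambda>i. snd r (i + n))"

definition separates :: "('v, 'e) mgraph \<Rightarrow> 'e set \<Rightarrow> ('v, 'e) ray \<Rightarrow> ('v, 'e) ray \<Rightarrow> bool" where
  "separates G S r s \<longleftrightarrow>
     (\<exists>C D m n. component C (delete_edges G S) \<and> component D (delete_edges G S) \<and> C \<noteq> D \<and>
        tail m r \<in> rays C \<and> tail n s \<in> rays D)"

definition ray_equiv :: "('v, 'e) mgraph \<Rightarrow> (('v, 'e) ray \<times> ('v, 'e) ray) set" where
  "ray_equiv G = {(r, s). r \<in> rays G \<and> s \<in> rays G \<and>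
     (\<nexists>S. finite S \<and> S \<subseteq> edges G \<and> separates G S r s)}"

definition graph_ends :: "('v, 'e) mgraph \<Rightarrow> ('v, 'e) ray set set" where
  "graph_ends G = rays G // ray_equiv G"

text \<open>The cycle through \<open>vs ! 0, \<dots>, vs ! (n - 1)\<close>, indices modulo \<open>n\<close>; two parallel edges
  form a cycle of length 2.\<close>

definition cycle :: "('v, 'e) mgraph \<Rightarrow> 'v list \<Rightarrow> 'e list \<Rightarrow> bool" where
  "cycle G vs es \<longleftrightarrow>
     2 \<le> length vs \<and> length es = length vs \<and> distinct vs \<and> distinct es \<and>
     set vs \<subseteq> verts G \<and> set es \<subseteq> edges G \<and>
     (\<forall>i<length vs. endpts G (es ! i) = {vs ! i, vs ! (Suc i mod length vs)})"

definition tree :: "('v, 'e) mgraph \<Rightarrow> bool" where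
  "tree T \<longleftrightarrow> multigraph T \<and> connected_graph T \<and> (\<nexists>vs es. cycle T vs es)"

definition spanning_tree :: "('v, 'e) mgraph \<Rightarrow> ('v, 'e) mgraph \<Rightarrow> bool" where
  "spanning_tree T G \<longleftrightarrow> subgraph T G \<and> verts T = verts G \<and> tree T"

definition end_faithful :: "('v, 'e) mgraph \<Rightarrow> ('v, 'e) mgraph \<Rightarrow> bool" where
  "end_faithful H G \<longleftrightarrow>
     subgraph H G \<and>
     (\<forall>\<omega>\<in>graph_ends G. \<exists>r\<in>rays H. r \<in> \<omega>) \<and>
     (\<forall>r\<in>rays H. \<forall>s\<in>rays H.
        (\<exists>\<omega>\<in>graph_ends G. r \<in> \<omega> \<and> s \<in> \<omega>) \<longrightarrow> (\<exists>\<omega>\<in>graph_ends H. r \<in> \<omega> \<and> s \<in> \<omega>))"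

definition end_faithful_spanning_tree_packing ::
    "('v, 'e) mgraph \<Rightarrow> ('v, 'e) mgraph set \<Rightarrow> bool" where
  "end_faithful_spanning_tree_packing G \<T> \<longleftrightarrow>
     (\<forall>T\<in>\<T>. spanning_tree T G \<and> end_faithful T G) \<and>
     (\<forall>T\<in>\<T>. \<forall>T'\<in>\<T>. T \<noteq> T' \<longrightarrow> edges T \<inter> edges T' = {})"

end

theory Submission imports Defs "HOL-Library.Disjoint_Sets"
begin

text \<open>The trees are limits of spanning trees of finite quotients of \<open>G\<close> whose cells are solid: in each
  finite quotient of a cell, every partition is crossed by the number of edges needed for \<open>k\<close> edge
  disjoint spanning trees. Minimising over partitions shows that any set with a finite edge boundary
  splits into finitely many solid cells, so a cell can be refined and the trees extended inside it by
  \<open>k - 1\<close> of the \<open>k\<close> trees of its quotient. A limit of such trees may fail to be connected, because the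
  path between two vertices may run through an end. The spare tree avoids this: inside the cell of
  an end \<open>\<omega>\<close> with \<open>m\<close> boundary edges, choose \<open>m + 1\<close> disjoint finite connected sets that separate two given
  vertices from \<open>\<omega>\<close>. Orient the quotient of the cell so that every set of new cells that avoids the one
  of \<open>\<omega>\<close> has in-degree at least \<open>k\<close>. After reversing paths some vertex reaches both vertices without
  passing the new cell of \<open>\<omega>\<close>, and a branching grown as in Lovasz's proof of Edmonds' theorem contains
  a path between them whose deletion leaves these in-degrees at least \<open>k - 1\<close>. Add this path to one
  tree and pack \<open>k - 1\<close> trees into the other edges.

  Since there are only countably many ends, every tree, pair of vertices and end is treated at some
  stage. Infinitely many edges on the tree paths between two fixed vertices would accumulate at an end,
  which is impossible after that end was treated; hence the limits are connected, also inside every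
  cell. The cells containing tails of a ray of \<open>\<omega>\<close> shrink to \<open>\<omega>\<close>, so connectedness inside the cells makes
  the limit trees end faithful.\<close>

section \<open>Orientations and branchings of finite multigraphs\<close>

text \<open>A tree of a finite quotient joins vertices only modulo cells, and cells may be infinite,
  so a stage need not contain any actual path that could be preserved. What is preserved is weaker:
  tree edges are never removed, new edges lie inside cells, and each tree stays connected inside
  every earlier cell. Hence once \<open>y\<close> and \<open>z\<close> are joined outside the cell
  of an end, no edge inside that cell can ever separate them in the tree, and one treatment per end
  suffices.

  The factor two in \<open>2 * k\<close> comes from counting crossing edges at both ends. One of the
  \<open>k\<close> trees is lost because the link is grown as a branching from a vertex other than
  the root: removing it costs each set that avoids the root at most one unit of guaranteed
  in-degree, the price of one tree. The obstacle is that the quotient of a cell \<open>X\<close>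
  does not see the \<open>m\<close> boundary edges of \<open>X\<close>, so the connectivity of
  \<open>G\<close> bounds its cuts from below only after these edges are added back. That defect is
  at most \<open>m\<close> in total, and \<open>m + 1\<close> disjoint connected separators
  outnumber it.\<close>

definition enters :: "('e \<Rightarrow> 'a set) \<Rightarrow> ('e \<Rightarrow> 'a) \<Rightarrow> 'e set \<Rightarrow> 'a set \<Rightarrow> 'e set" where
  "enters \<epsilon> h E A = {e \<in> E. h e \<in> A \<and> \<not> \<epsilon> e \<subseteq> A}"

definition arcs :: "('e \<Rightarrow> 'a set) \<Rightarrow> ('e \<Rightarrow> 'a) \<Rightarrow> 'e set \<Rightarrow> ('a \<times> 'a) set" where
  "arcs \<epsilon> h E = {(a, b). \<exists>e\<in>E. \<epsilon> e = {a, b} \<and> h e = b \<and> a \<noteq> b}"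

definition links :: "('e \<Rightarrow> 'a set) \<Rightarrow> 'e set \<Rightarrow> ('a \<times> 'a) set" where
  "links \<epsilon> E = {(a, b). \<exists>e\<in>E. \<epsilon> e = {a, b}}"

definition finite_multigraph :: "'a set \<Rightarrow> 'e set \<Rightarrow> ('e \<Rightarrow> 'a set) \<Rightarrow> bool" where
  "finite_multigraph V E \<epsilon> \<longleftrightarrow> finite V \<and> finite E \<and> (\<forall>e\<in>E. \<epsilon> e \<subseteq> V \<and> card (\<epsilon> e) = 2)"

text \<open>Only the head of each edge is stored, and the edge set is a separate argument of
  \<open>enters\<close> and \<open>arcs\<close>; edges can so be deleted or packed without touching
  the orientation.\<close>

definition orientation :: "('e \<Rightarrow> 'a set) \<Rightarrow> ('e \<Rightarrow> 'a) \<Rightarrow> 'e set \<Rightarrow> bool" where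
  "orientation \<epsilon> h E \<longleftrightarrow> (\<forall>e\<in>E. h e \<in> \<epsilon> e)"

lemma finite_multigraph_subset:
  "finite_multigraph V E \<epsilon> \<Longrightarrow> F \<subseteq> E \<Longrightarrow> finite_multigraph V F \<epsilon>"
  unfolding finite_multigraph_def by (meson finite_subset subset_iff)

lemma orientation_subset: "orientation \<epsilon> h E \<Longrightarrow> F \<subseteq> E \<Longrightarrow> orientation \<epsilon> h F"
  unfolding orientation_def by blast

lemma oriented_ends:
  assumes "finite_multigraph V E \<epsilon>" "orientation \<epsilon> h E" "e \<in> E"
  obtains a where "\<epsilon> e = {a, h e}" "a \<noteq> h e" "a \<in> V" "h e \<in> V" "(a, h e) \<in> arcs \<epsilon> h E"
proof -
  have "card (\<epsilon> e) = 2" and he: "h e \<in> \<epsilon> e" and sub: "\<epsilon> e \<subseteq> V"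
    using assms unfolding finite_multigraph_def orientation_def by auto
  then obtain p q where "\<epsilon> e = {p, q}" "p \<noteq> q" by (meson card_2_iff)
  with he have "\<exists>a. \<epsilon> e = {a, h e} \<and> a \<noteq> h e" by (metis insert_commute insert_iff singletonD)
  then obtain a where "\<epsilon> e = {a, h e}" "a \<noteq> h e" by blast
  with sub assms(3) that show ?thesis unfolding arcs_def by auto
qed

lemma finite_enters: "finite_multigraph V E \<epsilon> \<Longrightarrow> finite (enters \<epsilon> h E A)"
  unfolding enters_def finite_multigraph_def by auto

lemma card_filter_sum: "finite E \<Longrightarrow> card {e \<in> E. P e} = (\<Sum>e\<in>E. of_bool (P e))"
  by (simp add: sum.If_cases of_bool_def Int_def)

text \<open>Compared edge by edge: an edge between \<open>A - B\<close> and \<open>B - A\<close>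
  counts only on the right, every other edge counts equally on both sides.\<close>

lemma enters_submodular:
  assumes G: "finite_multigraph V E \<epsilon>" and h: "orientation \<epsilon> h E"
  shows "card (enters \<epsilon> h E (A \<inter> B)) + card (enters \<epsilon> h E (A \<union> B))
    \<le> card (enters \<epsilon> h E A) + card (enters \<epsilon> h E B)"
proof -
  have fin: "finite E" using G unfolding finite_multigraph_def by auto
  have "of_bool (h e \<in> A \<inter> B \<and> \<not> \<epsilon> e \<subseteq> A \<inter> B) + of_bool (h e \<in> A \<union> B \<and> \<not> \<epsilon> e \<subseteq> A \<union> B)
      \<le> (of_bool (h e \<in> A \<and> \<not> \<epsilon> e \<subseteq> A) + of_bool (h e \<in> B \<and> \<not> \<epsilon> e \<subseteq> B) :: nat)" if "e \<in> E" for e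
  proof -
    obtain a where "\<epsilon> e = {a, h e}" using oriented_ends[OF G h \<open>e \<in> E\<close>] by blast
    then show ?thesis by auto
  qed
  then have "(\<Sum>e\<in>E. of_bool (h e \<in> A \<inter> B \<and> \<not> \<epsilon> e \<subseteq> A \<inter> B) + of_bool (h e \<in> A \<union> B \<and> \<not> \<epsilon> e \<subseteq> A \<union> B))
      \<le> (\<Sum>e\<in>E. of_bool (h e \<in> A \<and> \<not> \<epsilon> e \<subseteq> A) + of_bool (h e \<in> B \<and> \<not> \<epsilon> e \<subseteq> B) :: nat)"
    by (rule sum_mono)
  then show ?thesis
    unfolding enters_def card_filter_sum[OF fin] sum.distrib .
qed

section \<open>Reversal of directed paths\<close>

lemma rtrancl_last_exit:
  assumes "(y, c) \<in> r\<^sup>*" "c \<noteq> a"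
  shows "(y, c) \<in> (r \<inter> (- {a}) \<times> (- {a}))\<^sup>* \<or>
    (\<exists>b. (a, b) \<in> r \<and> b \<noteq> a \<and> (b, c) \<in> (r \<inter> (- {a}) \<times> (- {a}))\<^sup>*)"
  using assms
proof (induction rule: converse_rtrancl_induct)
  case base
  then show ?case by auto
next
  case (step y z)
  show ?case
  proof (cases "y = a")
    case True
    then show ?thesis
      by (metis (no_types, lifting) Int_iff assms(2) converse_rtranclE mem_Sigma_iff step ComplD insertCI)
  next
    case False
    from step.IH[OF step.prems] show ?thesis
    proof
      assume zc: "(z, c) \<in> (r \<inter> (- {a}) \<times> (- {a}))\<^sup>*"
      show ?thesis
      proof (cases "z = a")
        case True
        with zc assms(2) have False by (metis ComplD IntD2 SigmaD1 converse_rtranclE insertCI)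
        then show ?thesis ..
      next
        case False
        then have "(y, z) \<in> r \<inter> (- {a}) \<times> (- {a})" using step.hyps(1) \<open>y \<noteq> a\<close> by auto
        with zc show ?thesis by (meson converse_rtrancl_into_rtrancl)
      qed
    qed blast
  qed
qed

text \<open>Both sides carry a correction term, so the identity is free of natural subtraction and
  telescopes along a path.\<close>

lemma card_enters_flip:
  assumes G: "finite_multigraph V E \<epsilon>" and e: "e \<in> E" "\<epsilon> e = {a, b}" "h e = b" "a \<noteq> b"
  shows "card (enters \<epsilon> (h(e := a)) E A) + of_bool (b \<in> A) = card (enters \<epsilon> h E A) + of_bool (a \<in> A)"
proof -
  let ?X = "{e' \<in> E - {e}. h e' \<in> A \<and> \<not> \<epsilon> e' \<subseteq> A}"
  have X: "finite ?X" "e \<notin> ?X" using G unfolding finite_multigraph_def by auto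
  have 1: "enters \<epsilon> (h(e := a)) E A = (if a \<in> A \<and> b \<notin> A then insert e ?X else ?X)"
    using e unfolding enters_def by auto
  have 2: "enters \<epsilon> h E A = (if b \<in> A \<and> a \<notin> A then insert e ?X else ?X)"
    using e unfolding enters_def by auto
  show ?thesis unfolding 1 2 using X by auto
qed

text \<open>The induction is on the vertex set \<open>S\<close> instead of a path. After its last
  visit to \<open>a\<close> the connection runs inside \<open>S - {a}\<close>, so the recursive
  reversal cannot touch the arc \<open>e\<close> leaving \<open>a\<close>, and \<open>e\<close> is
  flipped afterwards. The contributions of inner vertices cancel, which leaves those of
  \<open>a\<close> and \<open>c\<close>.\<close>

lemma reverse_path:
  assumes G: "finite_multigraph V E \<epsilon>" and "orientation \<epsilon> h E" "finite S" "a \<in> S"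
    and "(a, c) \<in> (arcs \<epsilon> h E \<inter> S \<times> S)\<^sup>*"
  shows "\<exists>h'. orientation \<epsilon> h' E \<and> (\<forall>e\<in>E. h' e \<noteq> h e \<longrightarrow> \<epsilon> e \<subseteq> S) \<and>
    (c, a) \<in> (arcs \<epsilon> h' E \<inter> S \<times> S)\<^sup>* \<and>
    (\<forall>A. card (enters \<epsilon> h' E A) + of_bool (c \<in> A) = card (enters \<epsilon> h E A) + of_bool (a \<in> A))"
  using assms(3,4,5,2)
proof (induction S arbitrary: a rule: finite_psubset_induct)
  case (psubset S)
  show ?case
  proof (cases "a = c")
    case True
    then show ?thesis using psubset.prems by auto
  next
    case False
    let ?r = "arcs \<epsilon> h E \<inter> S \<times> S" and ?S = "S - {a}"
    have eq: "?r \<inter> (- {a}) \<times> (- {a}) = arcs \<epsilon> h E \<inter> ?S \<times> ?S" by auto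
    have "(a, c) \<notin> (arcs \<epsilon> h E \<inter> ?S \<times> ?S)\<^sup>*"
      using False by (metis DiffD2 IntD2 SigmaD1 converse_rtranclE singletonI)
    then obtain b where b: "(a, b) \<in> ?r" "b \<noteq> a" "(b, c) \<in> (arcs \<epsilon> h E \<inter> ?S \<times> ?S)\<^sup>*"
      using rtrancl_last_exit[OF psubset.prems(2), of a] False unfolding eq by blast
    then obtain e where e: "e \<in> E" "\<epsilon> e = {a, b}" "h e = b" "a \<noteq> b" "a \<in> S" "b \<in> S"
      unfolding arcs_def by auto
    obtain h' where h': "orientation \<epsilon> h' E" "\<forall>e\<in>E. h' e \<noteq> h e \<longrightarrow> \<epsilon> e \<subseteq> ?S"
      "(c, b) \<in> (arcs \<epsilon> h' E \<inter> ?S \<times> ?S)\<^sup>*"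
      "\<forall>A. card (enters \<epsilon> h' E A) + of_bool (c \<in> A) = card (enters \<epsilon> h E A) + of_bool (b \<in> A)"
      using psubset.IH[of ?S b] e b psubset.prems by auto
    have he: "h' e = b" using h'(2) e by auto
    let ?h = "h'(e := a)"
    have "orientation \<epsilon> ?h E" using h'(1) e unfolding orientation_def by auto
    moreover have "\<forall>e'\<in>E. ?h e' \<noteq> h e' \<longrightarrow> \<epsilon> e' \<subseteq> S" using h'(2) e by auto
    moreover have "(c, a) \<in> (arcs \<epsilon> ?h E \<inter> S \<times> S)\<^sup>*"
    proof -
      have "arcs \<epsilon> h' E \<inter> ?S \<times> ?S \<subseteq> arcs \<epsilon> ?h E \<inter> S \<times> S"
      proof
        fix p assume "p \<in> arcs \<epsilon> h' E \<inter> ?S \<times> ?S"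
        then obtain u v f where p: "p = (u, v)" "u \<in> ?S" "v \<in> ?S" "f \<in> E" "\<epsilon> f = {u, v}" "h' f = v" "u \<noteq> v"
          unfolding arcs_def by auto
        then have "f \<noteq> e" using e by auto
        with p show "p \<in> arcs \<epsilon> ?h E \<inter> S \<times> S" unfolding arcs_def by auto
      qed
      then have "(c, b) \<in> (arcs \<epsilon> ?h E \<inter> S \<times> S)\<^sup>*" using h'(3) rtrancl_mono by blast
      moreover have "(b, a) \<in> arcs \<epsilon> ?h E \<inter> S \<times> S" using e unfolding arcs_def by auto
      ultimately show ?thesis by (rule rtrancl.rtrancl_into_rtrancl)
    qed
    moreover have "card (enters \<epsilon> ?h E A) + of_bool (c \<in> A) = card (enters \<epsilon> h E A) + of_bool (a \<in> A)" for A
      using card_enters_flip[where A = A and h = h' and a = a and b = b, OF G e(1,2) he e(4)] h'(4)[rule_format, of A] by linarith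
    ultimately show ?thesis by blast
  qed
qed

text \<open>The growth step of Lovasz's proof of Edmonds' theorem, with the start \<open>r\<close>
  of the branching kept apart from the root \<open>x\<close> of the in-degree condition. The
  branching never grows into \<open>x\<close>, which is why \<open>Z\<close> is closed under arcs
  only up to \<open>x\<close>.\<close>

lemma branching_grow:
  assumes G: "finite_multigraph V E \<epsilon>" and h: "orientation \<epsilon> h E" and r: "r \<in> V"
    and rho: "\<And>A. A \<noteq> {} \<Longrightarrow> A \<subseteq> V - {x} \<Longrightarrow> Suc j \<le> card (enters \<epsilon> h E A)"
  obtains Z F where "r \<in> Z" "Z \<subseteq> V" "F \<subseteq> E" "\<forall>e\<in>F. \<epsilon> e \<subseteq> Z" "\<forall>p\<in>Z. (r, p) \<in> (links \<epsilon> F)\<^sup>*"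
    "x \<in> Z \<longrightarrow> r = x" "\<forall>a b. (a, b) \<in> arcs \<epsilon> h E \<longrightarrow> a \<in> Z \<longrightarrow> b \<in> Z \<or> b = x"
    "\<And>A. A \<noteq> {} \<Longrightarrow> A \<subseteq> V - {x} \<Longrightarrow> j \<le> card (enters \<epsilon> h (E - F) A)"
proof -
  define good where "good Z F \<longleftrightarrow> r \<in> Z \<and> Z \<subseteq> V \<and> F \<subseteq> E \<and> (\<forall>e\<in>F. \<epsilon> e \<subseteq> Z) \<and>
    (\<forall>p\<in>Z. (r, p) \<in> (links \<epsilon> F)\<^sup>*) \<and> (x \<in> Z \<longrightarrow> r = x) \<and>
    (\<forall>A. A \<noteq> {} \<longrightarrow> A \<subseteq> V - {x} \<longrightarrow> j \<le> card (enters \<epsilon> h (E - F) A))" for Z F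
  have finV: "finite V" using G unfolding finite_multigraph_def by auto
  have "good {r} {}" unfolding good_def using r rho by (auto dest: Suc_leD)
  moreover have "card Z < Suc (card V)" if "good Z F" for Z F
    using that card_mono[OF finV, of Z] unfolding good_def by linarith
  ultimately have "\<exists>Z. (\<exists>F. good Z F) \<and> (\<forall>Z'. (\<exists>F. good Z' F) \<longrightarrow> card Z' \<le> card Z)"
    using ex_has_greatest_nat[of "\<lambda>Z. \<exists>F. good Z F" "{r}" card "Suc (card V)"] by metis
  then obtain Z F where gd: "good Z F" and max: "\<And>Z' F'. good Z' F' \<Longrightarrow> card Z' \<le> card Z"
    by blast
  have "Z \<subseteq> V" "F \<subseteq> E" and FZ: "\<And>e. e \<in> F \<Longrightarrow> \<epsilon> e \<subseteq> Z" using gd unfolding good_def by auto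
  then have finZ: "finite Z" using finV finite_subset by blast
  let ?E = "E - F"
  have G': "finite_multigraph V ?E \<epsilon>" and h': "orientation \<epsilon> h ?E"
    using finite_multigraph_subset[OF G] orientation_subset[OF h] by auto
  have low: "j \<le> card (enters \<epsilon> h ?E A)" if "A \<noteq> {}" "A \<subseteq> V - {x}" for A
    using gd that unfolding good_def by auto
  \<comment> \<open>Only sets entered by \<open>e\<close> lose an arc, so \<open>e\<close> can be
    added unless it enters a set whose in-degree has already dropped to \<open>j\<close>.\<close>
  have extend: False if e: "e \<in> ?E" "\<epsilon> e = {a, b}" "h e = b" "a \<in> Z" "b \<notin> Z" "b \<noteq> x"
    and nt: "\<And>A. A \<subseteq> V - {x} \<Longrightarrow> b \<in> A \<Longrightarrow> a \<notin> A \<Longrightarrow> card (enters \<epsilon> h ?E A) \<noteq> j" for e a b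
  proof -
    let ?Z = "insert b Z" and ?F = "insert e F"
    have "b \<in> V" using e(1,2) G unfolding finite_multigraph_def by auto
    moreover have mono: "links \<epsilon> F \<subseteq> links \<epsilon> ?F" unfolding links_def by auto
    moreover have "(r, p) \<in> (links \<epsilon> ?F)\<^sup>*" if "p \<in> ?Z" for p
    proof -
      have *: "(r, p) \<in> (links \<epsilon> ?F)\<^sup>*" if "p \<in> Z" for p
      proof -
        have "(r, p) \<in> (links \<epsilon> F)\<^sup>*" using gd that unfolding good_def by simp
        then show ?thesis using rtrancl_mono[OF mono] by (rule rev_subsetD)
      qed
      have ab: "(a, b) \<in> links \<epsilon> ?F" unfolding links_def using e by auto
      show ?thesis
      proof (cases "p = b")
        case True
        then show ?thesis using rtrancl.rtrancl_into_rtrancl[OF *[OF e(4)] ab] by simp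
      next
        case False
        then show ?thesis using * that by simp
      qed
    qed
    moreover have "j \<le> card (enters \<epsilon> h (E - ?F) A)" if A: "A \<noteq> {}" "A \<subseteq> V - {x}" for A
    proof (cases "b \<in> A \<and> a \<notin> A")
      case True
      then have "card (enters \<epsilon> h ?E A) \<noteq> j" using nt[OF A(2)] by simp
      then have "j < card (enters \<epsilon> h ?E A)" using low[OF A] by simp
      moreover have "enters \<epsilon> h ?E A - {e} = enters \<epsilon> h (E - ?F) A" unfolding enters_def by auto
      moreover have "card (enters \<epsilon> h ?E A) \<le> Suc (card (enters \<epsilon> h ?E A - {e}))"
        unfolding card_Diff_singleton_if by (split if_split) arith
      ultimately show ?thesis by simp
    next
      case False
      then have "enters \<epsilon> h (E - ?F) A = enters \<epsilon> h ?E A" using e unfolding enters_def by auto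
      then show ?thesis using low[OF A] by simp
    qed
    moreover have "r \<in> Z" "x \<in> Z \<longrightarrow> r = x" using gd unfolding good_def by auto
    moreover have "\<forall>e'\<in>?F. \<epsilon> e' \<subseteq> ?Z" using FZ e(2,4) by auto
    ultimately have "good ?Z ?F"
      using e(1,6) \<open>Z \<subseteq> V\<close> \<open>F \<subseteq> E\<close> unfolding good_def by blast
    then show False using max[of ?Z ?F] finZ e by simp
  qed
  have closed: "b \<in> Z \<or> b = x" if ab: "(a, b) \<in> arcs \<epsilon> h E" "a \<in> Z" for a b
  proof (rule ccontr)
    assume neg: "\<not> (b \<in> Z \<or> b = x)"
    obtain e where e: "e \<in> E" "\<epsilon> e = {a, b}" "h e = b" using ab unfolding arcs_def by auto
    have eF: "e \<in> ?E" using e neg FZ by auto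
    \<comment> \<open>A smallest critical set \<open>A\<close> reaching beyond \<open>Z\<close> is
      taken. Heads of \<open>F\<close> lie in \<open>Z\<close>, so \<open>A - Z\<close> has lost
      nothing and is entered by at least \<open>Suc j\<close> arcs, but \<open>A\<close> by only
      \<open>j\<close>: some arc \<open>f\<close> runs from \<open>A \<inter> Z\<close> to
      \<open>A - Z\<close>. A critical \<open>B\<close> entered by \<open>f\<close> would give the
      smaller critical set \<open>A \<inter> B\<close>, so \<open>f\<close> can be added.\<close>
    define tight where "tight A \<longleftrightarrow> A \<subseteq> V - {x} \<and> card (enters \<epsilon> h ?E A) = j \<and> A - Z \<noteq> {}" for A
    obtain A0 where "tight A0"
      using extend[OF eF e(2,3) ab(2)] neg unfolding tight_def by blast
    then obtain A where A: "tight A" and min: "\<And>A'. tight A' \<Longrightarrow> card A \<le> card A'"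
      using ex_has_least_nat[of tight A0 card] by blast
    have "Suc j \<le> card (enters \<epsilon> h E (A - Z))" using rho[of "A - Z"] A unfolding tight_def by auto
    moreover have "enters \<epsilon> h E (A - Z) = enters \<epsilon> h ?E (A - Z)"
    proof -
      have "h e \<in> Z" if "e \<in> F" for e using FZ[OF that] h \<open>F \<subseteq> E\<close> that unfolding orientation_def by blast
      then show ?thesis unfolding enters_def by blast
    qed
    moreover have "card (enters \<epsilon> h ?E A) = j" using A unfolding tight_def by blast
    ultimately have "\<not> enters \<epsilon> h ?E (A - Z) \<subseteq> enters \<epsilon> h ?E A"
      using card_mono[OF finite_enters[OF G'], of "enters \<epsilon> h ?E (A - Z)" h A] by auto
    then obtain f where f: "f \<in> ?E" "h f \<in> A - Z" "\<not> \<epsilon> f \<subseteq> A - Z" "\<epsilon> f \<subseteq> A"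
      unfolding enters_def by auto
    obtain a' where a': "\<epsilon> f = {a', h f}" using oriented_ends[OF G h] f(1) by blast
    have a'Z: "a' \<in> Z" "a' \<in> A" using a' f by auto
    show False
    proof (rule extend[OF f(1) a' refl a'Z(1)])
      show "h f \<notin> Z" "h f \<noteq> x" using f A unfolding tight_def by auto
      fix B assume B: "B \<subseteq> V - {x}" "h f \<in> B" "a' \<notin> B"
      show "card (enters \<epsilon> h ?E B) \<noteq> j"
      proof
        assume tB: "card (enters \<epsilon> h ?E B) = j"
        have "card (enters \<epsilon> h ?E (A \<inter> B)) + card (enters \<epsilon> h ?E (A \<union> B)) \<le> j + j"
          using enters_submodular[OF G' h', of A B] A tB unfolding tight_def by simp
        moreover have "j \<le> card (enters \<epsilon> h ?E (A \<inter> B))" "j \<le> card (enters \<epsilon> h ?E (A \<union> B))"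
          using A B f(2) low[of "A \<inter> B"] low[of "A \<union> B"] unfolding tight_def by blast+
        ultimately have "card (enters \<epsilon> h ?E (A \<inter> B)) = j" by linarith
        then have "tight (A \<inter> B)" using A B f(2) unfolding tight_def by auto
        then have "card A \<le> card (A \<inter> B)" using min by blast
        moreover have "finite A" using A finV unfolding tight_def by (meson finite_Diff finite_subset)
        ultimately have "A \<inter> B = A" by (meson Int_lower1 card_seteq)
        then show False using a'Z B by auto
      qed
    qed
  qed
  show ?thesis
    by (rule that[of Z F]) (use gd closed low in \<open>simp_all add: good_def\<close>)
qed

text \<open>Started at the root itself, the branching is spanning: an arc entering
  \<open>V - Z\<close> would leave \<open>Z\<close>. Each branching uses up one unit of
  in-degree.\<close>

lemma edmonds_packing:
  assumes "finite_multigraph V E \<epsilon>" "orientation \<epsilon> h E" "x \<in> V"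
    and "\<And>A. A \<noteq> {} \<Longrightarrow> A \<subseteq> V - {x} \<Longrightarrow> j \<le> card (enters \<epsilon> h E A)"
  shows "\<exists>F::nat \<Rightarrow> 'e set. (\<forall>i<j. F i \<subseteq> E \<and> (\<forall>p\<in>V. (x, p) \<in> (links \<epsilon> (F i))\<^sup>*)) \<and>
    (\<forall>i<j. \<forall>i'<j. i \<noteq> i' \<longrightarrow> F i \<inter> F i' = {})"
  using assms
proof (induction j arbitrary: E)
  case 0
  then show ?case by auto
next
  case (Suc j)
  obtain Z F where ZF: "x \<in> Z" "Z \<subseteq> V" "F \<subseteq> E" "\<forall>e\<in>F. \<epsilon> e \<subseteq> Z" "\<forall>p\<in>Z. (x, p) \<in> (links \<epsilon> F)\<^sup>*"
    "\<forall>a b. (a, b) \<in> arcs \<epsilon> h E \<longrightarrow> a \<in> Z \<longrightarrow> b \<in> Z \<or> b = x"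
    "\<And>A. A \<noteq> {} \<Longrightarrow> A \<subseteq> V - {x} \<Longrightarrow> j \<le> card (enters \<epsilon> h (E - F) A)"
    by (rule branching_grow[where x = x and j = j, OF Suc.prems(1,2,3)]) (use Suc.prems(4) in auto)
  have "Z = V"
  proof (rule ccontr)
    assume "Z \<noteq> V"
    then have "0 < card (enters \<epsilon> h E (V - Z))"
      using Suc.prems(4)[of "V - Z"] ZF(1,2) by fastforce
    then obtain e where e: "e \<in> E" "h e \<in> V - Z" "\<not> \<epsilon> e \<subseteq> V - Z"
      unfolding enters_def by (auto simp: card_gt_0_iff)
    obtain a where a: "\<epsilon> e = {a, h e}" "a \<in> V" "(a, h e) \<in> arcs \<epsilon> h E"
      using oriented_ends[OF Suc.prems(1,2) e(1)] by blast
    then have "a \<in> Z" using e by auto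
    with a ZF(1,6) e show False by auto
  qed
  obtain Fs :: "nat \<Rightarrow> 'e set" where Fs:
    "\<forall>i<j. Fs i \<subseteq> E - F \<and> (\<forall>p\<in>V. (x, p) \<in> (links \<epsilon> (Fs i))\<^sup>*)"
    "\<forall>i<j. \<forall>i'<j. i \<noteq> i' \<longrightarrow> Fs i \<inter> Fs i' = {}"
    using Suc.IH[of "E - F"] finite_multigraph_subset[OF Suc.prems(1)]
      orientation_subset[OF Suc.prems(2)] Suc.prems(3) ZF(7) by auto
  let ?F = "Fs(j := F)"
  have "?F i \<subseteq> E \<and> (\<forall>p\<in>V. (x, p) \<in> (links \<epsilon> (?F i))\<^sup>*)" if "i < Suc j" for i
  proof (cases "i = j")
    case True
    then show ?thesis using ZF(3,5) \<open>Z = V\<close> by simp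
  next
    case False
    then have "Fs i \<subseteq> E - F \<and> (\<forall>p\<in>V. (x, p) \<in> (links \<epsilon> (Fs i))\<^sup>*)" using Fs(1) that by simp
    then show ?thesis using False by auto
  qed
  moreover have "?F i \<inter> ?F i' = {}" if "i < Suc j" "i' < Suc j" "i \<noteq> i'" for i i'
  proof -
    consider "i = j" "i' < j" | "i < j" "i' = j" | "i < j" "i' < j" using \<open>i < Suc j\<close> \<open>i' < Suc j\<close> \<open>i \<noteq> i'\<close> by linarith
    then show ?thesis
    proof cases
      case 3
      then show ?thesis using Fs(2) that by simp
    qed (use Fs(1) in auto)
  qed
  ultimately show ?case by blast
qed

section \<open>Existence of rooted orientations\<close>

text \<open>Two maximal members that met would both equal their union. This turns uncrossing into a
  partition over which degrees can be summed; it serves two different notions of tight set.\<close>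

lemma maximal_members_partition:
  assumes "finite W" and cover: "\<And>v. v \<in> W \<Longrightarrow> \<exists>A. T A \<and> v \<in> A"
    and sub: "\<And>A. T A \<Longrightarrow> A \<subseteq> W \<and> A \<noteq> {}"
    and union: "\<And>A B. T A \<Longrightarrow> T B \<Longrightarrow> A \<inter> B \<noteq> {} \<Longrightarrow> T (A \<union> B)"
  shows "\<exists>P. partition_on W P \<and> (\<forall>A\<in>P. T A)"
proof -
  define P where "P = {A. T A \<and> (\<forall>B. T B \<longrightarrow> A \<subseteq> B \<longrightarrow> B = A)}"
  have "\<exists>A\<in>P. v \<in> A" if v: "v \<in> W" for v
  proof -
    obtain A0 where A0: "T A0 \<and> v \<in> A0" using cover[OF v] by blast
    have bound: "\<forall>A. T A \<and> v \<in> A \<longrightarrow> card A < Suc (card W)"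
      using sub card_mono[OF \<open>finite W\<close>] by (simp add: less_Suc_eq_le)
    obtain A where A: "T A \<and> v \<in> A" "\<forall>B. T B \<and> v \<in> B \<longrightarrow> card B \<le> card A"
      using ex_has_greatest_nat[of "\<lambda>A. T A \<and> v \<in> A", OF A0 bound] by blast
    have "B = A" if "T B" "A \<subseteq> B" for B
    proof -
      have "finite B" using sub[OF that(1)] \<open>finite W\<close> finite_subset by blast
      then show ?thesis using card_seteq[of B A] A that by auto
    qed
    then show ?thesis using A(1) unfolding P_def by blast
  qed
  moreover have "A \<inter> B = {}" if "A \<in> P" "B \<in> P" "A \<noteq> B" for A B
  proof (rule ccontr)
    assume "A \<inter> B \<noteq> {}"
    then have "T (A \<union> B)" using union that unfolding P_def by blast
    then have "A \<union> B = A" "A \<union> B = B" using that unfolding P_def by auto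
    with \<open>A \<noteq> B\<close> show False by simp
  qed
  moreover have PT: "T A" if "A \<in> P" for A using that unfolding P_def by blast
  moreover have "A \<subseteq> W" "A \<noteq> {}" if "A \<in> P" for A using sub[OF PT[OF that]] by auto
  ultimately have "\<Union>P = W" "disjoint P" "{} \<notin> P" unfolding disjoint_def by blast+
  then have "partition_on W P" unfolding partition_on_def by simp
  with PT show ?thesis by blast
qed

lemma sum_over_partition:
  assumes "finite V" "partition_on V P"
  shows "sum m V = (\<Sum>A\<in>P. sum m A)"
proof -
  have "\<forall>A\<in>P. finite A" "\<forall>A\<in>P. \<forall>B\<in>P. A \<noteq> B \<longrightarrow> A \<inter> B = {}" "\<Union>P = V"
    using assms finite_subset[OF _ assms(1)] unfolding partition_on_def disjoint_def by blast+
  then show ?thesis using sum.Union_disjoint[of P m] by simp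
qed

lemma card_heads:
  assumes G: "finite_multigraph V E \<epsilon>" and A: "A \<subseteq> V"
  shows "card {e \<in> E. h e \<in> A} = (\<Sum>v\<in>A. card {e \<in> E. h e = v})"
proof -
  have fin: "finite E" "finite A" using G A finite_subset unfolding finite_multigraph_def by auto
  have "{e \<in> E. h e \<in> A} = (\<Union>v\<in>A. {e \<in> E. h e = v})" by auto
  moreover have "card (\<Union>v\<in>A. {e \<in> E. h e = v}) = (\<Sum>v\<in>A. card {e \<in> E. h e = v})"
    by (rule card_UN_disjoint) (use fin in auto)
  ultimately show ?thesis by simp
qed

lemma enters_singleton:
  assumes "finite_multigraph V E \<epsilon>"
  shows "enters \<epsilon> h E {v} = {e \<in> E. h e = v}"
proof -
  have "\<not> \<epsilon> e \<subseteq> {v}" if "e \<in> E" for e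
  proof
    assume "\<epsilon> e \<subseteq> {v}"
    then have "card (\<epsilon> e) \<le> 1" using card_mono[of "{v}" "\<epsilon> e"] by simp
    then show False using assms that unfolding finite_multigraph_def by auto
  qed
  then show ?thesis unfolding enters_def by auto
qed

text \<open>Minimise the total deficit. The set \<open>R\<close> reachable from a deficient vertex
  \<open>p\<close> contains the head of every edge meeting it. Were no vertex of \<open>R\<close> in
  surplus, the edges with head in \<open>R\<close> together with those inside \<open>V - R\<close>
  would number less than \<open>sum m V\<close>. So a surplus vertex is reachable, and reversing a
  path to it lowers the deficit.\<close>

lemma orientation_with_indegrees:
  assumes G: "finite_multigraph V E \<epsilon>"
    and low: "\<And>A. A \<subseteq> V \<Longrightarrow> card {e \<in> E. \<epsilon> e \<subseteq> A} \<le> sum m A" and tot: "sum m V = card E"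
  shows "\<exists>h. orientation \<epsilon> h E \<and> (\<forall>v\<in>V. card {e \<in> E. h e = v} = m v)"
proof -
  have fin: "finite E" "finite V" using G unfolding finite_multigraph_def by auto
  \<comment> \<open>Truncated subtraction is intended: a surplus contributes nothing.\<close>
  define def where "def h = (\<Sum>v\<in>V. m v - card {e \<in> E. h e = v})" for h
  have "\<epsilon> e \<noteq> {}" if "e \<in> E" for e using G that unfolding finite_multigraph_def by auto
  then have "orientation \<epsilon> (\<lambda>e. SOME p. p \<in> \<epsilon> e) E"
    unfolding orientation_def by (simp add: some_in_eq)
  then obtain h where h: "orientation \<epsilon> h E" and least: "\<And>h'. orientation \<epsilon> h' E \<Longrightarrow> def h \<le> def h'"
    using ex_has_least_nat[of "\<lambda>h. orientation \<epsilon> h E" _ def] by blast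
  have hV: "h e \<in> V" if "e \<in> E" for e
    using h G that unfolding orientation_def finite_multigraph_def by auto
  then have "{e \<in> E. h e \<in> V} = E" by auto
  then have toth: "(\<Sum>v\<in>V. card {e \<in> E. h e = v}) = card E" using card_heads[OF G order_refl, of h] by simp
  have "m p \<le> card {e \<in> E. h e = p}" if p: "p \<in> V" for p
  proof (rule ccontr)
    assume neg: "\<not> m p \<le> card {e \<in> E. h e = p}"
    define R where "R = {c \<in> V. (p, c) \<in> (arcs \<epsilon> h E \<inter> V \<times> V)\<^sup>*}"
    have pR: "p \<in> R" "R \<subseteq> V" using p unfolding R_def by auto
    have closed: "h e \<in> R" if e: "e \<in> E" "\<epsilon> e \<inter> R \<noteq> {}" for e
    proof -
      obtain a where a: "\<epsilon> e = {a, h e}" "a \<in> V" "h e \<in> V" "(a, h e) \<in> arcs \<epsilon> h E"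
        using oriented_ends[OF G h e(1)] by blast
      show ?thesis
      proof (cases "h e \<in> R")
        case False
        then have "(p, a) \<in> (arcs \<epsilon> h E \<inter> V \<times> V)\<^sup>*" using a(1) e(2) unfolding R_def by auto
        moreover have "(a, h e) \<in> arcs \<epsilon> h E \<inter> V \<times> V" using a by auto
        ultimately have "(p, h e) \<in> (arcs \<epsilon> h E \<inter> V \<times> V)\<^sup>*" by (rule rtrancl.rtrancl_into_rtrancl)
        then show ?thesis using a(3) unfolding R_def by simp
      qed
    qed
    have "\<exists>c\<in>R. m c < card {e \<in> E. h e = c}"
    proof (rule ccontr)
      assume "\<not> (\<exists>c\<in>R. m c < card {e \<in> E. h e = c})"
      then have "(\<Sum>v\<in>R. card {e \<in> E. h e = v}) < sum m R"
        using neg pR fin finite_subset by (intro sum_strict_mono_ex1) (auto simp: not_less not_le)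
      moreover have "{e \<in> E. h e \<in> R} \<union> {e \<in> E. \<epsilon> e \<subseteq> V - R} = E"
        using closed G unfolding finite_multigraph_def by auto
      then have "card E \<le> card {e \<in> E. h e \<in> R} + card {e \<in> E. \<epsilon> e \<subseteq> V - R}"
        by (metis card_Un_le)
      moreover have "sum m V = sum m R + sum m (V - R)"
        using sum.subset_diff[OF pR(2) fin(2), of m] by simp
      ultimately show False using low[of "V - R"] tot card_heads[OF G pR(2), of h] by auto
    qed
    then obtain c where c: "c \<in> R" "m c < card {e \<in> E. h e = c}" by blast
    have pc: "(p, c) \<in> (arcs \<epsilon> h E \<inter> V \<times> V)\<^sup>*" using c unfolding R_def by auto
    obtain h' where h': "orientation \<epsilon> h' E"
      "\<And>A. card (enters \<epsilon> h' E A) + of_bool (c \<in> A) = card (enters \<epsilon> h E A) + of_bool (p \<in> A)"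
      using reverse_path[OF G h fin(2) p pc] by auto
    have deg: "card {e \<in> E. h' e = v} + of_bool (c = v) = card {e \<in> E. h e = v} + of_bool (p = v)" for v
      using h'(2)[of "{v}"] unfolding enters_singleton[OF G] by auto
    have "c \<noteq> p" using c neg by auto
    have "def h' < def h"
      unfolding def_def
    proof (rule sum_strict_mono_ex1[OF fin(2)])
      have "m v - card {e \<in> E. h' e = v} \<le> m v - card {e \<in> E. h e = v}" for v
      proof (cases "c = v")
        case True
        then show ?thesis using c deg[of v] \<open>c \<noteq> p\<close> by simp
      next
        case False
        then show ?thesis using deg[of v] by simp
      qed
      then show "\<forall>v\<in>V. m v - card {e \<in> E. h' e = v} \<le> m v - card {e \<in> E. h e = v}" by simp
      have "m p - card {e \<in> E. h' e = p} < m p - card {e \<in> E. h e = p}"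
        using deg[of p] \<open>c \<noteq> p\<close> neg by simp
      then show "\<exists>v\<in>V. m v - card {e \<in> E. h' e = v} < m v - card {e \<in> E. h e = v}" using p by blast
    qed
    with least[OF h'(1)] show False by simp
  qed
  note le = this
  have "m v = card {e \<in> E. h e = v}" if "v \<in> V" for v
    by (rule sum_mono_inv[of m V]) (use tot toth fin that le in simp_all)
  with h show ?thesis by auto
qed

text \<open>An orientation theorem of Frank. \<open>q A\<close> is the number of heads that must
  fall into \<open>A\<close>: one per edge inside, and \<open>k\<close> from entering edges if the
  root lies elsewhere. For a minimal feasible \<open>m\<close> every vertex lies in a tight set, and
  intersecting tight sets have tight unions. On the resulting partition the hypothesis bounds
  \<open>sum m V\<close> by the number of edges, which makes \<open>m\<close> a vector of
  in-degrees.\<close>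

lemma rooted_orientation_exists:
  assumes G: "finite_multigraph V E \<epsilon>" and x: "x \<in> V"
    and part: "\<And>P. partition_on V P \<Longrightarrow> k * (card P - 1) \<le> card {e \<in> E. \<not> (\<exists>A\<in>P. \<epsilon> e \<subseteq> A)}"
  obtains h where "orientation \<epsilon> h E"
    "\<And>A. A \<noteq> {} \<Longrightarrow> A \<subseteq> V - {x} \<Longrightarrow> k \<le> card (enters \<epsilon> h E A)"
proof -
  have fin: "finite E" "finite V" using G unfolding finite_multigraph_def by auto
  define i where "i A = card {e \<in> E. \<epsilon> e \<subseteq> A}" for A
  define q where "q A = (if x \<in> A then 0 else k) + i A" for A
  define feas where "feas m \<longleftrightarrow> (\<forall>A. A \<noteq> {} \<longrightarrow> A \<subseteq> V \<longrightarrow> q A \<le> sum m A)" for m :: "'a \<Rightarrow> nat"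
  have "feas (\<lambda>_. k + card E)"
    unfolding feas_def
  proof (intro allI impI)
    fix A assume A: "A \<noteq> {}" "A \<subseteq> V"
    have "q A \<le> k + card E" unfolding q_def i_def using card_mono[OF fin(1)] by (simp add: add_mono)
    have c1: "1 \<le> card A" using A finite_subset[OF A(2) fin(2)] by (simp add: Suc_le_eq card_gt_0_iff)
    have "k + card E \<le> card A * (k + card E)" using mult_le_mono1[OF c1, of "k + card E"] unfolding mult_1 .
    with \<open>q A \<le> k + card E\<close> have "q A \<le> card A * (k + card E)" by (rule le_trans)
    then show "q A \<le> (\<Sum>_\<in>A. k + card E)" unfolding sum_constant of_nat_id .
  qed
  then obtain m where m: "feas m" and least: "\<And>m'. feas m' \<Longrightarrow> sum m V \<le> sum m' V"
    using ex_has_least_nat[of feas _ "\<lambda>m. sum m V"] by blast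
  have mD: "q A \<le> sum m A" if "A \<noteq> {}" "A \<subseteq> V" for A using m that unfolding feas_def by simp
  define tight where "tight A \<longleftrightarrow> A \<noteq> {} \<and> A \<subseteq> V \<and> q A = sum m A" for A
  have cover: "\<exists>A. tight A \<and> v \<in> A" if v: "v \<in> V" for v
  proof (rule ccontr)
    assume neg: "\<nexists>A. tight A \<and> v \<in> A"
    have "q {v} \<le> sum m {v}" using v by (intro mD) auto
    moreover have "q {v} \<noteq> sum m {v}" using neg v unfolding tight_def by blast
    ultimately have mv: "0 < m v" by simp
    let ?m = "m(v := m v - 1)"
    have red: "sum m A = Suc (sum ?m A)" if "v \<in> A" "A \<subseteq> V" for A
    proof -
      have "finite A" using that fin finite_subset by blast
      then have "sum m A = m v + sum m (A - {v})" "sum ?m A = ?m v + sum ?m (A - {v})"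
        using that(1) by (intro sum.remove; simp)+
      moreover have "sum ?m (A - {v}) = sum m (A - {v})" by (rule sum.cong) auto
      ultimately show ?thesis using mv by simp
    qed
    have "feas ?m"
      unfolding feas_def
    proof (intro allI impI)
      fix A assume A: "A \<noteq> {}" "A \<subseteq> V"
      then have le: "q A \<le> sum m A" by (rule mD)
      show "q A \<le> sum ?m A"
      proof (cases "v \<in> A")
        case True
        then have "q A \<noteq> sum m A" using neg A unfolding tight_def by blast
        then show ?thesis using le red[OF True A(2)] by linarith
      next
        case False
        then have "sum ?m A = sum m A" by (intro sum.cong) auto
        then show ?thesis using le by simp
      qed
    qed
    then show False using least[of ?m] red[OF v] by simp
  qed
  have union: "tight (A \<union> B)" if AB: "tight A" "tight B" "A \<inter> B \<noteq> {}" for A B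
  proof -
    have f: "finite A" "finite B" using AB fin finite_subset unfolding tight_def by auto
    have "card ({e \<in> E. \<epsilon> e \<subseteq> A} \<union> {e \<in> E. \<epsilon> e \<subseteq> B}) \<le> i (A \<union> B)"
      unfolding i_def using fin by (intro card_mono) auto
    moreover have "{e \<in> E. \<epsilon> e \<subseteq> A} \<inter> {e \<in> E. \<epsilon> e \<subseteq> B} = {e \<in> E. \<epsilon> e \<subseteq> A \<inter> B}" by auto
    ultimately have "i A + i B \<le> i (A \<inter> B) + i (A \<union> B)"
      unfolding i_def using card_Un_Int[of "{e \<in> E. \<epsilon> e \<subseteq> A}" "{e \<in> E. \<epsilon> e \<subseteq> B}"] fin by simp
    \<comment> \<open>The edge count is supermodular, and the summand \<open>k\<close> is modular
      because it depends on membership of the single vertex \<open>x\<close>.\<close>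
    then have "q A + q B \<le> q (A \<inter> B) + q (A \<union> B)" unfolding q_def by auto
    moreover have "sum m (A \<union> B) + sum m (A \<inter> B) = sum m A + sum m B"
      using sum.union_inter[OF f, of m] by simp
    moreover have "q (A \<inter> B) \<le> sum m (A \<inter> B)" "q (A \<union> B) \<le> sum m (A \<union> B)"
    proof -
      have "A \<inter> B \<subseteq> V" "A \<union> B \<subseteq> V" "A \<union> B \<noteq> {}" using AB unfolding tight_def by auto
      then show "q (A \<inter> B) \<le> sum m (A \<inter> B)" "q (A \<union> B) \<le> sum m (A \<union> B)"
        using AB(3) by (simp_all add: mD)
    qed
    moreover have "q A = sum m A" "q B = sum m B" "A \<noteq> {}" "A \<union> B \<subseteq> V" using AB unfolding tight_def by auto
    ultimately show ?thesis unfolding tight_def by simp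
  qed
  obtain P where P: "partition_on V P" "\<forall>A\<in>P. tight A"
    using maximal_members_partition[where T = tight, OF fin(2) cover] union unfolding tight_def by blast
  have finP: "finite P" using P(1) fin(2) finite_elements by blast
  obtain A0 where A0: "A0 \<in> P" "x \<in> A0" using P(1) x unfolding partition_on_def by blast
  have uniq: "x \<notin> A" if "A \<in> P - {A0}" for A
    using that A0 P(1) unfolding partition_on_def disjoint_def by blast
  have "sum m V = (\<Sum>A\<in>P. q A)"
    using sum_over_partition[OF fin(2) P(1), of m] P(2) unfolding tight_def by simp
  also have "\<dots> = (\<Sum>A\<in>P. if x \<in> A then 0 else k) + (\<Sum>A\<in>P. i A)" unfolding q_def by (simp add: sum.distrib)
  \<comment> \<open>Exactly one part contains \<open>x\<close>, and it alone does not pay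
    \<open>k\<close>.\<close>
  also have "(\<Sum>A\<in>P. if x \<in> A then 0 else k) = k * (card P - 1)"
    using finP A0 uniq by (simp add: sum.remove[OF finP A0(1)])
  also have "(\<Sum>A\<in>P. i A) = card {e \<in> E. \<exists>A\<in>P. \<epsilon> e \<subseteq> A}"
  proof -
    have "{e \<in> E. \<epsilon> e \<subseteq> A} \<inter> {e \<in> E. \<epsilon> e \<subseteq> B} = {}" if "A \<in> P" "B \<in> P" "A \<noteq> B" for A B
    proof -
      have "A \<inter> B = {}" using that P(1) unfolding partition_on_def disjoint_def by blast
      moreover have "\<epsilon> e \<noteq> {}" if "e \<in> E" for e using G that unfolding finite_multigraph_def by auto
      ultimately show ?thesis by blast
    qed
    then have "card (\<Union>A\<in>P. {e \<in> E. \<epsilon> e \<subseteq> A}) = (\<Sum>A\<in>P. i A)"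
      unfolding i_def using finP fin by (intro card_UN_disjoint) auto
    moreover have "(\<Union>A\<in>P. {e \<in> E. \<epsilon> e \<subseteq> A}) = {e \<in> E. \<exists>A\<in>P. \<epsilon> e \<subseteq> A}" by auto
    ultimately show ?thesis by simp
  qed
  finally have "sum m V = k * (card P - 1) + card {e \<in> E. \<exists>A\<in>P. \<epsilon> e \<subseteq> A}" .
  also have "\<dots> \<le> card {e \<in> E. \<not> (\<exists>A\<in>P. \<epsilon> e \<subseteq> A)} + card {e \<in> E. \<exists>A\<in>P. \<epsilon> e \<subseteq> A}"
    using part[OF P(1)] by simp
  also have "\<dots> = card ({e \<in> E. \<not> (\<exists>A\<in>P. \<epsilon> e \<subseteq> A)} \<union> {e \<in> E. \<exists>A\<in>P. \<epsilon> e \<subseteq> A})"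
    using fin by (intro card_Un_disjoint[symmetric]) auto
  also have "{e \<in> E. \<not> (\<exists>A\<in>P. \<epsilon> e \<subseteq> A)} \<union> {e \<in> E. \<exists>A\<in>P. \<epsilon> e \<subseteq> A} = E" by blast
  finally have "sum m V \<le> card E" .
  moreover have "card E \<le> sum m V"
  proof -
    have "{e \<in> E. \<epsilon> e \<subseteq> V} = E" using G unfolding finite_multigraph_def by auto
    then have "q V = card E" unfolding q_def i_def using x by simp
    moreover have "q V \<le> sum m V" using x by (intro mD) auto
    ultimately show ?thesis by simp
  qed
  ultimately have tot: "sum m V = card E" by simp
  have low: "i A \<le> sum m A" if "A \<subseteq> V" for A
  proof (cases "A = {}")
    case True
    then have none: "{e \<in> E. \<epsilon> e \<subseteq> A} = {}" using G unfolding finite_multigraph_def by auto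
    show ?thesis unfolding i_def none by simp
  next
    case False
    then have "q A \<le> sum m A" using that by (rule mD)
    then show ?thesis unfolding q_def by simp
  qed
  obtain h where h: "orientation \<epsilon> h E" "\<forall>v\<in>V. card {e \<in> E. h e = v} = m v"
    using orientation_with_indegrees[OF G low[unfolded i_def] tot] by blast
  have "k \<le> card (enters \<epsilon> h E A)" if A: "A \<noteq> {}" "A \<subseteq> V - {x}" for A
  proof -
    have AV: "A \<subseteq> V" using A by blast
    have "card {e \<in> E. h e \<in> A} = (\<Sum>v\<in>A. m v)"
      unfolding card_heads[OF G AV] using h(2) AV by (intro sum.cong) auto
    moreover have "{e \<in> E. h e \<in> A} = enters \<epsilon> h E A \<union> {e \<in> E. \<epsilon> e \<subseteq> A}"
      using h(1) unfolding enters_def orientation_def by auto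
    then have "card {e \<in> E. h e \<in> A} \<le> card (enters \<epsilon> h E A) + i A"
      unfolding i_def by (simp add: card_Un_le)
    moreover have "q A \<le> sum m A" using A(1) AV by (rule mD)
    moreover have "q A = k + i A" using A unfolding q_def by auto
    ultimately show ?thesis by linarith
  qed
  with h(1) that show ?thesis by blast
qed

section \<open>Linking two vertices away from the root\<close>

lemma links_mono: "E \<subseteq> E' \<Longrightarrow> links \<epsilon> E \<subseteq> links \<epsilon> E'"
  unfolding links_def by blast

lemma sym_links: "sym (links \<epsilon> E)"
  unfolding sym_def links_def by (auto simp: insert_commute)

lemma rtrancl_links_sym: "(p, q) \<in> (links \<epsilon> E)\<^sup>* \<Longrightarrow> (q, p) \<in> (links \<epsilon> E)\<^sup>*"
  using sym_rtrancl[OF sym_links] by (meson symD)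

lemma rtrancl_closed_induct:
  assumes "(p, q) \<in> r\<^sup>*" "p \<in> S" "\<And>a b. (a, b) \<in> r \<Longrightarrow> a \<in> S \<Longrightarrow> b \<in> S"
  shows "q \<in> S"
  using assms(1,2) by (induction rule: rtrancl_induct) (use assms(3) in blast)+

lemma rtrancl_exit:
  assumes "(p, q) \<in> r\<^sup>*" "p \<in> S" "q \<notin> S"
  shows "\<exists>a b. (a, b) \<in> r \<and> a \<in> S \<and> b \<notin> S"
  using assms rtrancl_closed_induct[of p q r S] by blast

text \<open>In the application the graph is a quotient of a set \<open>X\<close> of vertices, \<open>c\<close> counts the edges from
  a cell to the complement of \<open>X\<close>, and the root \<open>x\<close> is the cell that contains the tails of a given ray.
  The orientation is chosen so that as many vertices as possible reach \<open>u\<close> or \<open>v\<close> without passing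
  the root. If no vertex reaches both, then the heads of the arcs leaving these two ancestor sets
  generate an out-closed set covered by sets of in-degree exactly \<open>Suc j\<close>, since otherwise
  reversing a path would enlarge the ancestor sets. Counting degrees, at most \<open>sum c V\<close> arcs leave
  the ancestor sets, but every \<open>W i\<close> contains one of them.\<close>

lemma link_avoiding_root:
  assumes G: "finite_multigraph V E \<epsilon>" and h0: "orientation \<epsilon> h0 E"
    and rho0: "\<And>A. A \<noteq> {} \<Longrightarrow> A \<subseteq> V - {x} \<Longrightarrow> Suc j \<le> card (enters \<epsilon> h0 E A)"
    and cut: "\<And>A. A \<noteq> {} \<Longrightarrow> A \<subseteq> V - {x} \<Longrightarrow>
      2 * Suc j \<le> card {e \<in> E. \<epsilon> e \<inter> A \<noteq> {} \<and> \<not> \<epsilon> e \<subseteq> A} + sum c A"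
    and uv: "u \<in> V - {x}" "v \<in> V - {x}"
    and n: "sum c V < n"
    and W: "\<And>i. i < n \<Longrightarrow> W i \<subseteq> V - {x}"
    and Wdisj: "\<And>i i'. i < n \<Longrightarrow> i' < n \<Longrightarrow> i \<noteq> i' \<Longrightarrow> W i \<inter> W i' = {}"
    and Wconn: "\<And>i p q. i < n \<Longrightarrow> p \<in> W i \<Longrightarrow> q \<in> W i \<Longrightarrow> (p, q) \<in> (links \<epsilon> {e \<in> E. \<epsilon> e \<subseteq> W i})\<^sup>*"
    and sep: "\<And>B w e i. i < n \<Longrightarrow> B \<subseteq> V - {x} \<Longrightarrow> w \<in> {u, v} \<Longrightarrow> w \<in> B \<Longrightarrow>
      (\<And>p. p \<in> B \<Longrightarrow> (p, w) \<in> (links \<epsilon> {e \<in> E. \<epsilon> e \<subseteq> B})\<^sup>*) \<Longrightarrow>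
      e \<in> E \<Longrightarrow> x \<in> \<epsilon> e \<Longrightarrow> \<epsilon> e \<inter> B \<noteq> {} \<Longrightarrow> B \<inter> W i \<noteq> {}"
  obtains h Q where "orientation \<epsilon> h E" "Q \<subseteq> E" "\<And>e. e \<in> Q \<Longrightarrow> x \<notin> \<epsilon> e" "(u, v) \<in> (links \<epsilon> Q)\<^sup>*"
    "\<And>A. A \<noteq> {} \<Longrightarrow> A \<subseteq> V - {x} \<Longrightarrow> j \<le> card (enters \<epsilon> h (E - Q) A)"
proof -
  have fin: "finite E" "finite V" using G unfolding finite_multigraph_def by auto
  let ?U = "V - {x}"
  define valid where "valid h \<longleftrightarrow> orientation \<epsilon> h E \<and> (\<forall>e\<in>E. h e \<noteq> x) \<and>
    (\<forall>A. A \<noteq> {} \<longrightarrow> A \<subseteq> ?U \<longrightarrow> Suc j \<le> card (enters \<epsilon> h E A))" for h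
  define arc where "arc h = arcs \<epsilon> h E \<inter> ?U \<times> ?U" for h
  define anc where "anc h w = {p \<in> ?U. (p, w) \<in> (arc h)\<^sup>*}" for h w
  \<comment> \<open>Turning every edge at \<open>x\<close> away from \<open>x\<close> does not lower
    the in-degree of a set that avoids \<open>x\<close>; afterwards no arc enters the root.\<close>
  have "\<exists>h. valid h"
  proof -
    let ?h = "\<lambda>e. if h0 e = x then (SOME p. p \<in> \<epsilon> e \<and> p \<noteq> x) else h0 e"
    have *: "?h e \<in> \<epsilon> e \<and> ?h e \<noteq> x" if e: "e \<in> E" for e
    proof (cases "h0 e = x")
      case True
      obtain a where "\<epsilon> e = {a, h0 e}" "a \<noteq> h0 e" using oriented_ends[OF G h0 e] by blast
      then have "\<exists>p. p \<in> \<epsilon> e \<and> p \<noteq> x" using True by auto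
      then show ?thesis using True someI_ex[of "\<lambda>p. p \<in> \<epsilon> e \<and> p \<noteq> x"] by simp
    next
      case False
      then show ?thesis using h0 e unfolding orientation_def by simp
    qed
    moreover have "Suc j \<le> card (enters \<epsilon> ?h E A)" if A: "A \<noteq> {}" "A \<subseteq> ?U" for A
    proof -
      have "enters \<epsilon> h0 E A \<subseteq> enters \<epsilon> ?h E A" using A(2) unfolding enters_def by auto
      then have "card (enters \<epsilon> h0 E A) \<le> card (enters \<epsilon> ?h E A)" by (intro card_mono finite_enters[OF G])
      then show ?thesis using rho0[OF A] by simp
    qed
    ultimately have "valid ?h" unfolding valid_def orientation_def by blast
    then show ?thesis by blast
  qed
  then obtain h1 where h1: "valid h1" by blast
  define measure where "measure h = card (anc h u) + card (anc h v)" for h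
  have bound: "\<forall>h. valid h \<longrightarrow> measure h < Suc (card V + card V)"
  proof (intro allI impI)
    fix h
    have "card (anc h w) \<le> card V" for w unfolding anc_def using fin by (intro card_mono) auto
    then show "measure h < Suc (card V + card V)" unfolding measure_def by (simp add: add_mono less_Suc_eq_le)
  qed
  obtain h where vh: "valid h" and maximal: "\<And>h'. valid h' \<Longrightarrow> measure h' \<le> measure h"
    using ex_has_greatest_nat[of valid, OF h1 bound] by blast
  have h: "orientation \<epsilon> h E" and hx: "\<And>e. e \<in> E \<Longrightarrow> h e \<noteq> x"
    and rho: "\<And>A. A \<noteq> {} \<Longrightarrow> A \<subseteq> ?U \<Longrightarrow> Suc j \<le> card (enters \<epsilon> h E A)"
    using vh unfolding valid_def by auto
  define B where "B = anc h u"
  define B' where "B' = anc h v"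
  have uB: "u \<in> B" "v \<in> B'" using uv unfolding B_def B'_def anc_def by auto
  have BU: "B \<subseteq> ?U" "B' \<subseteq> ?U" unfolding B_def B'_def anc_def by auto
  show ?thesis
  proof (cases "B \<inter> B' = {}")
    case False
    \<comment> \<open>A common ancestor settles the claim: the branching grown from \<open>z\<close>
      is closed up to \<open>x\<close>, so it contains \<open>u\<close> and \<open>v\<close>, and it
      misses \<open>x\<close> because \<open>z\<close> is not \<open>x\<close>.\<close>
    then obtain z where z: "z \<in> ?U" "(z, u) \<in> (arc h)\<^sup>*" "(z, v) \<in> (arc h)\<^sup>*"
      unfolding B_def B'_def anc_def by auto
    then have "z \<in> V" by blast
    obtain Z F where ZF: "z \<in> Z" "Z \<subseteq> V" "F \<subseteq> E" "\<forall>e\<in>F. \<epsilon> e \<subseteq> Z" "\<forall>p\<in>Z. (z, p) \<in> (links \<epsilon> F)\<^sup>*"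
      "x \<in> Z \<longrightarrow> z = x" "\<forall>a b. (a, b) \<in> arcs \<epsilon> h E \<longrightarrow> a \<in> Z \<longrightarrow> b \<in> Z \<or> b = x"
      "\<And>A. A \<noteq> {} \<Longrightarrow> A \<subseteq> ?U \<Longrightarrow> j \<le> card (enters \<epsilon> h (E - F) A)"
      by (rule branching_grow[where x = x and j = j, OF G h \<open>z \<in> V\<close>]) (use rho in auto)
    have "w \<in> Z" if "(z, w) \<in> (arc h)\<^sup>*" for w
      using that ZF(1) by (rule rtrancl_closed_induct) (use ZF(7) in \<open>auto simp: arc_def\<close>)
    then have "u \<in> Z" "v \<in> Z" using z by auto
    then have "(z, u) \<in> (links \<epsilon> F)\<^sup>*" "(z, v) \<in> (links \<epsilon> F)\<^sup>*" using ZF(5) by auto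
    then have "(u, v) \<in> (links \<epsilon> F)\<^sup>*" using rtrancl_links_sym rtrancl_trans by metis
    moreover have "x \<notin> \<epsilon> e" if "e \<in> F" for e using ZF(4,6) z(1) that by blast
    ultimately show ?thesis using that[OF h ZF(3)] ZF(8) by blast
  next
    case disj: True
    define N where "N = ?U - B - B'"
    have anc_step: "a \<in> anc h w" if "(a, b) \<in> arcs \<epsilon> h E" "a \<noteq> x" "b \<in> anc h w" for a b w
    proof -
      have "a \<in> V" using that(1) G unfolding arcs_def finite_multigraph_def by auto
      then have "(a, b) \<in> arc h" using that unfolding arc_def anc_def by auto
      then show ?thesis using that(2,3) \<open>a \<in> V\<close> unfolding anc_def by (auto intro: converse_rtrancl_into_rtrancl)
    qed
    have arc_into: "a \<in> B" if "(a, b) \<in> arcs \<epsilon> h E" "a \<noteq> x" "b \<in> B" for a b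
      using anc_step[OF that(1,2)] that(3) unfolding B_def by blast
    have arc_into': "a \<in> B'" if "(a, b) \<in> arcs \<epsilon> h E" "a \<noteq> x" "b \<in> B'" for a b
      using anc_step[OF that(1,2)] that(3) unfolding B'_def by blast
    have arc_from: "b \<in> N" if "(a, b) \<in> arcs \<epsilon> h E" "a \<in> N" for a b
    proof -
      have "b \<in> V" "b \<noteq> x" "a \<noteq> x" using that G hx unfolding arcs_def finite_multigraph_def N_def by auto
      then show ?thesis using that arc_into arc_into' unfolding N_def by blast
    qed
    define reach where "reach b = {p \<in> ?U. (b, p) \<in> (arc h)\<^sup>*}" for b
    have reachN: "reach b \<subseteq> N" if "b \<in> N" for b
    proof
      fix p assume "p \<in> reach b"
      then have "(b, p) \<in> (arc h)\<^sup>*" unfolding reach_def by simp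
      then show "p \<in> N" using that by (rule rtrancl_closed_induct) (use arc_from in \<open>auto simp: arc_def\<close>)
    qed
    have reach_closed: "q \<in> reach b" if "(p, q) \<in> arcs \<epsilon> h E" "p \<in> reach b" for b p q
    proof -
      have "q \<in> V" "q \<noteq> x" using that(1) G hx unfolding arcs_def finite_multigraph_def by auto
      then have "(p, q) \<in> arc h" using that unfolding arc_def reach_def by auto
      then show ?thesis using that(2) \<open>q \<in> V\<close> \<open>q \<noteq> x\<close> unfolding reach_def by (auto intro: rtrancl_into_rtrancl)
    qed
    define tight where "tight A \<longleftrightarrow> A \<noteq> {} \<and> A \<subseteq> ?U \<and> card (enters \<epsilon> h E A) = Suc j" for A
    \<comment> \<open>Reversing a path from \<open>a\<close> through \<open>b\<close> to
      \<open>c'\<close> makes \<open>c'\<close> a new ancestor and keeps the old ones, because the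
      path meets \<open>B \<union> B'\<close> in \<open>a\<close> only. By maximality of
      \<open>measure\<close> the reversed orientation is invalid, and a set that violates the
      condition must contain \<open>c'\<close>, miss \<open>a\<close> and have been tight
      before.\<close>
    have blocked: "\<exists>A. tight A \<and> c' \<in> A \<and> A \<subseteq> reach b"
      if ab: "(a, b) \<in> arcs \<epsilon> h E" "a \<in> B \<union> B'" "b \<in> N" and c': "c' \<in> reach b" for a b c'
    proof -
      let ?S = "insert a (reach b)"
      have RN: "reach b \<subseteq> N" using reachN[OF ab(3)] .
      have S: "finite ?S" "?S \<subseteq> ?U" "a \<notin> reach b"
        using fin RN ab BU unfolding reach_def N_def by auto
      have bR: "b \<in> reach b" using ab(3) unfolding reach_def N_def by auto
      have "(b, c') \<in> (arcs \<epsilon> h E \<inter> ?S \<times> ?S)\<^sup>*"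
      proof -
        have "(b, c') \<in> (arc h)\<^sup>*" using c' unfolding reach_def by simp
        then have "(b, c') \<in> (arcs \<epsilon> h E \<inter> reach b \<times> reach b)\<^sup>* \<and> c' \<in> reach b"
        proof (induction rule: rtrancl_induct)
          case (step y z)
          then have "z \<in> reach b" using reach_closed unfolding arc_def by blast
          then have "(y, z) \<in> arcs \<epsilon> h E \<inter> reach b \<times> reach b" using step unfolding arc_def by blast
          with step \<open>z \<in> reach b\<close> show ?case by (meson rtrancl.rtrancl_into_rtrancl)
        qed (use bR in auto)
        then show ?thesis using rtrancl_mono[of "arcs \<epsilon> h E \<inter> reach b \<times> reach b" "arcs \<epsilon> h E \<inter> ?S \<times> ?S"] by blast
      qed
      moreover have "(a, b) \<in> arcs \<epsilon> h E \<inter> ?S \<times> ?S" using ab(1) bR by auto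
      ultimately have path: "(a, c') \<in> (arcs \<epsilon> h E \<inter> ?S \<times> ?S)\<^sup>*" by (rule converse_rtrancl_into_rtrancl[rotated])
      obtain h' where h': "orientation \<epsilon> h' E" "\<And>e. e \<in> E \<Longrightarrow> h' e \<noteq> h e \<Longrightarrow> \<epsilon> e \<subseteq> ?S"
        "(c', a) \<in> (arcs \<epsilon> h' E \<inter> ?S \<times> ?S)\<^sup>*"
        "\<And>A. card (enters \<epsilon> h' E A) + of_bool (c' \<in> A) = card (enters \<epsilon> h E A) + of_bool (a \<in> A)"
        using reverse_path[OF G h S(1) insertI1 path] by auto
      have keep: "arc h \<inter> Y \<times> Y \<subseteq> arc h'" if Y: "Y \<inter> reach b = {}" for Y
      proof
        fix pq assume pq: "pq \<in> arc h \<inter> Y \<times> Y"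
        then obtain p q e where e: "pq = (p, q)" "p \<in> Y" "q \<in> Y" "e \<in> E" "\<epsilon> e = {p, q}" "h e = q" "p \<noteq> q"
          unfolding arc_def arcs_def by auto
        then have "\<not> \<epsilon> e \<subseteq> ?S" using Y by auto
        then have "h' e = q" using h'(2)[OF e(4)] e(6) by auto
        then show "pq \<in> arc h'" using e pq unfolding arc_def arcs_def by auto
      qed
      have anc_keep: "anc h w \<subseteq> anc h' w" if "anc h w \<inter> reach b = {}" for w
      proof
        fix p assume p: "p \<in> anc h w"
        then have "(p, w) \<in> (arc h)\<^sup>*" unfolding anc_def by simp
        then have "(p, w) \<in> (arc h')\<^sup>*"
        proof (induction rule: converse_rtrancl_induct)
          case (step y z)
          have "y \<in> anc h w" "z \<in> anc h w"
            using step(1,2) unfolding anc_def arc_def by (auto intro: converse_rtrancl_into_rtrancl)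
          then have "(y, z) \<in> arc h'" using keep[OF that] step(1) by blast
          with step show ?case by (meson converse_rtrancl_into_rtrancl)
        qed simp
        then show "p \<in> anc h' w" using p unfolding anc_def by simp
      qed
      have "B \<inter> reach b = {}" "B' \<inter> reach b = {}" using RN unfolding N_def by auto
      then have sub: "B \<subseteq> anc h' u" "B' \<subseteq> anc h' v"
        using anc_keep unfolding B_def B'_def by auto
      have "\<not> valid h'"
      proof
        assume val: "valid h'"
        have fa: "finite (anc h' w)" for w using fin unfolding anc_def by auto
        have ca: "(c', a) \<in> (arc h')\<^sup>*"
          using h'(3) S(2) rtrancl_mono[of "arcs \<epsilon> h' E \<inter> ?S \<times> ?S" "arc h'"] unfolding arc_def by blast
        have c'U: "c' \<in> ?U" "c' \<notin> B" "c' \<notin> B'" using c' RN unfolding N_def by auto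
        have trans: "c' \<in> anc h' w" if "a \<in> anc h' w" for w
          using that ca c'U(1) unfolding anc_def by (auto intro: rtrancl_trans)
        have le: "card B \<le> card (anc h' u)" "card B' \<le> card (anc h' v)"
          using sub fa by (auto intro: card_mono)
        have "measure h < measure h'"
        proof (cases "a \<in> B")
          case True
          then have "insert c' B \<subseteq> anc h' u" using trans sub by blast
          then have "B \<subset> anc h' u" using c'U by blast
          then show ?thesis using le psubset_card_mono[OF fa, of B u] unfolding measure_def B_def[symmetric] B'_def[symmetric] by simp
        next
          case False
          then have "insert c' B' \<subseteq> anc h' v" using ab(2) trans sub by blast
          then have "B' \<subset> anc h' v" using c'U by blast
          then show ?thesis using le psubset_card_mono[OF fa, of B' v] unfolding measure_def B_def[symmetric] B'_def[symmetric] by simp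
        qed
        then show False using maximal[OF val] by simp
      qed
      moreover have "h' e \<noteq> x" if "e \<in> E" for e
      proof (cases "h' e = h e")
        case True
        then show ?thesis using hx[OF that] by simp
      next
        case False
        then have "\<epsilon> e \<subseteq> ?U" using h'(2)[OF that] S(2) by blast
        then show ?thesis using h'(1) that unfolding orientation_def by blast
      qed
      ultimately obtain A where A: "A \<noteq> {}" "A \<subseteq> ?U" "\<not> Suc j \<le> card (enters \<epsilon> h' E A)"
        using h'(1) unfolding valid_def by blast
      have Ac: "c' \<in> A" "a \<notin> A" and Atight: "card (enters \<epsilon> h E A) = Suc j"
        using h'(4)[of A] A(3) rho[OF A(1,2)] by (auto simp: of_bool_def split: if_splits)
      \<comment> \<open>No arc leaves \<open>reach b\<close>, so every arc entering
        \<open>A - reach b\<close> enters \<open>A\<close> as well. The path contributes one more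
        arc into \<open>A\<close>, with its head in \<open>reach b\<close>. Were
        \<open>A - reach b\<close> nonempty, \<open>A\<close> would be entered by more than
        \<open>Suc j\<close> arcs.\<close>
      have "A \<subseteq> reach b"
      proof (rule ccontr)
        assume "\<not> A \<subseteq> reach b"
        then have low: "Suc j \<le> card (enters \<epsilon> h E (A - reach b))" using rho[of "A - reach b"] A by blast
        have "\<exists>p q. (p, q) \<in> arcs \<epsilon> h E \<inter> ?S \<times> ?S \<and> p \<in> - A \<and> q \<notin> - A"
          using rtrancl_exit[OF path, of "- A"] Ac by auto
        then obtain p q where pq: "(p, q) \<in> arcs \<epsilon> h E" "p \<in> ?S" "q \<in> ?S" "p \<notin> A" "q \<in> A" by auto
        then have qR: "q \<in> reach b" using Ac by auto
        obtain f where f: "f \<in> E" "\<epsilon> f = {p, q}" "h f = q" using pq(1) unfolding arcs_def by auto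
        have "insert f (enters \<epsilon> h E (A - reach b)) \<subseteq> enters \<epsilon> h E A"
        proof -
          have "f \<in> enters \<epsilon> h E A" using f pq unfolding enters_def by auto
          moreover have "g \<in> enters \<epsilon> h E A" if g: "g \<in> enters \<epsilon> h E (A - reach b)" for g
          proof -
            have gE: "g \<in> E" "h g \<in> A" "h g \<notin> reach b" "\<not> \<epsilon> g \<subseteq> A - reach b" using g unfolding enters_def by auto
            obtain s where s: "\<epsilon> g = {s, h g}" "(s, h g) \<in> arcs \<epsilon> h E" using oriented_ends[OF G h gE(1)] by blast
            have "s \<notin> reach b" using reach_closed[OF s(2)] gE(3) by blast
            then show ?thesis using gE s unfolding enters_def by auto
          qed
          ultimately show ?thesis by blast
        qed
        moreover have "f \<notin> enters \<epsilon> h E (A - reach b)" using f qR unfolding enters_def by auto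
        ultimately have "Suc (card (enters \<epsilon> h E (A - reach b))) \<le> card (enters \<epsilon> h E A)"
          using card_mono[OF finite_enters[OF G], of "insert f (enters \<epsilon> h E (A - reach b))" h A]
          by (simp add: finite_enters[OF G])
        then show False using low Atight by simp
      qed
      then show ?thesis using A Ac Atight unfolding tight_def by blast
    qed
    define N' where "N' = \<Union>{reach b | a b. (a, b) \<in> arcs \<epsilon> h E \<and> a \<in> B \<union> B' \<and> b \<in> N}"
    have N'U: "N' \<subseteq> ?U" unfolding N'_def reach_def by auto
    have N'_out: "q \<in> N'" if "(p, q) \<in> arcs \<epsilon> h E" "p \<in> N'" for p q
      using that reach_closed unfolding N'_def by blast
    define T where "T A \<longleftrightarrow> tight A \<and> A \<subseteq> N'" for A
    have "\<exists>P. partition_on N' P \<and> (\<forall>A\<in>P. T A)"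
    proof (rule maximal_members_partition)
      show "finite N'" using N'U fin finite_subset by blast
      show "\<exists>A. T A \<and> w \<in> A" if "w \<in> N'" for w
      proof -
        obtain a b where ab: "(a, b) \<in> arcs \<epsilon> h E" "a \<in> B \<union> B'" "b \<in> N" "w \<in> reach b"
          using \<open>w \<in> N'\<close> unfolding N'_def by blast
        obtain A where "tight A" "w \<in> A" "A \<subseteq> reach b" using blocked[OF ab] by blast
        moreover have "reach b \<subseteq> N'" using ab unfolding N'_def by blast
        ultimately show ?thesis unfolding T_def by blast
      qed
      show "A \<subseteq> N' \<and> A \<noteq> {}" if "T A" for A using that unfolding T_def tight_def by blast
      show "T (A \<union> A')" if AA: "T A" "T A'" "A \<inter> A' \<noteq> {}" for A A'
      proof -
        have "Suc j \<le> card (enters \<epsilon> h E (A \<inter> A'))" "Suc j \<le> card (enters \<epsilon> h E (A \<union> A'))"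
          using rho[of "A \<inter> A'"] rho[of "A \<union> A'"] AA unfolding T_def tight_def by blast+
        then have "card (enters \<epsilon> h E (A \<union> A')) = Suc j"
          using enters_submodular[OF G h, of A A'] AA unfolding T_def tight_def by linarith
        then show ?thesis using AA unfolding T_def tight_def by blast
      qed
    qed
    then obtain P where P: "partition_on N' P" "\<And>A. A \<in> P \<Longrightarrow> T A" by blast
    define lv where "lv A = {e \<in> E. h e \<notin> A \<and> \<epsilon> e \<inter> A \<noteq> {}}" for A
    \<comment> \<open>In-degree minus out-degree minus \<open>c\<close>; edges inside a set cancel
      in its sum. A tight set has in-degree \<open>Suc j\<close>, hence by \<open>cut\<close> at
      least that much out-degree plus \<open>c\<close>, so its sum is not positive. As no arc leaves
      \<open>N'\<close>, the in-degree of \<open>N'\<close> is at most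
      \<open>sum c N'\<close>.\<close>
    define g where "g v = int (card {e \<in> E. h e = v}) - int (card (lv {v})) - int (c v)" for v
    have gsum: "sum g A = int (card (enters \<epsilon> h E A)) - int (card (lv A)) - int (sum c A)" if A: "A \<subseteq> V" for A
    proof -
      have finA: "finite A" using A fin finite_subset by blast
      define i where "i = {e \<in> E. \<epsilon> e \<subseteq> A}"
      have "{e \<in> E. h e \<in> A} = enters \<epsilon> h E A \<union> i" "enters \<epsilon> h E A \<inter> i = {}"
        using h unfolding enters_def orientation_def i_def by auto
      then have 1: "(\<Sum>v\<in>A. card {e \<in> E. h e = v}) = card (enters \<epsilon> h E A) + card i"
        using card_heads[OF G A, of h] card_Un_disjoint[of "enters \<epsilon> h E A" i] fin finite_enters[OF G] unfolding i_def by simp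
      have "(\<Union>v\<in>A. lv {v}) = lv A \<union> i"
      proof
        show "(\<Union>v\<in>A. lv {v}) \<subseteq> lv A \<union> i"
        proof
          fix e assume "e \<in> (\<Union>v\<in>A. lv {v})"
          then obtain v where v: "v \<in> A" "e \<in> E" "h e \<noteq> v" "v \<in> \<epsilon> e" unfolding lv_def by auto
          obtain s where "\<epsilon> e = {s, h e}" using oriented_ends[OF G h v(2)] by blast
          then show "e \<in> lv A \<union> i" using v unfolding lv_def i_def by auto
        qed
        show "lv A \<union> i \<subseteq> (\<Union>v\<in>A. lv {v})"
        proof
          fix e assume e: "e \<in> lv A \<union> i"
          then have eE: "e \<in> E" unfolding lv_def i_def by auto
          obtain s where s: "\<epsilon> e = {s, h e}" "s \<noteq> h e" using oriented_ends[OF G h eE] by blast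
          have "s \<in> A" using e s(1) unfolding lv_def i_def by auto
          moreover have "e \<in> lv {s}" using eE s unfolding lv_def by auto
          ultimately show "e \<in> (\<Union>v\<in>A. lv {v})" by blast
        qed
      qed
      moreover have "card (\<Union>v\<in>A. lv {v}) = (\<Sum>v\<in>A. card (lv {v}))"
      proof (rule card_UN_disjoint[OF finA])
        show "\<forall>v\<in>A. finite (lv {v})" using fin unfolding lv_def by auto
        show "\<forall>v\<in>A. \<forall>w\<in>A. v \<noteq> w \<longrightarrow> lv {v} \<inter> lv {w} = {}"
        proof (intro ballI impI)
          fix v w assume "v \<in> A" "w \<in> A" "v \<noteq> w"
          have False if e: "e \<in> lv {v}" "e \<in> lv {w}" for e
          proof -
            have eE: "e \<in> E" using e unfolding lv_def by auto
            obtain s where "\<epsilon> e = {s, h e}" using oriented_ends[OF G h eE] by blast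
            then show False using e \<open>v \<noteq> w\<close> unfolding lv_def by auto
          qed
          then show "lv {v} \<inter> lv {w} = {}" by blast
        qed
      qed
      moreover have "card (lv A \<union> i) = card (lv A) + card i"
        using fin h unfolding lv_def i_def orientation_def by (intro card_Un_disjoint) auto
      ultimately have 2: "(\<Sum>v\<in>A. card (lv {v})) = card (lv A) + card i" by simp
      have "sum g A = int (\<Sum>v\<in>A. card {e \<in> E. h e = v}) - int (\<Sum>v\<in>A. card (lv {v})) - int (sum c A)"
        unfolding g_def by (simp add: sum_subtractf)
      then show ?thesis unfolding 1 2 by simp
    qed
    have "sum g A \<le> 0" if "A \<in> P" for A
    proof -
      have A: "A \<noteq> {}" "A \<subseteq> ?U" "card (enters \<epsilon> h E A) = Suc j"
        using P(2)[OF that] unfolding T_def tight_def by auto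
      have "{e \<in> E. \<epsilon> e \<inter> A \<noteq> {} \<and> \<not> \<epsilon> e \<subseteq> A} \<subseteq> enters \<epsilon> h E A \<union> lv A"
        unfolding enters_def lv_def by auto
      then have "card {e \<in> E. \<epsilon> e \<inter> A \<noteq> {} \<and> \<not> \<epsilon> e \<subseteq> A} \<le> card (enters \<epsilon> h E A \<union> lv A)"
        using fin finite_enters[OF G] unfolding lv_def by (intro card_mono) auto
      also have "\<dots> \<le> card (enters \<epsilon> h E A) + card (lv A)" by (rule card_Un_le)
      finally have "2 * Suc j \<le> Suc j + card (lv A) + sum c A" using cut[OF A(1,2)] A(3) by simp
      moreover have "sum g A = int (card (enters \<epsilon> h E A)) - int (card (lv A)) - int (sum c A)"
        using A(2) by (intro gsum) blast
      moreover define t where "t = sum c A"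
      ultimately have "sum g A = int (card (enters \<epsilon> h E A)) - int (card (lv A)) - int t"
        "2 * Suc j \<le> Suc j + card (lv A) + t" by auto
      moreover from this(2) have "int (Suc j) \<le> int (card (lv A) + t)" by (subst of_nat_le_iff) simp
      ultimately show ?thesis using A(3) by simp
    qed
    then have "(\<Sum>A\<in>P. sum g A) \<le> 0" by (rule sum_nonpos)
    moreover have finN': "finite N'" using N'U fin finite_subset by blast
    ultimately have "sum g N' \<le> 0" using sum_over_partition[OF _ P(1), of g] by simp
    moreover have "lv N' = {}"
    proof -
      have False if e: "e \<in> lv N'" for e
      proof -
        have eE: "e \<in> E" "h e \<notin> N'" "\<epsilon> e \<inter> N' \<noteq> {}" using e unfolding lv_def by auto
        obtain s where s: "\<epsilon> e = {s, h e}" "(s, h e) \<in> arcs \<epsilon> h E" using oriented_ends[OF G h eE(1)] by blast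
        then have "s \<in> N'" using eE by auto
        then show False using eE(2) N'_out[OF s(2)] by blast
      qed
      then show ?thesis by blast
    qed
    moreover have "N' \<subseteq> V" using N'U by blast
    ultimately have "card (enters \<epsilon> h E N') \<le> sum c N'" using gsum[of N', OF \<open>N' \<subseteq> V\<close>]
      by (simp flip: of_nat_sum)
    also have "\<dots> \<le> sum c V" using \<open>N' \<subseteq> V\<close> fin by (intro sum_mono2) auto
    finally have few: "card (enters \<epsilon> h E N') < n" using n by simp
    \<comment> \<open>An ancestor set contains all predecessors of its members except
      \<open>x\<close>, so an arc entering it comes from \<open>x\<close>. This is the situation to
      which \<open>sep\<close> applies.\<close>
    have meets: "anc h w \<inter> W i \<noteq> {}" if w: "w \<in> {u, v}" and i: "i < n" for w i
    proof -
      have wA: "w \<in> anc h w" "anc h w \<subseteq> ?U" using w uv unfolding anc_def by auto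
      then have "0 < card (enters \<epsilon> h E (anc h w))" using rho[of "anc h w"] by fastforce
      then obtain e where e: "e \<in> E" "h e \<in> anc h w" "\<not> \<epsilon> e \<subseteq> anc h w"
        unfolding enters_def by (auto simp: card_gt_0_iff)
      obtain s where s: "\<epsilon> e = {s, h e}" "(s, h e) \<in> arcs \<epsilon> h E" using oriented_ends[OF G h e(1)] by blast
      have "s = x" using anc_step[OF s(2) _ e(2)] s(1) e(2,3) by auto
      show ?thesis
      proof (rule sep[OF i wA(2) w wA(1) _ e(1)])
        show "x \<in> \<epsilon> e" "\<epsilon> e \<inter> anc h w \<noteq> {}" using s e \<open>s = x\<close> by auto
        fix p assume "p \<in> anc h w"
        then have "(p, w) \<in> (arc h)\<^sup>*" unfolding anc_def by simp
        then show "(p, w) \<in> (links \<epsilon> {e \<in> E. \<epsilon> e \<subseteq> anc h w})\<^sup>*"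
        proof (induction rule: converse_rtrancl_induct)
          case (step y z)
          have "y \<in> anc h w" "z \<in> anc h w"
            using step(1,2) unfolding anc_def arc_def by (auto intro: converse_rtrancl_into_rtrancl)
          then have "(y, z) \<in> links \<epsilon> {e \<in> E. \<epsilon> e \<subseteq> anc h w}"
            using step(1) unfolding arc_def arcs_def links_def by auto
          with step show ?case by (meson converse_rtrancl_into_rtrancl)
        qed simp
      qed
    qed
    \<comment> \<open>\<open>W i\<close> is connected and meets both ancestor sets, so it has an
      edge between \<open>B\<close> and its outside. That edge cannot point into \<open>B\<close>,
      and coming from \<open>B\<close> it cannot point into \<open>B'\<close>; its head therefore
      lies in \<open>N'\<close>. Disjointness of the \<open>W i\<close> makes these arcs
      distinct.\<close>
    have "\<exists>e. e \<in> enters \<epsilon> h E N' \<and> \<epsilon> e \<subseteq> W i" if i: "i < n" for i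
    proof -
      obtain b b' where b: "b \<in> B" "b \<in> W i" and b': "b' \<in> B'" "b' \<in> W i"
        using meets[of u, OF _ i] meets[of v, OF _ i] unfolding B_def B'_def by blast
      have "b' \<notin> B" using b' disj by blast
      then obtain p q where pq: "(p, q) \<in> links \<epsilon> {e \<in> E. \<epsilon> e \<subseteq> W i}" "p \<in> B" "q \<notin> B"
        using rtrancl_exit[OF Wconn[OF i b(2) b'(2)] b(1)] by blast
      then obtain e where e: "e \<in> E" "\<epsilon> e \<subseteq> W i" "\<epsilon> e = {p, q}" unfolding links_def by auto
      have pqU: "p \<in> ?U" "q \<in> ?U" using e W[OF i] by auto
      have he: "h e = p \<or> h e = q" using h e unfolding orientation_def by auto
      have "p \<noteq> q" using pq by auto
      have "(q, p) \<notin> arcs \<epsilon> h E" using arc_into pq(2,3) pqU by blast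
      then have hq: "h e = q" using he e \<open>p \<noteq> q\<close> unfolding arcs_def by (auto simp: insert_commute)
      then have arc_pq: "(p, q) \<in> arcs \<epsilon> h E" using e \<open>p \<noteq> q\<close> unfolding arcs_def by auto
      have "q \<notin> B'" using arc_into'[OF arc_pq] pq(2) pqU disj by blast
      then have "q \<in> N" using pqU pq(3) unfolding N_def by blast
      then have "q \<in> N'" using arc_pq pq(2) pqU unfolding N'_def reach_def by blast
      moreover have "p \<notin> N'"
      proof
        assume "p \<in> N'"
        then obtain b where "b \<in> N" "p \<in> reach b" unfolding N'_def by blast
        then show False using reachN pq(2) unfolding N_def by blast
      qed
      ultimately show ?thesis using e hq unfolding enters_def by auto
    qed
    then obtain f where f: "\<And>i. i < n \<Longrightarrow> f i \<in> enters \<epsilon> h E N' \<and> \<epsilon> (f i) \<subseteq> W i" by metis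
    have "inj_on f {..<n}"
    proof (rule inj_onI)
      fix i i' assume ii: "i \<in> {..<n}" "i' \<in> {..<n}" "f i = f i'"
      have "f i \<in> E" using f ii(1) unfolding enters_def by auto
      then have "\<epsilon> (f i) \<noteq> {}" using G unfolding finite_multigraph_def by auto
      then have "W i \<inter> W i' \<noteq> {}" using f[of i] f[of i'] ii by auto
      then show "i = i'" using Wdisj ii by auto
    qed
    then have "n \<le> card (enters \<epsilon> h E N')"
      using card_inj_on_le[of f "{..<n}" "enters \<epsilon> h E N'"] f finite_enters[OF G] by auto
    with few show ?thesis by simp
  qed
qed

section \<open>Connectivity modulo a partition\<close>

definition same :: "'a set set \<Rightarrow> ('a \<times> 'a) set" where
  "same P = {(a, b). \<exists>A\<in>P. a \<in> A \<and> b \<in> A}"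

text \<open>Connectedness in the quotient that contracts the members of \<open>P\<close>, phrased on
  the original vertices so that different partitions can be compared. For \<open>P = {}\<close> it
  is ordinary connectedness by \<open>J\<close>.\<close>

definition conn :: "('e \<Rightarrow> 'a set) \<Rightarrow> 'a set set \<Rightarrow> 'e set \<Rightarrow> ('a \<times> 'a) set" where
  "conn \<epsilon> P J = (same P \<union> links \<epsilon> J)\<^sup>*"

text \<open>Independence in the graphic matroid of the quotient, expressed by every edge being a
  bridge. An edge inside a member of \<open>P\<close> is a loop of the quotient and thereby
  excluded.\<close>

definition indep :: "('e \<Rightarrow> 'a set) \<Rightarrow> 'a set set \<Rightarrow> 'e set \<Rightarrow> bool" where
  "indep \<epsilon> P J \<longleftrightarrow> (\<forall>e\<in>J. \<forall>p q. \<epsilon> e = {p, q} \<longrightarrow> (p, q) \<notin> conn \<epsilon> P (J - {e}))"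

definition refines :: "'a set set \<Rightarrow> 'a set set \<Rightarrow> bool" where
  "refines P' P \<longleftrightarrow> (\<forall>A\<in>P'. \<exists>B\<in>P. A \<subseteq> B)"

lemma conn_refl [simp]: "(p, p) \<in> conn \<epsilon> P J"
  unfolding conn_def by simp

lemma conn_trans: "(p, q) \<in> conn \<epsilon> P J \<Longrightarrow> (q, r) \<in> conn \<epsilon> P J \<Longrightarrow> (p, r) \<in> conn \<epsilon> P J"
  unfolding conn_def by (rule rtrancl_trans)

lemma conn_sym: "(p, q) \<in> conn \<epsilon> P J \<Longrightarrow> (q, p) \<in> conn \<epsilon> P J"
proof -
  have "sym (same P \<union> links \<epsilon> J)" unfolding sym_def same_def links_def by (auto simp: insert_commute)
  then show "(p, q) \<in> conn \<epsilon> P J \<Longrightarrow> (q, p) \<in> conn \<epsilon> P J" unfolding conn_def by (meson sym_rtrancl symD)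
qed

lemma conn_mono: "J \<subseteq> J' \<Longrightarrow> conn \<epsilon> P J \<subseteq> conn \<epsilon> P J'"
  unfolding conn_def by (intro rtrancl_mono Un_mono links_mono order_refl)

lemma conn_monoD: "(p, q) \<in> conn \<epsilon> P J \<Longrightarrow> J \<subseteq> J' \<Longrightarrow> (p, q) \<in> conn \<epsilon> P J'"
  using conn_mono by blast

lemma conn_edge: "e \<in> J \<Longrightarrow> \<epsilon> e = {p, q} \<Longrightarrow> (p, q) \<in> conn \<epsilon> P J"
  unfolding conn_def links_def by (intro r_into_rtrancl) blast

lemma conn_same: "A \<in> P \<Longrightarrow> p \<in> A \<Longrightarrow> q \<in> A \<Longrightarrow> (p, q) \<in> conn \<epsilon> P J"
  unfolding conn_def same_def by (intro r_into_rtrancl) blast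

lemma conn_least:
  assumes "(p, q) \<in> conn \<epsilon> P J"
    and "\<And>A a b. A \<in> P \<Longrightarrow> a \<in> A \<Longrightarrow> b \<in> A \<Longrightarrow> (a, b) \<in> conn \<epsilon> P' J'"
    and "\<And>e a b. e \<in> J \<Longrightarrow> \<epsilon> e = {a, b} \<Longrightarrow> (a, b) \<in> conn \<epsilon> P' J'"
  shows "(p, q) \<in> conn \<epsilon> P' J'"
  using assms(1) unfolding conn_def[of \<epsilon> P J]
proof (induction rule: rtrancl_induct)
  case (step y z)
  then have "(y, z) \<in> conn \<epsilon> P' J'" using assms(2,3) unfolding same_def links_def by auto
  with step.IH show ?case by (rule conn_trans)
qed simp

lemma conn_coarsen:
  assumes "(p, q) \<in> conn \<epsilon> P' J'" "refines P' P" "\<And>e. e \<in> J' \<Longrightarrow> e \<in> J \<or> (\<exists>A\<in>P. \<epsilon> e \<subseteq> A)"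
  shows "(p, q) \<in> conn \<epsilon> P J"
  using assms(1)
proof (rule conn_least)
  show "(a, b) \<in> conn \<epsilon> P J" if A: "A \<in> P'" "a \<in> A" "b \<in> A" for A a b
  proof -
    obtain B where "B \<in> P" "A \<subseteq> B" using assms(2) A(1) unfolding refines_def by blast
    then show ?thesis using A by (intro conn_same[of B]) auto
  qed
  show "(a, b) \<in> conn \<epsilon> P J" if e: "e \<in> J'" "\<epsilon> e = {a, b}" for e a b
    using assms(3)[OF e(1)]
  proof
    assume "e \<in> J"
    then show ?thesis using e(2) by (rule conn_edge)
  next
    assume "\<exists>A\<in>P. \<epsilon> e \<subseteq> A"
    then obtain A where "A \<in> P" "\<epsilon> e \<subseteq> A" by blast
    then show ?thesis using e by (intro conn_same[of A]) auto
  qed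
qed

section \<open>The graphic matroid of a quotient\<close>

lemma conn_insert:
  assumes "(y, z) \<in> conn \<epsilon> P (insert e J)" "\<epsilon> e = {p, q}"
  shows "(y, z) \<in> conn \<epsilon> P J \<or> (y, p) \<in> conn \<epsilon> P J \<and> (q, z) \<in> conn \<epsilon> P J \<or>
    (y, q) \<in> conn \<epsilon> P J \<and> (p, z) \<in> conn \<epsilon> P J"
  using assms(1) unfolding conn_def[of \<epsilon> P "insert e J"]
proof (induction rule: rtrancl_induct)
  case (step a b)
  show ?case
  proof (cases "(a, b) \<in> conn \<epsilon> P J")
    case True
    then show ?thesis using step.IH by (meson conn_trans)
  next
    case False
    have "(a, b) \<notin> same P \<union> links \<epsilon> J" using False unfolding conn_def by blast
    then have "\<epsilon> e = {a, b}" using step.hyps(2) unfolding links_def by auto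
    then have "a = p \<and> b = q \<or> a = q \<and> b = p" using assms(2) by (auto simp: doubleton_eq_iff)
    then show ?thesis
    proof
      assume "a = p \<and> b = q"
      then show ?thesis using step.IH conn_refl conn_sym conn_trans by metis
    next
      assume "a = q \<and> b = p"
      then show ?thesis using step.IH conn_refl conn_sym conn_trans by metis
    qed
  qed
qed simp

text \<open>If some \<open>f\<close> in \<open>I\<close> ceased to be a bridge, the new connection
  between its ends would run through \<open>e\<close>; closing it up by \<open>f\<close> would join
  the ends of \<open>e\<close> within \<open>I\<close>.\<close>

lemma indep_insert:
  assumes I: "indep \<epsilon> P I" and e: "\<epsilon> e = {p, q}" "(p, q) \<notin> conn \<epsilon> P I"
  shows "indep \<epsilon> P (insert e I)"
  unfolding indep_def
proof (intro ballI allI impI notI)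
  fix f a b assume f: "f \<in> insert e I" "\<epsilon> f = {a, b}" "(a, b) \<in> conn \<epsilon> P (insert e I - {f})"
  show False
  proof (cases "f = e")
    case True
    then have "(a, b) \<in> conn \<epsilon> P I" using f(3) by (rule_tac conn_monoD) auto
    moreover have "a = p \<and> b = q \<or> a = q \<and> b = p" using f(2) e(1) True by (auto simp: doubleton_eq_iff)
    ultimately show False using e(2) conn_sym by metis
  next
    case False
    then have fI: "f \<in> I" using f(1) by simp
    have "insert e I - {f} = insert e (I - {f})" using False by auto
    then have cases: "(a, b) \<in> conn \<epsilon> P (I - {f}) \<or> (a, p) \<in> conn \<epsilon> P (I - {f}) \<and> (q, b) \<in> conn \<epsilon> P (I - {f}) \<or>
      (a, q) \<in> conn \<epsilon> P (I - {f}) \<and> (p, b) \<in> conn \<epsilon> P (I - {f})"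
      using conn_insert[of a b \<epsilon> P e "I - {f}" p q] f(3) e(1) by simp
    have nab: "(a, b) \<notin> conn \<epsilon> P (I - {f})" using I fI f(2) unfolding indep_def by blast
    have up: "(s, t) \<in> conn \<epsilon> P I" if "(s, t) \<in> conn \<epsilon> P (I - {f})" for s t
      using that by (rule conn_monoD) auto
    have ab: "(a, b) \<in> conn \<epsilon> P I" using fI f(2) by (rule conn_edge)
    from cases nab have "(a, p) \<in> conn \<epsilon> P I \<and> (q, b) \<in> conn \<epsilon> P I \<or> (a, q) \<in> conn \<epsilon> P I \<and> (p, b) \<in> conn \<epsilon> P I"
      using up by blast
    then have "(p, q) \<in> conn \<epsilon> P I"
    proof
      assume "(a, p) \<in> conn \<epsilon> P I \<and> (q, b) \<in> conn \<epsilon> P I"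
      then show ?thesis using ab conn_trans conn_sym by metis
    next
      assume "(a, q) \<in> conn \<epsilon> P I \<and> (p, b) \<in> conn \<epsilon> P I"
      then show ?thesis using ab conn_trans conn_sym by metis
    qed
    with e(2) show False ..
  qed
qed

text \<open>Extension of an independent set to a basis of \<open>J\<close>; a set of maximal size
  spans, since any edge with unconnected ends could be added.\<close>

lemma indep_extend:
  assumes "finite J" "I \<subseteq> J" "indep \<epsilon> P I" and ends: "\<And>e. e \<in> J \<Longrightarrow> \<exists>p q. \<epsilon> e = {p, q}"
  obtains M where "I \<subseteq> M" "M \<subseteq> J" "indep \<epsilon> P M" "conn \<epsilon> P M = conn \<epsilon> P J"
proof -
  let ?Q = "\<lambda>M. I \<subseteq> M \<and> M \<subseteq> J \<and> indep \<epsilon> P M"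
  have "\<forall>M. ?Q M \<longrightarrow> card M < Suc (card J)" using card_mono[OF assms(1)] by (simp add: less_Suc_eq_le)
  moreover have "?Q I" using assms by simp
  ultimately obtain M where M: "?Q M" and max: "\<forall>M'. ?Q M' \<longrightarrow> card M' \<le> card M"
    using ex_has_greatest_nat[of ?Q I card "Suc (card J)"] by blast
  have finM: "finite M" using M assms(1) finite_subset by blast
  have edge: "(p, q) \<in> conn \<epsilon> P M" if e: "e \<in> J" "\<epsilon> e = {p, q}" for e p q
  proof (rule ccontr)
    assume neg: "(p, q) \<notin> conn \<epsilon> P M"
    have "indep \<epsilon> P M" using M by simp
    then have "indep \<epsilon> P (insert e M)" using e(2) neg by (rule indep_insert)
    then have "?Q (insert e M)" using M e(1) by auto
    then have "card (insert e M) \<le> card M" using max[rule_format] by simp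
    then have "e \<in> M" using finM by (simp add: card_insert_if split: if_splits)
    then have "(p, q) \<in> conn \<epsilon> P M" using e(2) by (rule conn_edge)
    with neg show False ..
  qed
  have "(p, q) \<in> conn \<epsilon> P M" if "(p, q) \<in> conn \<epsilon> P J" for p q
    using that by (rule conn_least) (use conn_same edge in metis)+
  moreover have "conn \<epsilon> P M \<subseteq> conn \<epsilon> P J" using M by (intro conn_mono) blast
  ultimately have "conn \<epsilon> P M = conn \<epsilon> P J" by auto
  with M that show ?thesis by blast
qed

text \<open>This allows a tree to be refined cell by cell: a forest of the coarse quotient and
  forests inside its cells never close a cycle together.\<close>

lemma indep_refine:
  assumes "finite T" and T: "indep \<epsilon> P T" and ref: "refines P' P" and M: "indep \<epsilon> P' M"
    and inside: "\<And>e. e \<in> M \<Longrightarrow> \<exists>A\<in>P. \<epsilon> e \<subseteq> A" and two: "\<And>e. e \<in> T \<Longrightarrow> \<exists>p q. \<epsilon> e = {p, q}"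
  shows "indep \<epsilon> P' (T \<union> M)"
  unfolding indep_def
proof (intro ballI allI impI notI)
  \<comment> \<open>A connection between two vertices of one cell of \<open>P\<close> can do without
    any \<open>f\<close> in \<open>T\<close>: if \<open>f\<close> were indispensable, its ends would
    be joined in the coarse quotient without \<open>f\<close> by going round through the
    cell.\<close>
  have drop: "(y, z) \<in> conn \<epsilon> P' R"
    if "finite S" "S \<subseteq> T" "R \<subseteq> M" "A \<in> P" "y \<in> A" "z \<in> A" "(y, z) \<in> conn \<epsilon> P' (S \<union> R)" for S R A y z
    using that
  proof (induction S)
    case empty
    then show ?case by simp
  next
    case (insert f S)
    obtain p q where f: "\<epsilon> f = {p, q}" using two insert.prems(1) by blast
    have "(y, z) \<in> conn \<epsilon> P' (S \<union> R)"
    proof (rule ccontr)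
      assume "(y, z) \<notin> conn \<epsilon> P' (S \<union> R)"
      then have pq: "(y, p) \<in> conn \<epsilon> P' (S \<union> R) \<and> (q, z) \<in> conn \<epsilon> P' (S \<union> R) \<or>
        (y, q) \<in> conn \<epsilon> P' (S \<union> R) \<and> (p, z) \<in> conn \<epsilon> P' (S \<union> R)"
        using conn_insert[of y z \<epsilon> P' f "S \<union> R" p q] insert.prems(6) f by simp
      have coarse: "(a, b) \<in> conn \<epsilon> P (T - {f})" if "(a, b) \<in> conn \<epsilon> P' (S \<union> R)" for a b
        using that ref by (rule conn_coarsen) (use insert.hyps(2) insert.prems inside in blast)
      have "(z, y) \<in> conn \<epsilon> P (T - {f})" using insert.prems(3,4,5) by (intro conn_same)
      then have "(p, q) \<in> conn \<epsilon> P (T - {f})"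
        using pq coarse conn_sym conn_trans by metis
      then show False using T f insert.prems(1) unfolding indep_def by blast
    qed
    then show ?case using insert by blast
  qed
  fix e p q assume e: "e \<in> T \<union> M" "\<epsilon> e = {p, q}" "(p, q) \<in> conn \<epsilon> P' (T \<union> M - {e})"
  show False
  proof (cases "\<exists>A\<in>P. \<epsilon> e \<subseteq> A")
    case True
    then obtain A where A: "A \<in> P" "p \<in> A" "q \<in> A" using e(2) by auto
    have "e \<notin> T"
    proof
      assume "e \<in> T"
      moreover have "(p, q) \<in> conn \<epsilon> P (T - {e})" using A by (rule conn_same)
      ultimately show False using T e(2) unfolding indep_def by blast
    qed
    then have "e \<in> M" "T \<union> M - {e} = T \<union> (M - {e})" using e(1) by auto
    then have "(p, q) \<in> conn \<epsilon> P' (M - {e})" using drop[OF assms(1), of "M - {e}" A p q] A e(3) by auto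
    with M \<open>e \<in> M\<close> e(2) show False unfolding indep_def by blast
  next
    case False
    then have "e \<in> T" using e(1) inside by blast
    moreover have "(p, q) \<in> conn \<epsilon> P (T - {e})"
      using e(3) ref by (rule conn_coarsen) (use inside in blast)
    ultimately show False using T e(2) unfolding indep_def by blast
  qed
qed

lemma conn_partition_mono: "P \<subseteq> P' \<Longrightarrow> conn \<epsilon> P J \<subseteq> conn \<epsilon> P' J"
  unfolding conn_def same_def by (intro rtrancl_mono) blast

text \<open>An edge \<open>e\<close> of a minimal connection \<open>J\<close> has \<open>y\<close>
  and \<open>z\<close> on different sides, so a connection in \<open>T - {e}\<close> would close up
  to one between the ends of \<open>e\<close>. Admitting \<open>P' \<subseteq> P\<close> lets an
  actual path, with \<open>P' = {}\<close>, be compared with separation in a quotient.\<close>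

lemma conn_minimal_subset_separates:
  assumes T: "indep \<epsilon> P T" and "P' \<subseteq> P" and "finite T" and ends: "\<And>e. e \<in> T \<Longrightarrow> \<exists>p q. \<epsilon> e = {p, q}"
    and yz: "(y, z) \<in> conn \<epsilon> P' T"
  obtains J where "J \<subseteq> T" "(y, z) \<in> conn \<epsilon> P' J" "\<And>e. e \<in> J \<Longrightarrow> (y, z) \<notin> conn \<epsilon> P (T - {e})"
proof -
  let ?Q = "\<lambda>J. J \<subseteq> T \<and> (y, z) \<in> conn \<epsilon> P' J"
  have "?Q T" using yz by simp
  then obtain J where J: "?Q J" and least: "\<And>J'. ?Q J' \<Longrightarrow> card J \<le> card J'"
    using ex_has_least_nat[of ?Q T card] by blast
  have "(y, z) \<notin> conn \<epsilon> P (T - {e})" if e: "e \<in> J" for e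
  proof
    assume T': "(y, z) \<in> conn \<epsilon> P (T - {e})"
    have "finite J" using J \<open>finite T\<close> finite_subset by blast
    then have "card (J - {e}) < card J" using e by (rule card_Diff1_less)
    then have neg: "(y, z) \<notin> conn \<epsilon> P' (J - {e})" using least[of "J - {e}"] J by auto
    obtain p q where pq: "\<epsilon> e = {p, q}" using ends e J by blast
    have "insert e (J - {e}) = J" using e by auto
    then have "(y, p) \<in> conn \<epsilon> P' (J - {e}) \<and> (q, z) \<in> conn \<epsilon> P' (J - {e}) \<or>
        (y, q) \<in> conn \<epsilon> P' (J - {e}) \<and> (p, z) \<in> conn \<epsilon> P' (J - {e})"
      using conn_insert[of y z \<epsilon> P' e "J - {e}" p q] J neg pq by simp
    moreover have up: "(s, t) \<in> conn \<epsilon> P (T - {e})" if "(s, t) \<in> conn \<epsilon> P' (J - {e})" for s t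
    proof -
      have "(s, t) \<in> conn \<epsilon> P (J - {e})" using that conn_partition_mono[OF \<open>P' \<subseteq> P\<close>] by blast
      then show ?thesis by (rule conn_monoD) (use J in blast)
    qed
    ultimately have "(p, q) \<in> conn \<epsilon> P (T - {e})" using T' conn_sym conn_trans by metis
    moreover have "e \<in> T" using e J by blast
    ultimately show False using T pq unfolding indep_def by blast
  qed
  with J that show ?thesis by blast
qed

section \<open>Regions and solid sets\<close>

lemma adjacency_eq: "adjacency H = links (endpts H) (edges H)"
  unfolding adjacency_def links_def ..

lemma card_members_meeting:
  assumes "finite S" and disj: "\<And>A B. A \<in> P \<Longrightarrow> B \<in> P \<Longrightarrow> A \<noteq> B \<Longrightarrow> A \<inter> B = {}"
  shows "card {A \<in> P. A \<inter> S \<noteq> {}} \<le> card S"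
proof (rule card_inj_on_le[of "\<lambda>A. SOME p. p \<in> A \<inter> S"])
  have *: "(SOME p. p \<in> A \<inter> S) \<in> A \<inter> S" if "A \<inter> S \<noteq> {}" for A
    using that by (intro some_in_eq[THEN iffD2])
  show "inj_on (\<lambda>A. SOME p. p \<in> A \<inter> S) {A \<in> P. A \<inter> S \<noteq> {}}"
  proof (rule inj_onI)
    fix A B assume AB: "A \<in> {A \<in> P. A \<inter> S \<noteq> {}}" "B \<in> {A \<in> P. A \<inter> S \<noteq> {}}"
      "(SOME p. p \<in> A \<inter> S) = (SOME p. p \<in> B \<inter> S)"
    then have "(SOME p. p \<in> A \<inter> S) \<in> A \<inter> B" using *[of A] *[of B] by auto
    then show "A = B" using disj AB by blast
  qed
  show "(\<lambda>A. SOME p. p \<in> A \<inter> S) ` {A \<in> P. A \<inter> S \<noteq> {}} \<subseteq> S" using * by auto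
  show "finite S" by fact
qed

text \<open>The number of trees is \<open>j\<close>, so \<open>Suc j\<close> is the \<open>k\<close> of the theorem.\<close>

locale highly_connected_graph =
  fixes G :: "('v, 'e) mgraph" and j :: nat
  assumes multi: "multigraph G" and locfin: "locally_finite G"
    and econn: "edge_connected (2 * Suc j) G"
begin

abbreviation "V \<equiv> verts G"
abbreviation "E \<equiv> edges G"
abbreviation "\<epsilon> \<equiv> endpts G"

definition bd :: "'v set \<Rightarrow> 'e set" where
  "bd A = {e \<in> E. \<epsilon> e \<inter> A \<noteq> {} \<and> \<not> \<epsilon> e \<subseteq> A}"

definition inside :: "'v set \<Rightarrow> 'e set" where
  "inside A = {e \<in> E. \<epsilon> e \<subseteq> A}"

text \<open>A finite boundary forces every ray to settle on one side, and it makes quotients by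
  finitely many such sets finite graphs.\<close>

definition region :: "'v set \<Rightarrow> bool" where
  "region A \<longleftrightarrow> A \<subseteq> V \<and> finite (bd A)"

text \<open>The edge set of the quotient of the subgraph induced by \<open>X\<close>; the boundary
  edges of \<open>X\<close> are left out.\<close>

definition crossing :: "'v set \<Rightarrow> 'v set set \<Rightarrow> 'e set" where
  "crossing X P = {e \<in> inside X. \<not> (\<exists>A\<in>P. \<epsilon> e \<subseteq> A)}"

definition region_partition :: "'v set \<Rightarrow> 'v set set \<Rightarrow> bool" where
  "region_partition X P \<longleftrightarrow> finite P \<and> partition_on X P \<and> (\<forall>A\<in>P. region A)"

text \<open>This is the condition of Tutte and Nash-Williams for \<open>Suc j\<close> edge disjoint spanning trees in
  every finite quotient of the subgraph induced by \<open>X\<close>.\<close>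

definition solid :: "'v set \<Rightarrow> bool" where
  "solid X \<longleftrightarrow> X \<noteq> {} \<and> region X \<and>
    (\<forall>P. region_partition X P \<longrightarrow> Suc j * (card P - 1) \<le> card (crossing X P))"

section \<open>Finite cuts and partitions into regions\<close>

lemma edge_ends:
  assumes "e \<in> E"
  obtains p q where "\<epsilon> e = {p, q}" "p \<noteq> q" "p \<in> V" "q \<in> V"
proof -
  have "\<epsilon> e \<subseteq> V" "card (\<epsilon> e) = 2" using multi assms unfolding multigraph_def by auto
  then show ?thesis using that by (auto simp: card_2_iff)
qed

lemma edge_two: "e \<in> E \<Longrightarrow> \<exists>p q. \<epsilon> e = {p, q}"
  using edge_ends by metis

lemma connectedV: "p \<in> V \<Longrightarrow> q \<in> V \<Longrightarrow> (p, q) \<in> (links \<epsilon> E)\<^sup>*"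
  using econn unfolding edge_connected_def connected_graph_def adjacency_eq by blast

lemma finite_incident: "finite K \<Longrightarrow> K \<subseteq> V \<Longrightarrow> finite {e \<in> E. \<epsilon> e \<inter> K \<noteq> {}}"
proof -
  assume K: "finite K" "K \<subseteq> V"
  have "{e \<in> E. \<epsilon> e \<inter> K \<noteq> {}} = (\<Union>v\<in>K. {e \<in> E. v \<in> \<epsilon> e})" by auto
  moreover have "finite {e \<in> E. v \<in> \<epsilon> e}" if "v \<in> K" for v
    using locfin K that unfolding locally_finite_def by auto
  ultimately show ?thesis using K by simp
qed

lemma region_finite: "finite K \<Longrightarrow> K \<subseteq> V \<Longrightarrow> region K"
proof -
  assume K: "finite K" "K \<subseteq> V"
  have "bd K \<subseteq> {e \<in> E. \<epsilon> e \<inter> K \<noteq> {}}" unfolding bd_def by auto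
  then show ?thesis using finite_incident[OF K] K(2) finite_subset unfolding region_def by blast
qed

lemma region_V: "region V"
proof -
  have "bd V = {}" using multi unfolding bd_def multigraph_def by auto
  then show ?thesis unfolding region_def by simp
qed

lemma region_Diff: "region A \<Longrightarrow> region B \<Longrightarrow> region (A - B)"
proof -
  assume "region A" "region B"
  moreover have "bd (A - B) \<subseteq> bd A \<union> bd B" unfolding bd_def by auto
  ultimately show ?thesis unfolding region_def by (meson Diff_subset finite_Un finite_subset order_trans)
qed

lemma region_Union: "finite Q \<Longrightarrow> \<forall>A\<in>Q. region A \<Longrightarrow> region (\<Union>Q)"
proof -
  assume Q: "finite Q" "\<forall>A\<in>Q. region A"
  have "bd (\<Union>Q) \<subseteq> (\<Union>A\<in>Q. bd A)" unfolding bd_def by auto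
  moreover have "finite (\<Union>A\<in>Q. bd A)" using Q unfolding region_def by auto
  ultimately show ?thesis using Q unfolding region_def by (meson Union_least finite_subset)
qed

lemma region_partitionD:
  assumes "region_partition X P"
  shows "finite P" "\<Union>P = X" "\<And>A. A \<in> P \<Longrightarrow> A \<noteq> {}" "\<And>A. A \<in> P \<Longrightarrow> A \<subseteq> X" "\<And>A. A \<in> P \<Longrightarrow> region A"
    "\<And>A B. A \<in> P \<Longrightarrow> B \<in> P \<Longrightarrow> A \<noteq> B \<Longrightarrow> A \<inter> B = {}"
  using assms unfolding region_partition_def partition_on_def disjoint_def by auto

lemma region_partitionI:
  assumes "finite P" "\<Union>P = X" "\<And>A. A \<in> P \<Longrightarrow> A \<noteq> {}" "\<And>A. A \<in> P \<Longrightarrow> region A"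
    "\<And>A B. A \<in> P \<Longrightarrow> B \<in> P \<Longrightarrow> A \<noteq> B \<Longrightarrow> A \<inter> B = {}"
  shows "region_partition X P"
  using assms unfolding region_partition_def partition_on_def disjoint_def by auto

lemma region_partition_replace:
  assumes "region_partition X P" "A \<in> P" "region_partition A Q"
  shows "region_partition X ((P - {A}) \<union> Q)"
proof (rule region_partitionI)
  note P = region_partitionD[OF assms(1)] and Q = region_partitionD[OF assms(3)]
  have disj: "B \<inter> C = {}" if "B \<in> P - {A}" "C \<in> Q" for B C
    using that P(6)[OF _ assms(2)] Q(4) by blast
  show "finite ((P - {A}) \<union> Q)" using P(1) Q(1) by simp
  show "\<Union>((P - {A}) \<union> Q) = X" using P(2) Q(2) assms(2) by auto
  show "B \<noteq> {}" "region B" if "B \<in> (P - {A}) \<union> Q" for B using that P(3,5) Q(3,5) by auto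
  show "B \<inter> C = {}" if "B \<in> (P - {A}) \<union> Q" "C \<in> (P - {A}) \<union> Q" "B \<noteq> C" for B C
    using that P(6) Q(6) disj by (metis DiffD1 Int_commute Un_iff)
qed

lemma finite_crossing:
  assumes "region_partition X P"
  shows "finite (crossing X P)"
proof -
  note P = region_partitionD[OF assms]
  have "crossing X P \<subseteq> (\<Union>A\<in>P. bd A)"
  proof
    fix e assume e: "e \<in> crossing X P"
    then have eE: "e \<in> E" "\<epsilon> e \<subseteq> X" unfolding crossing_def inside_def by auto
    then obtain p q where pq: "\<epsilon> e = {p, q}" using edge_two by blast
    then obtain A where "A \<in> P" "p \<in> A" using eE P(2) by auto
    moreover have "\<not> \<epsilon> e \<subseteq> A" using e \<open>A \<in> P\<close> unfolding crossing_def by blast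
    ultimately show "e \<in> (\<Union>A\<in>P. bd A)" using pq eE unfolding bd_def by auto
  qed
  moreover have "finite (\<Union>A\<in>P. bd A)" using P(1,5) unfolding region_def by auto
  ultimately show ?thesis by (rule finite_subset)
qed

section \<open>Counting edges across a partition\<close>

lemma card_bd_ge:
  assumes A: "A \<subseteq> V" "A \<noteq> {}" "A \<noteq> V" and fin: "finite (bd A)"
  shows "2 * Suc j \<le> card (bd A)"
proof (rule ccontr)
  assume "\<not> 2 * Suc j \<le> card (bd A)"
  moreover have "bd A \<subseteq> E" unfolding bd_def by auto
  ultimately have c: "connected_graph (delete_edges G (bd A))"
    using econn fin unfolding edge_connected_def by auto
  obtain p q where pq: "p \<in> A" "q \<in> V" "q \<notin> A" using A by blast
  then have "(p, q) \<in> (links \<epsilon> (E - bd A))\<^sup>*"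
    using c A(1) unfolding connected_graph_def adjacency_eq delete_edges_def by auto
  then obtain a b where "(a, b) \<in> links \<epsilon> (E - bd A)" "a \<in> A" "b \<notin> A"
    using rtrancl_exit[OF _ pq(1,3)] by blast
  then show False unfolding links_def bd_def by auto
qed

text \<open>An edge lies in the boundaries of at most as many parts as it has ends in
  \<open>X\<close>: two for a crossing edge, one for a boundary edge of \<open>X\<close>.\<close>

lemma sum_card_bd:
  assumes part: "region_partition X P" and X: "region X"
  shows "(\<Sum>A\<in>P. card (bd A)) \<le> 2 * card (crossing X P) + card (bd X)"
proof -
  note P = region_partitionD[OF part]
  define F where "F = crossing X P \<union> bd X"
  have finF: "finite F" using finite_crossing[OF part] X unfolding F_def region_def by auto
  have bdF: "bd A \<subseteq> F" if "A \<in> P" for A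
  proof
    fix e assume e: "e \<in> bd A"
    then have "\<not> (\<exists>B\<in>P. \<epsilon> e \<subseteq> B)" using P(6)[OF that] that unfolding bd_def by blast
    then show "e \<in> F" using e P(4)[OF that] unfolding F_def crossing_def inside_def bd_def by blast
  qed
  have "(\<Sum>A\<in>P. card (bd A)) = (\<Sum>A\<in>P. \<Sum>e\<in>F. of_bool (e \<in> bd A))"
  proof (rule sum.cong)
    fix A assume "A \<in> P"
    then have "{e \<in> F. e \<in> bd A} = bd A" using bdF by blast
    then show "card (bd A) = (\<Sum>e\<in>F. of_bool (e \<in> bd A))" using card_filter_sum[OF finF, of "\<lambda>e. e \<in> bd A"] by simp
  qed simp
  also have "\<dots> = (\<Sum>e\<in>F. \<Sum>A\<in>P. of_bool (e \<in> bd A))" by (rule sum.swap)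
  also have "\<dots> = (\<Sum>e\<in>F. card {A \<in> P. e \<in> bd A})" by (simp add: card_filter_sum[OF P(1)])
  also have "\<dots> \<le> (\<Sum>e\<in>F. 2 * of_bool (e \<in> crossing X P) + of_bool (e \<in> bd X))"
  proof (rule sum_mono)
    fix e assume e: "e \<in> F"
    then have eE: "e \<in> E" unfolding F_def crossing_def inside_def bd_def by auto
    then obtain p q where pq: "\<epsilon> e = {p, q}" "p \<noteq> q" using edge_ends by metis
    have "{A \<in> P. e \<in> bd A} \<subseteq> {A \<in> P. A \<inter> (\<epsilon> e \<inter> X) \<noteq> {}}" using P(4) unfolding bd_def by blast
    then have "card {A \<in> P. e \<in> bd A} \<le> card {A \<in> P. A \<inter> (\<epsilon> e \<inter> X) \<noteq> {}}" using P(1) by (intro card_mono) auto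
    also have "\<dots> \<le> card (\<epsilon> e \<inter> X)" by (rule card_members_meeting) (use pq P(6) in auto)
    also have "\<dots> \<le> 2 * of_bool (e \<in> crossing X P) + of_bool (e \<in> bd X)"
    proof (cases "e \<in> crossing X P")
      case True
      then show ?thesis using card_mono[of "{p, q}" "\<epsilon> e \<inter> X"] pq by auto
    next
      case False
      then have "e \<in> bd X" using e unfolding F_def by auto
      then have "\<epsilon> e \<inter> X \<subset> \<epsilon> e" unfolding bd_def by auto
      then have "card (\<epsilon> e \<inter> X) < card (\<epsilon> e)" using pq by (intro psubset_card_mono) auto
      then show ?thesis using pq \<open>e \<in> bd X\<close> by simp
    qed
    finally show "card {A \<in> P. e \<in> bd A} \<le> 2 * of_bool (e \<in> crossing X P) + of_bool (e \<in> bd X)" .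
  qed
  also have "\<dots> = 2 * card {e \<in> F. e \<in> crossing X P} + card {e \<in> F. e \<in> bd X}"
    by (simp only: sum.distrib card_filter_sum[OF finF] sum_distrib_left)
  also have "{e \<in> F. e \<in> crossing X P} = crossing X P" unfolding F_def by auto
  also have "{e \<in> F. e \<in> bd X} = bd X" unfolding F_def by auto
  finally show ?thesis .
qed

lemma card_parts_le:
  assumes part: "region_partition X P" and "region X" and "V \<notin> P"
  shows "2 * Suc j * card P \<le> 2 * card (crossing X P) + card (bd X)"
proof -
  note P = region_partitionD[OF part]
  have "2 * Suc j \<le> card (bd A)" if "A \<in> P" for A
    by (rule card_bd_ge) (use P(3,5)[OF that] assms(3) that in \<open>auto simp: region_def\<close>)
  then have "(\<Sum>A\<in>P. 2 * Suc j) \<le> (\<Sum>A\<in>P. card (bd A))" by (rule sum_mono)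
  then have "2 * Suc j * card P \<le> (\<Sum>A\<in>P. card (bd A))"
    unfolding sum_constant of_nat_id by (subst mult.commute)
  then show ?thesis using sum_card_bd[OF part assms(2)] by (rule le_trans)
qed

lemma V_nonempty: "V \<noteq> {}"
  using locfin unfolding locally_finite_def by auto

text \<open>Here the edge connectivity \<open>2 * Suc j\<close> is spent: each crossing edge is seen
  from both sides, so \<open>Suc j\<close> edges per part remain.\<close>

lemma solid_V: "solid V"
  unfolding solid_def
proof (intro conjI allI impI V_nonempty region_V)
  fix P assume part: "region_partition V P"
  note P = region_partitionD[OF part]
  have bdV: "bd V = {}" using multi unfolding bd_def multigraph_def by auto
  show "Suc j * (card P - 1) \<le> card (crossing V P)"
  proof (cases "V \<in> P")
    case True
    have "A = V" if "A \<in> P" for A using P(3,4,6) that True by blast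
    then have "P = {V}" using True by blast
    then show ?thesis by simp
  next
    case False
    then have "2 * (Suc j * card P) \<le> 2 * card (crossing V P)"
      using card_parts_le[OF part region_V False] unfolding bdV by (simp only: card.empty add_0_right mult.assoc)
    then have "Suc j * card P \<le> card (crossing V P)" by (simp only: mult_le_cancel1)
    moreover have "Suc j * (card P - 1) \<le> Suc j * card P" by (intro mult_le_mono2) simp
    ultimately show ?thesis by (rule le_trans[rotated])
  qed
qed

lemma solid_region: "solid X \<Longrightarrow> region X"
  unfolding solid_def by simp

text \<open>Splitting a cell \<open>A\<close> of a minimiser by \<open>Q\<close> adds
  \<open>card Q - 1\<close> parts and at most the edges of \<open>crossing A Q\<close>, so
  minimality is the solidity inequality for \<open>A\<close>. The condition
  \<open>U \<noteq> V\<close> keeps \<open>V\<close> from being a part: its boundary is empty, and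
  the lower bound behind the minimisation needs large boundaries.\<close>

lemma solid_partition:
  assumes U: "region U" "U \<noteq> V"
  obtains P where "region_partition U P" "\<And>A. A \<in> P \<Longrightarrow> solid A"
proof (cases "U = {}")
  case True
  have "region_partition U {}" unfolding True by (rule region_partitionI) auto
  then show ?thesis using that by blast
next
  case False
  have nV: "V \<notin> P" if "region_partition U P" for P
    using region_partitionD(4)[OF that, of V] U unfolding region_def by blast
  \<comment> \<open>minimises \<open>card (crossing U P) - Suc j * card P\<close>; doubling and adding \<open>card (bd U)\<close> makes it a
    natural number by \<open>card_parts_le\<close>\<close>
  define f where "f P = 2 * card (crossing U P) + card (bd U) - 2 * Suc j * card P" for P
  have "region_partition U {U}" by (rule region_partitionI) (use False U in auto)
  then obtain P where P: "region_partition U P" and least: "\<And>Q. region_partition U Q \<Longrightarrow> f P \<le> f Q"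
    using ex_has_least_nat[of "region_partition U" _ f] by blast
  note PD = region_partitionD[OF P]
  have "solid A" if A: "A \<in> P" for A
    unfolding solid_def
  proof (intro conjI allI impI)
    show "A \<noteq> {}" "region A" using PD A by auto
    fix Q assume Q: "region_partition A Q"
    note QD = region_partitionD[OF Q]
    let ?R = "(P - {A}) \<union> Q"
    note part = region_partition_replace[OF P A Q]
    have PQ: "(P - {A}) \<inter> Q = {}" using QD(3,4) PD(6)[OF _ A] by fastforce
    have cardR: "card ?R = card P - 1 + card Q" using card_Un_disjoint[OF _ QD(1) PQ] PD(1) A by simp
    have "crossing U ?R \<subseteq> crossing U P \<union> crossing A Q"
      unfolding crossing_def inside_def by blast
    then have "card (crossing U ?R) \<le> card (crossing U P \<union> crossing A Q)"
      using finite_crossing[OF P] finite_crossing[OF Q] by (intro card_mono) auto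
    also have "\<dots> \<le> card (crossing U P) + card (crossing A Q)" by (rule card_Un_le)
    finally have cr: "card (crossing U ?R) \<le> card (crossing U P) + card (crossing A Q)" .
    have cP: "1 \<le> card P" using PD(1) A by (simp add: Suc_le_eq card_gt_0_iff) blast
    define p where "p = Suc j * card P"
    define r where "r = Suc j * (card P - 1 + card Q)"
    have pp: "2 * Suc j * card P = 2 * p" unfolding p_def by (simp only: mult.assoc)
    have rr: "2 * Suc j * card ?R = 2 * r" unfolding r_def cardR by (simp only: mult.assoc)
    have "f P \<le> f ?R" using least part by blast
    moreover have "2 * p \<le> 2 * card (crossing U P) + card (bd U)"
      using card_parts_le[OF P U(1) nV[OF P]] unfolding pp .
    moreover have "2 * r \<le> 2 * card (crossing U ?R) + card (bd U)"
      using card_parts_le[OF part U(1) nV[OF part]] unfolding rr .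
    ultimately have "r \<le> p + card (crossing A Q)" using cr unfolding f_def pp rr by linarith
    moreover have "r + Suc j = p + Suc j * card Q" unfolding r_def p_def using cP
      by (metis (no_types, lifting) add.assoc add.commute add_mult_distrib2 le_add_diff_inverse2 mult.right_neutral)
    ultimately have "Suc j * card Q \<le> Suc j + card (crossing A Q)" by linarith
    then show "Suc j * (card Q - 1) \<le> card (crossing A Q)" by (simp add: diff_mult_distrib2)
  qed
  with P that show ?thesis by blast
qed

lemma inside_mono: "A \<subseteq> B \<Longrightarrow> inside A \<subseteq> inside B"
  unfolding inside_def by auto

lemma component_region:
  assumes X: "region X" and p: "p \<in> X" and C: "C = {q. (p, q) \<in> (links \<epsilon> (inside X))\<^sup>*}"
  shows "C \<subseteq> X" "region C" "\<And>e. e \<in> inside X \<Longrightarrow> \<epsilon> e \<inter> C \<noteq> {} \<Longrightarrow> \<epsilon> e \<subseteq> C"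
proof -
  show CX: "C \<subseteq> X"
  proof
    fix q assume "q \<in> C"
    then have "(p, q) \<in> (links \<epsilon> (inside X))\<^sup>*" using C by simp
    then show "q \<in> X" using p by (rule rtrancl_closed_induct) (auto simp: links_def inside_def)
  qed
  show closed: "\<epsilon> e \<subseteq> C" if e: "e \<in> inside X" "\<epsilon> e \<inter> C \<noteq> {}" for e
  proof -
    have eE: "e \<in> E" using e(1) unfolding inside_def by simp
    obtain p' q' where pq: "\<epsilon> e = {p', q'}" using edge_two[OF eE] by blast
    have "\<exists>a b. \<epsilon> e = {a, b} \<and> a \<in> C"
    proof (cases "p' \<in> C")
      case False
      then have "q' \<in> C" using pq e(2) by auto
      then show ?thesis using pq insert_commute[of p' q'] by metis
    qed (use pq in blast)
    then obtain a b where ab: "\<epsilon> e = {a, b}" "a \<in> C" by blast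
    then have "(a, b) \<in> links \<epsilon> (inside X)" using e(1) unfolding links_def by blast
    then have "b \<in> C" using ab(2) unfolding C by (auto intro: rtrancl_into_rtrancl)
    then show ?thesis using ab by simp
  qed
  have "bd C \<subseteq> bd X" using CX closed unfolding bd_def inside_def by blast
  then show "region C" using X CX finite_subset unfolding region_def by blast
qed

text \<open>Otherwise a component \<open>C\<close> gives the two-part partition
  \<open>{C, X - C}\<close> without crossing edges.\<close>

lemma solid_connected:
  assumes X: "solid X" and pq: "p \<in> X" "q \<in> X"
  shows "(p, q) \<in> (links \<epsilon> (inside X))\<^sup>*"
proof (rule ccontr)
  assume neg: "(p, q) \<notin> (links \<epsilon> (inside X))\<^sup>*"
  define C where "C = {q. (p, q) \<in> (links \<epsilon> (inside X))\<^sup>*}"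
  note C = component_region[OF solid_region[OF X] pq(1) C_def]
  have nC: "p \<in> C" "q \<notin> C" using neg unfolding C_def by auto
  have "region_partition X {C, X - C}"
    by (rule region_partitionI) (use C(1,2) pq nC region_Diff[OF solid_region[OF X] C(2)] in auto)
  then have "Suc j * (card {C, X - C} - 1) \<le> card (crossing X {C, X - C})"
    using X unfolding solid_def by blast
  moreover have "\<epsilon> e \<subseteq> C \<or> \<epsilon> e \<subseteq> X - C" if "e \<in> inside X" for e
    using C(3)[OF that] that unfolding inside_def by auto
  then have "crossing X {C, X - C} = {}" unfolding crossing_def by auto
  moreover have "C \<noteq> X - C" using nC by blast
  ultimately show False by simp
qed

text \<open>Balls around a vertex are finite by local finiteness and exhaust \<open>V\<close> by
  connectedness.\<close>

lemma countable_V: "countable V"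
proof -
  obtain v0 where v0: "v0 \<in> V" using V_nonempty by blast
  have nb: "links \<epsilon> E `` K \<subseteq> V \<and> finite (links \<epsilon> E `` K)" if K: "finite K" "K \<subseteq> V" for K
  proof -
    have "links \<epsilon> E `` K \<subseteq> (\<Union>e\<in>{e \<in> E. \<epsilon> e \<inter> K \<noteq> {}}. \<epsilon> e)" unfolding links_def by blast
    moreover have "finite (\<epsilon> e) \<and> \<epsilon> e \<subseteq> V" if "e \<in> E" for e
    proof -
      obtain p q where "\<epsilon> e = {p, q}" "p \<in> V" "q \<in> V" using edge_ends[OF \<open>e \<in> E\<close>] by metis
      then show ?thesis by simp
    qed
    then have "finite (\<Union>e\<in>{e \<in> E. \<epsilon> e \<inter> K \<noteq> {}}. \<epsilon> e)" "(\<Union>e\<in>{e \<in> E. \<epsilon> e \<inter> K \<noteq> {}}. \<epsilon> e) \<subseteq> V"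
      using finite_incident[OF K] by auto
    ultimately show ?thesis using finite_subset by blast
  qed
  have "(links \<epsilon> E ^^ n) `` {v0} \<subseteq> V \<and> finite ((links \<epsilon> E ^^ n) `` {v0})" for n
  proof (induction n)
    case (Suc n)
    then show ?case using nb[of "(links \<epsilon> E ^^ n) `` {v0}"] by (simp add: relcomp_Image)
  qed (use v0 in auto)
  then have "countable (\<Union>n. (links \<epsilon> E ^^ n) `` {v0})" by (simp add: countable_finite)
  moreover have "V \<subseteq> (\<Union>n. (links \<epsilon> E ^^ n) `` {v0})"
    using connectedV[OF v0] by (auto simp: rtrancl_is_UN_relpow)
  ultimately show ?thesis by (rule countable_subset[rotated])
qed

end

section \<open>Quotients and their spanning trees\<close>

lemma conn_restrict:
  assumes "(p, q) \<in> conn \<epsilon> P J" "p \<in> A" "\<And>B. B \<in> P \<Longrightarrow> B \<subseteq> A \<or> B \<inter> A = {}" "\<And>e. e \<in> J \<Longrightarrow> \<epsilon> e \<subseteq> A"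
  shows "(p, q) \<in> conn \<epsilon> {B \<in> P. B \<subseteq> A} J"
proof -
  have "q \<in> A \<and> (p, q) \<in> conn \<epsilon> {B \<in> P. B \<subseteq> A} J"
    using assms(1) unfolding conn_def[of \<epsilon> P J]
  proof (induction rule: rtrancl_induct)
    case (step a b)
    from step.hyps(2) show ?case
    proof
      assume "(a, b) \<in> same P"
      then obtain B where B: "B \<in> P" "a \<in> B" "b \<in> B" unfolding same_def by auto
      then have "B \<subseteq> A" using assms(3) step.IH by blast
      then have "(a, b) \<in> conn \<epsilon> {B \<in> P. B \<subseteq> A} J" using B by (intro conn_same[of B]) auto
      from conn_trans[OF conjunct2[OF step.IH] this] show ?thesis using B \<open>B \<subseteq> A\<close> by blast
    next
      assume "(a, b) \<in> links \<epsilon> J"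
      then obtain e where e: "e \<in> J" "\<epsilon> e = {a, b}" unfolding links_def by auto
      then have "(a, b) \<in> conn \<epsilon> {B \<in> P. B \<subseteq> A} J" by (rule conn_edge)
      from conn_trans[OF conjunct2[OF step.IH] this] show ?thesis using assms(4)[OF e(1)] e(2) by auto
    qed
  qed (use assms(2) in auto)
  then show ?thesis by simp
qed

context highly_connected_graph
begin

text \<open>The endpoint map of the quotient graph. Edges keep their identity, so edge sets found in
  a quotient are edge sets of \<open>G\<close>.\<close>

definition quotient_ends :: "'v set set \<Rightarrow> 'e \<Rightarrow> 'v set set" where
  "quotient_ends P e = {A \<in> P. A \<inter> \<epsilon> e \<noteq> {}}"

lemma crossing_ends:
  assumes part: "region_partition X P" and e: "e \<in> crossing X P"
  obtains A B p q where "\<epsilon> e = {p, q}" "p \<in> A" "q \<in> B" "A \<in> P" "B \<in> P" "A \<noteq> B" "quotient_ends P e = {A, B}"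
proof -
  note P = region_partitionD[OF part]
  have eE: "e \<in> E" "\<epsilon> e \<subseteq> X" using e unfolding crossing_def inside_def by auto
  obtain p q where pq: "\<epsilon> e = {p, q}" using edge_two[OF eE(1)] by blast
  then obtain A B where AB: "A \<in> P" "p \<in> A" "B \<in> P" "q \<in> B" using eE P(2) by auto
  then have ne: "A \<noteq> B" using e pq unfolding crossing_def by auto
  have "C = A \<or> C = B" if "C \<in> P" "C \<inter> \<epsilon> e \<noteq> {}" for C
  proof -
    have "p \<in> C \<or> q \<in> C" using that(2) pq by auto
    then have "C \<inter> A \<noteq> {} \<or> C \<inter> B \<noteq> {}" using AB by blast
    then show ?thesis using P(6)[OF that(1) AB(1)] P(6)[OF that(1) AB(3)] by auto
  qed
  then have "quotient_ends P e = {A, B}" using AB pq unfolding quotient_ends_def by auto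
  with pq AB ne that show ?thesis by blast
qed

lemma quotient_multigraph:
  assumes part: "region_partition X P"
  shows "finite_multigraph P (crossing X P) (quotient_ends P)"
proof -
  have "quotient_ends P e \<subseteq> P \<and> card (quotient_ends P e) = 2" if e: "e \<in> crossing X P" for e
  proof -
    obtain A B where AB: "A \<in> P" "B \<in> P" "A \<noteq> B" "quotient_ends P e = {A, B}"
      using crossing_ends[OF part e] by metis
    then show ?thesis by simp
  qed
  then show ?thesis
    using region_partitionD(1)[OF part] finite_crossing[OF part] unfolding finite_multigraph_def by blast
qed

lemma quotient_conn:
  assumes part: "region_partition X P" and F: "F \<subseteq> crossing X P"
    and AB: "(A, B) \<in> (links (quotient_ends P) F)\<^sup>*" "A \<in> P" "a \<in> A" "b \<in> B"
  shows "(a, b) \<in> conn \<epsilon> P F"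
proof -
  have "\<forall>b\<in>B. (a, b) \<in> conn \<epsilon> P F"
    using AB(1)
  proof (induction rule: rtrancl_induct)
    case base
    then show ?case using AB by (auto intro: conn_same)
  next
    case (step B C)
    obtain e where e: "e \<in> F" "quotient_ends P e = {B, C}" using step.hyps(2) unfolding links_def by auto
    obtain A' B' p q where pq: "\<epsilon> e = {p, q}" "p \<in> A'" "q \<in> B'" "A' \<in> P" "B' \<in> P" "quotient_ends P e = {A', B'}"
      using crossing_ends[OF part subsetD[OF F e(1)]] by metis
    have edge: "(p, q) \<in> conn \<epsilon> P F" using e(1) pq(1) by (rule conn_edge)
    note edge' = conn_sym[OF edge]
    have "A' = B \<and> B' = C \<or> A' = C \<and> B' = B" using e(2) pq(6) by (auto simp: doubleton_eq_iff)
    then have "\<exists>p\<in>B. \<exists>q\<in>C. (p, q) \<in> conn \<epsilon> P F \<and> C \<in> P" using pq edge edge' by blast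
    then obtain p' q' where pq': "p' \<in> B" "q' \<in> C" "(p', q') \<in> conn \<epsilon> P F" "C \<in> P" by blast
    show ?case
    proof
      fix c assume "c \<in> C"
      then have "(q', c) \<in> conn \<epsilon> P F" using pq' by (intro conn_same)
      then show "(a, c) \<in> conn \<epsilon> P F" using step.IH pq' conn_trans by meson
    qed
  qed
  with AB(4) show ?thesis by blast
qed

text \<open>A partition of the set of cells becomes a region partition of \<open>X\<close> by taking
  unions, and its crossing edges already cross in the quotient. So solidity supplies the partition
  condition of \<open>rooted_orientation_exists\<close>.\<close>

lemma quotient_orientation:
  assumes X: "solid X" and part: "region_partition X P" and x: "x \<in> P"
  obtains h where "orientation (quotient_ends P) h (crossing X P)"
    "\<And>A. A \<noteq> {} \<Longrightarrow> A \<subseteq> P - {x} \<Longrightarrow> Suc j \<le> card (enters (quotient_ends P) h (crossing X P) A)"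
proof (rule rooted_orientation_exists[OF quotient_multigraph[OF part] x, of "Suc j"])
  note P = region_partitionD[OF part]
  fix Q assume Q: "partition_on P Q"
  then have QD: "\<Union>Q = P" "{} \<notin> Q" "\<And>\<AA> \<BB>. \<AA> \<in> Q \<Longrightarrow> \<BB> \<in> Q \<Longrightarrow> \<AA> \<noteq> \<BB> \<Longrightarrow> \<AA> \<inter> \<BB> = {}"
    unfolding partition_on_def disjoint_def by auto
  have finQ: "finite Q" using finite_elements[OF P(1) Q] .
  have sub: "\<AA> \<subseteq> P" if "\<AA> \<in> Q" for \<AA> using QD(1) that by blast
  have disj: "\<Union>\<AA> \<inter> \<Union>\<BB> = {}" if "\<AA> \<in> Q" "\<BB> \<in> Q" "\<AA> \<noteq> \<BB>" for \<AA> \<BB>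
  proof -
    have "A \<inter> B = {}" if "A \<in> \<AA>" "B \<in> \<BB>" for A B
      using P(6)[of A B] QD(3)[OF \<open>\<AA> \<in> Q\<close> \<open>\<BB> \<in> Q\<close> \<open>\<AA> \<noteq> \<BB>\<close>] sub \<open>\<AA> \<in> Q\<close> \<open>\<BB> \<in> Q\<close> that by blast
    then show ?thesis by blast
  qed
  have ne: "\<Union>\<AA> \<noteq> {}" if \<AA>: "\<AA> \<in> Q" for \<AA>
  proof -
    have "\<AA> \<noteq> {}" using QD(2) \<AA> by auto
    then obtain A where "A \<in> \<AA>" by blast
    then show ?thesis using P(3) sub[OF \<AA>] by blast
  qed
  have "inj_on Union Q"
  proof (rule inj_onI)
    fix \<AA> \<BB> assume *: "\<AA> \<in> Q" "\<BB> \<in> Q" "\<Union>\<AA> = \<Union>\<BB>"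
    then show "\<AA> = \<BB>" using disj[OF *(1,2)] ne[OF *(2)] by auto
  qed
  then have cardU: "card (Union ` Q) = card Q" by (rule card_image)
  have "region_partition X (Union ` Q)"
  proof (rule region_partitionI)
    show "finite (Union ` Q)" using finQ by simp
    show "\<Union>(Union ` Q) = X" using QD(1) P(2) by auto
    show "A \<noteq> {}" if "A \<in> Union ` Q" for A using that ne by blast
    show "region A" if A: "A \<in> Union ` Q" for A
    proof -
      obtain \<AA> where "\<AA> \<in> Q" "A = \<Union>\<AA>" using A by blast
      then show ?thesis using sub[of \<AA>] P(1,5) finite_subset[of \<AA> P] region_Union[of \<AA>] by auto
    qed
    show "A \<inter> B = {}" if AB: "A \<in> Union ` Q" "B \<in> Union ` Q" "A \<noteq> B" for A B
    proof -
      obtain \<AA> \<BB> where "\<AA> \<in> Q" "A = \<Union>\<AA>" "\<BB> \<in> Q" "B = \<Union>\<BB>" using AB(1,2) by auto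
      then show ?thesis using disj[of \<AA> \<BB>] AB(3) by auto
    qed
  qed
  then have "Suc j * (card Q - 1) \<le> card (crossing X (Union ` Q))"
    using X cardU unfolding solid_def by auto
  also have "crossing X (Union ` Q) \<subseteq> {e \<in> crossing X P. \<not> (\<exists>\<AA>\<in>Q. quotient_ends P e \<subseteq> \<AA>)}"
  proof
    fix e assume e: "e \<in> crossing X (Union ` Q)"
    then have eX: "e \<in> inside X" unfolding crossing_def by simp
    have n1: "\<not> \<epsilon> e \<subseteq> \<Union>\<AA>" if "\<AA> \<in> Q" for \<AA> using e that unfolding crossing_def by blast
    have "\<not> \<epsilon> e \<subseteq> A" if "A \<in> P" for A
    proof -
      have "A \<in> \<Union>Q" using QD(1) that by simp
      then obtain \<AA> where "\<AA> \<in> Q" "A \<in> \<AA>" by blast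
      then show ?thesis using n1 by blast
    qed
    then have eP: "e \<in> crossing X P" using eX unfolding crossing_def by blast
    moreover have "\<not> quotient_ends P e \<subseteq> \<AA>" if "\<AA> \<in> Q" for \<AA>
    proof
      assume sub: "quotient_ends P e \<subseteq> \<AA>"
      obtain A B p q where "\<epsilon> e = {p, q}" "p \<in> A" "q \<in> B" "quotient_ends P e = {A, B}"
        using crossing_ends[OF part eP] by metis
      then show False using n1[OF that] sub by auto
    qed
    ultimately show "e \<in> {e \<in> crossing X P. \<not> (\<exists>\<AA>\<in>Q. quotient_ends P e \<subseteq> \<AA>)}" by blast
  qed
  then have "card (crossing X (Union ` Q)) \<le> card {e \<in> crossing X P. \<not> (\<exists>\<AA>\<in>Q. quotient_ends P e \<subseteq> \<AA>)}"
    by (intro card_mono) (use finite_crossing[OF part] in auto)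
  finally show "Suc j * (card Q - 1) \<le> card {e \<in> crossing X P. \<not> (\<exists>\<AA>\<in>Q. quotient_ends P e \<subseteq> \<AA>)}" .
qed (use that in blast)

lemma quotient_packing:
  assumes part: "region_partition X P" and x: "x \<in> P" and E': "E' \<subseteq> crossing X P"
    and h: "orientation (quotient_ends P) h (crossing X P)"
    and rho: "\<And>A. A \<noteq> {} \<Longrightarrow> A \<subseteq> P - {x} \<Longrightarrow> n \<le> card (enters (quotient_ends P) h E' A)"
  obtains F where "\<And>i. i < n \<Longrightarrow> F i \<subseteq> E'" "\<And>i i'. i < n \<Longrightarrow> i' < n \<Longrightarrow> i \<noteq> i' \<Longrightarrow> F i \<inter> F i' = {}"
    "\<And>i p q. i < n \<Longrightarrow> p \<in> X \<Longrightarrow> q \<in> X \<Longrightarrow> (p, q) \<in> conn \<epsilon> P (F i)"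
proof -
  obtain F where F: "\<forall>i<n. F i \<subseteq> E' \<and> (\<forall>A\<in>P. (x, A) \<in> (links (quotient_ends P) (F i))\<^sup>*)"
    "\<forall>i<n. \<forall>i'<n. i \<noteq> i' \<longrightarrow> F i \<inter> F i' = {}"
    using edmonds_packing[OF finite_multigraph_subset[OF quotient_multigraph[OF part] E']
      orientation_subset[OF h E'] x rho] by blast
  obtain w where w: "w \<in> x" using region_partitionD(3)[OF part x] by blast
  have "(w, p) \<in> conn \<epsilon> P (F i)" if "i < n" "p \<in> X" for i p
  proof -
    obtain A where A: "A \<in> P" "p \<in> A" using region_partitionD(2)[OF part] \<open>p \<in> X\<close> by blast
    show ?thesis by (rule quotient_conn[OF part _ _ x w A(2)]) (use F(1) E' A(1) \<open>i < n\<close> in auto)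
  qed
  note w = this
  have "(p, q) \<in> conn \<epsilon> P (F i)" if "i < n" "p \<in> X" "q \<in> X" for i p q
    by (rule conn_trans[OF conn_sym[OF w[OF that(1,2)]] w[OF that(1,3)]])
  with F show ?thesis by (intro that[of F]) auto
qed

text \<open>Being independent and connecting \<open>V\<close> modulo \<open>P\<close>, each \<open>T i\<close> is a spanning tree of the quotient by \<open>P\<close>.\<close>

definition state :: "'v set set \<Rightarrow> (nat \<Rightarrow> 'e set) \<Rightarrow> bool" where
  "state P T \<longleftrightarrow> region_partition V P \<and> (\<forall>A\<in>P. solid A) \<and>
    (\<forall>i<j. finite (T i) \<and> T i \<subseteq> E \<and> indep \<epsilon> P (T i) \<and> (\<forall>p\<in>V. \<forall>q\<in>V. (p, q) \<in> conn \<epsilon> P (T i))) \<and>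
    (\<forall>i<j. \<forall>i'<j. i \<noteq> i' \<longrightarrow> T i \<inter> T i' = {})"

text \<open>The last clause asks more than connectedness of the new trees: each of them connects
  every old cell by edges inside that cell. This is what makes the limits connected inside cells,
  and so end faithful.\<close>

definition extends ::
  "'v set set \<Rightarrow> (nat \<Rightarrow> 'e set) \<Rightarrow> 'v set set \<Rightarrow> (nat \<Rightarrow> 'e set) \<Rightarrow> bool" where
  "extends P T P' T' \<longleftrightarrow> refines P' P \<and>
    (\<forall>i<j. T i \<subseteq> T' i \<and> (\<forall>e\<in>T' i - T i. \<exists>A\<in>P. \<epsilon> e \<subseteq> A) \<and>
      (\<forall>A\<in>P. \<forall>p\<in>A. \<forall>q\<in>A. (p, q) \<in> conn \<epsilon> P' (T' i \<inter> inside A)))"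

section \<open>Stages and their extensions\<close>

lemma stateD:
  assumes "state P T"
  shows "region_partition V P" "\<And>A. A \<in> P \<Longrightarrow> solid A" "\<And>i. i < j \<Longrightarrow> finite (T i)" "\<And>i. i < j \<Longrightarrow> T i \<subseteq> E"
    "\<And>i. i < j \<Longrightarrow> indep \<epsilon> P (T i)" "\<And>i p q. i < j \<Longrightarrow> p \<in> V \<Longrightarrow> q \<in> V \<Longrightarrow> (p, q) \<in> conn \<epsilon> P (T i)"
    "\<And>i i'. i < j \<Longrightarrow> i' < j \<Longrightarrow> i \<noteq> i' \<Longrightarrow> T i \<inter> T i' = {}"
  using assms unfolding state_def by auto

lemma extendsD:
  assumes "extends P T P' T'"
  shows "refines P' P" "\<And>i. i < j \<Longrightarrow> T i \<subseteq> T' i"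
    "\<And>i e. i < j \<Longrightarrow> e \<in> T' i \<Longrightarrow> e \<notin> T i \<Longrightarrow> \<exists>A\<in>P. \<epsilon> e \<subseteq> A"
    "\<And>i A p q. i < j \<Longrightarrow> A \<in> P \<Longrightarrow> p \<in> A \<Longrightarrow> q \<in> A \<Longrightarrow> (p, q) \<in> conn \<epsilon> P' (T' i \<inter> inside A)"
  using assms unfolding extends_def by auto

lemma indep_not_inside:
  assumes "indep \<epsilon> P T" "e \<in> T" "e \<in> E" "A \<in> P"
  shows "\<not> \<epsilon> e \<subseteq> A"
proof
  assume "\<epsilon> e \<subseteq> A"
  obtain p q where pq: "\<epsilon> e = {p, q}" using edge_two[OF assms(3)] by blast
  then have "(p, q) \<in> conn \<epsilon> P (T - {e})" using \<open>\<epsilon> e \<subseteq> A\<close> assms(4) by (intro conn_same[of A]) auto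
  then show False using assms(1,2) pq unfolding indep_def by blast
qed

lemma extends_refl: "extends P T P T"
  unfolding extends_def refines_def by (auto intro: conn_same)

lemma refines_trans: "refines P'' P' \<Longrightarrow> refines P' P \<Longrightarrow> refines P'' P"
  unfolding refines_def by (meson order_trans)

lemma refines_cases:
  assumes "region_partition X P" "region_partition X P'" "refines P' P" "A \<in> P" "B \<in> P'"
  shows "B \<subseteq> A \<or> B \<inter> A = {}"
proof -
  obtain C where "C \<in> P" "B \<subseteq> C" using assms(3,5) unfolding refines_def by blast
  then show ?thesis using region_partitionD(6)[OF assms(1) \<open>C \<in> P\<close> assms(4)] by blast
qed

lemma extends_trans:
  assumes s: "state P T" and s': "state P' T'" and e: "extends P T P' T'" and e': "extends P' T' P'' T''"
  shows "extends P T P'' T''"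
  unfolding extends_def
proof (intro conjI allI impI ballI)
  note e = extendsD[OF e] and e' = extendsD[OF e']
  show "refines P'' P" using e'(1) e(1) by (rule refines_trans)
  fix i assume i: "i < j"
  show "T i \<subseteq> T'' i" using e(2)[OF i] e'(2)[OF i] by blast
  {
    fix f assume f: "f \<in> T'' i - T i"
    show "\<exists>A\<in>P. \<epsilon> f \<subseteq> A"
    proof (cases "f \<in> T' i")
      case True
      then show ?thesis using e(3)[OF i] f by blast
    next
      case False
      then obtain A where "A \<in> P'" "\<epsilon> f \<subseteq> A" using e'(3)[OF i] f by blast
      moreover obtain B where "B \<in> P" "A \<subseteq> B" using e(1) \<open>A \<in> P'\<close> unfolding refines_def by blast
      ultimately show ?thesis by blast
    qed
  }
  fix A p q assume A: "A \<in> P" "p \<in> A" "q \<in> A"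
  have "(p, q) \<in> conn \<epsilon> {B \<in> P'. B \<subseteq> A} (T' i \<inter> inside A)"
    using e(4)[OF i A] A(2) refines_cases[OF stateD(1)[OF s] stateD(1)[OF s'] e(1) A(1)]
    by (rule conn_restrict) (auto simp: inside_def)
  then show "(p, q) \<in> conn \<epsilon> P'' (T'' i \<inter> inside A)"
  proof (rule conn_least)
    fix B a b assume "B \<in> {B \<in> P'. B \<subseteq> A}" "a \<in> B" "b \<in> B"
    then have "(a, b) \<in> conn \<epsilon> P'' (T'' i \<inter> inside B)" "inside B \<subseteq> inside A" using e'(4)[OF i] inside_mono by auto
    then show "(a, b) \<in> conn \<epsilon> P'' (T'' i \<inter> inside A)" by (elim conn_monoD) blast
  next
    fix f a b assume "f \<in> T' i \<inter> inside A" "\<epsilon> f = {a, b}"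
    then show "(a, b) \<in> conn \<epsilon> P'' (T'' i \<inter> inside A)" using e'(2)[OF i] by (intro conn_edge[of f]) auto
  qed
qed

text \<open>\<open>L i\<close> collects edges whose connections have to survive when the spanning
  set \<open>F i\<close> is thinned out to a tree: a basis of \<open>L i\<close> is chosen first and
  then extended to one of \<open>F i\<close>. By independence old tree edges never lie inside
  \<open>X\<close>, so they are disjoint from all new ones.\<close>

lemma extend_cell:
  assumes s: "state P T" and X: "X \<in> P" and C: "region_partition X C" and solC: "\<And>A. A \<in> C \<Longrightarrow> solid A"
    and F: "\<And>i. i < j \<Longrightarrow> F i \<subseteq> crossing X C" "\<And>i i'. i < j \<Longrightarrow> i' < j \<Longrightarrow> i \<noteq> i' \<Longrightarrow> F i \<inter> F i' = {}"
      "\<And>i p q. i < j \<Longrightarrow> p \<in> X \<Longrightarrow> q \<in> X \<Longrightarrow> (p, q) \<in> conn \<epsilon> C (F i)"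
    and L: "\<And>i. i < j \<Longrightarrow> L i \<subseteq> F i"
  obtains T' where "state (P - {X} \<union> C) T'" "extends P T (P - {X} \<union> C) T'"
    "\<And>i. i < j \<Longrightarrow> conn \<epsilon> (P - {X} \<union> C) (L i) \<subseteq> conn \<epsilon> (P - {X} \<union> C) (T' i \<inter> L i)"
proof -
  note s = stateD[OF s]
  let ?P = "P - {X} \<union> C"
  have part: "region_partition V ?P" using s(1) X C by (rule region_partition_replace)
  have ref: "refines ?P P" unfolding refines_def
  proof
    fix A assume "A \<in> ?P"
    then show "\<exists>B\<in>P. A \<subseteq> B" using X region_partitionD(4)[OF C] by blast
  qed
  have FE: "F i \<subseteq> E" "finite (F i)" "F i \<subseteq> inside X" if "i < j" for i
    using F(1)[OF that] finite_subset[OF F(1)[OF that] finite_crossing[OF C]] unfolding crossing_def inside_def by auto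
  have "\<exists>M. M \<subseteq> F i \<and> indep \<epsilon> ?P M \<and> conn \<epsilon> ?P M = conn \<epsilon> ?P (F i) \<and> conn \<epsilon> ?P (L i) \<subseteq> conn \<epsilon> ?P (M \<inter> L i)"
    if i: "i < j" for i
  proof -
    have two: "\<exists>p q. \<epsilon> e = {p, q}" if "e \<in> F i" for e using edge_two FE(1)[OF i] that by blast
    have twoL: "\<exists>p q. \<epsilon> e = {p, q}" if "e \<in> L i" for e using two subsetD[OF L[OF i] that] .
    have "indep \<epsilon> ?P {}" unfolding indep_def by simp
    from indep_extend[OF finite_subset[OF L[OF i] FE(2)[OF i]] empty_subsetI this twoL]
    obtain I where I: "I \<subseteq> L i" "indep \<epsilon> ?P I" "conn \<epsilon> ?P I = conn \<epsilon> ?P (L i)"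
      by metis
    then have "I \<subseteq> F i" using L[OF i] by blast
    from indep_extend[OF FE(2)[OF i] this I(2) two]
    obtain M where M: "I \<subseteq> M" "M \<subseteq> F i" "indep \<epsilon> ?P M" "conn \<epsilon> ?P M = conn \<epsilon> ?P (F i)"
      by metis
    have "conn \<epsilon> ?P I \<subseteq> conn \<epsilon> ?P (M \<inter> L i)" using I(1) M(1) by (intro conn_mono) blast
    with M I show ?thesis by blast
  qed
  then obtain M where M: "\<And>i. i < j \<Longrightarrow> M i \<subseteq> F i" "\<And>i. i < j \<Longrightarrow> indep \<epsilon> ?P (M i)"
    "\<And>i. i < j \<Longrightarrow> conn \<epsilon> ?P (M i) = conn \<epsilon> ?P (F i)"
    "\<And>i. i < j \<Longrightarrow> conn \<epsilon> ?P (L i) \<subseteq> conn \<epsilon> ?P (M i \<inter> L i)" by metis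
  have MX: "\<epsilon> e \<subseteq> X" if "i < j" "e \<in> M i" for i e using M(1) FE(3) that unfolding inside_def by blast
  have TX: "\<not> \<epsilon> e \<subseteq> X" if "i < j" "e \<in> T i" for i e
    using indep_not_inside[OF s(5) _ _ X] s(4) that by blast
  have connX: "(p, q) \<in> conn \<epsilon> ?P (M i)" if "i < j" "p \<in> X" "q \<in> X" for i p q
    using F(3)[OF that] conn_partition_mono[of C ?P \<epsilon> "F i"] M(3)[OF that(1)] by blast
  let ?T = "\<lambda>i. T i \<union> M i"
  have "state ?P ?T"
    unfolding state_def
  proof (intro conjI allI impI ballI part)
    show "solid A" if "A \<in> ?P" for A using that s(2) solC by blast
    show "T i \<union> M i \<subseteq> E" "finite (T i \<union> M i)" if "i < j" for i
      using s(3,4)[OF that] M(1)[OF that] FE[OF that] finite_subset by auto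
    show "indep \<epsilon> ?P (T i \<union> M i)" if i: "i < j" for i
      by (rule indep_refine[OF s(3)[OF i] s(5)[OF i] ref M(2)[OF i]]) (use MX[OF i] X edge_two s(4)[OF i] in blast)+
    show "(p, q) \<in> conn \<epsilon> ?P (T i \<union> M i)" if i: "i < j" and pq: "p \<in> V" "q \<in> V" for i p q
      using s(6)[OF i pq]
    proof (rule conn_least)
      fix A a b assume A: "A \<in> P" "a \<in> A" "b \<in> A"
      show "(a, b) \<in> conn \<epsilon> ?P (T i \<union> M i)"
      proof (cases "A = X")
        case True
        then show ?thesis by (intro conn_monoD[OF connX[OF i, of a b]]) (use A in auto)
      next
        case False
        then show ?thesis using A by (intro conn_same[of A]) auto
      qed
    next
      fix e a b assume "e \<in> T i" "\<epsilon> e = {a, b}"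
      then show "(a, b) \<in> conn \<epsilon> ?P (T i \<union> M i)" by (intro conn_edge[of e]) auto
    qed
    show "(T i \<union> M i) \<inter> (T i' \<union> M i') = {}" if i: "i < j" "i' < j" "i \<noteq> i'" for i i'
    proof -
      have "M i \<inter> M i' = {}" using M(1)[OF i(1)] M(1)[OF i(2)] F(2)[OF i] by blast
      moreover have "T i \<inter> M i' = {}" "M i \<inter> T i' = {}" using MX TX i(1,2) by blast+
      ultimately show ?thesis using s(7)[OF i] by blast
    qed
  qed
  moreover have "extends P T ?P ?T"
    unfolding extends_def
  proof (intro conjI allI impI ballI ref)
    fix i assume i: "i < j"
    show "T i \<subseteq> T i \<union> M i" by simp
    show "\<exists>A\<in>P. \<epsilon> e \<subseteq> A" if "e \<in> T i \<union> M i - T i" for e using that MX[OF i] X by blast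
    fix A p q assume A: "A \<in> P" "p \<in> A" "q \<in> A"
    show "(p, q) \<in> conn \<epsilon> ?P ((T i \<union> M i) \<inter> inside A)"
    proof (cases "A = X")
      case True
      have "M i \<subseteq> inside X" using M(1)[OF i] FE(3)[OF i] by blast
      then show ?thesis by (intro conn_monoD[OF connX[OF i, of p q]]) (use A True in auto)
    next
      case False
      then show ?thesis using A by (intro conn_same[of A]) auto
    qed
  qed
  moreover have "conn \<epsilon> ?P (L i) \<subseteq> conn \<epsilon> ?P ((T i \<union> M i) \<inter> L i)" if i: "i < j" for i
  proof -
    have "conn \<epsilon> ?P (M i \<inter> L i) \<subseteq> conn \<epsilon> ?P ((T i \<union> M i) \<inter> L i)" by (intro conn_mono) blast
    with M(4)[OF i] show ?thesis by blast
  qed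
  ultimately show ?thesis by (rule that)
qed

lemma solid_singleton: "v \<in> V \<Longrightarrow> solid {v}"
  unfolding solid_def
proof (intro conjI allI impI)
  show "v \<in> V \<Longrightarrow> region {v}" by (rule region_finite) auto
  fix P assume P: "region_partition {v} P"
  have "A = {v}" if "A \<in> P" for A using region_partitionD(3,4)[OF P that] by blast
  then have "P \<subseteq> {{v}}" by blast
  then have "card P \<le> 1" using card_mono[of "{{v}}" P] by simp
  then show "Suc j * (card P - 1) \<le> card (crossing {v} P)" by simp
qed simp

text \<open>Singletons are solid by themselves, and since \<open>K\<close> is nonempty the rest
  \<open>X - K\<close> differs from \<open>V\<close>, as \<open>solid_partition\<close>
  requires.\<close>

lemma solid_partition_singletons:
  assumes X: "region X" and K: "finite K" "K \<subseteq> X" "K \<noteq> {}"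
  obtains C where "region_partition X C" "\<And>A. A \<in> C \<Longrightarrow> solid A" "\<And>w. w \<in> K \<Longrightarrow> {w} \<in> C"
proof -
  have XV: "X \<subseteq> V" using X unfolding region_def by simp
  have "region (X - K)" using X region_finite[OF K(1)] K(2) XV by (intro region_Diff) auto
  moreover have "X - K \<noteq> V" using K(2,3) XV by blast
  ultimately obtain D where D: "region_partition (X - K) D" "\<And>A. A \<in> D \<Longrightarrow> solid A" using solid_partition by metis
  note DD = region_partitionD[OF D(1)]
  let ?C = "(\<lambda>w. {w}) ` K \<union> D"
  have sol: "solid A" if "A \<in> ?C" for A using that D(2) solid_singleton K(2) XV by blast
  moreover have "region_partition X ?C"
  proof (rule region_partitionI)
    show "finite ?C" using K(1) DD(1) by simp
    show "\<Union>?C = X" using DD(2) K(2) by auto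
    show "A \<noteq> {}" if "A \<in> ?C" for A using that DD(3) by blast
    show "region A" if "A \<in> ?C" for A using sol[OF that] by (rule solid_region)
    show "A \<inter> B = {}" if "A \<in> ?C" "B \<in> ?C" "A \<noteq> B" for A B
    proof -
      have "{w} \<inter> A' = {}" if "w \<in> K" "A' \<in> D" for w A' using DD(4)[OF that(2)] that(1) by blast
      then show ?thesis using that DD(6) by blast
    qed
  qed
  ultimately show ?thesis using that by blast
qed

text \<open>The quotient of the cell of \<open>y\<close> has \<open>Suc j\<close> disjoint spanning
  edge sets, of which \<open>j\<close> extend the trees; no link is built here. The new cell
  \<open>{y}\<close> serves as root.\<close>

lemma isolate_vertex:
  assumes s: "state P T" and y: "y \<in> V"
  obtains P' T' where "state P' T'" "extends P T P' T'" "{y} \<in> P'"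
proof -
  note sD = stateD[OF s]
  obtain X where X: "X \<in> P" "y \<in> X" using region_partitionD(2)[OF sD(1)] y by blast
  have solX: "solid X" using sD(2) X by blast
  obtain C where C: "region_partition X C" "\<And>A. A \<in> C \<Longrightarrow> solid A" "{y} \<in> C"
    using solid_partition_singletons[OF solid_region[OF solX], of "{y}"] X by blast
  obtain h where h: "orientation (quotient_ends C) h (crossing X C)"
    "\<And>A. A \<noteq> {} \<Longrightarrow> A \<subseteq> C - {{y}} \<Longrightarrow> Suc j \<le> card (enters (quotient_ends C) h (crossing X C) A)"
    using quotient_orientation[OF solX C(1,3)] by blast
  from quotient_packing[where n = "Suc j", OF C(1,3) order_refl h]
  obtain F where F: "\<And>i. i < Suc j \<Longrightarrow> F i \<subseteq> crossing X C"
    "\<And>i i'. i < Suc j \<Longrightarrow> i' < Suc j \<Longrightarrow> i \<noteq> i' \<Longrightarrow> F i \<inter> F i' = {}"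
    "\<And>i p q. i < Suc j \<Longrightarrow> p \<in> X \<Longrightarrow> q \<in> X \<Longrightarrow> (p, q) \<in> conn \<epsilon> C (F i)"
    by metis
  obtain T' where "state (P - {X} \<union> C) T'" "extends P T (P - {X} \<union> C) T'"
    by (rule extend_cell[OF s X(1) C(1,2), of F "\<lambda>_. {}"]) (use F in \<open>auto simp: less_Suc_eq\<close>)
  with C(3) that show ?thesis by blast
qed

end

section \<open>Linking two vertices away from an end\<close>

definition tends :: "('v, 'e) ray \<Rightarrow> 'v set \<Rightarrow> bool" where
  "tends r A \<longleftrightarrow> (\<exists>n. \<forall>i\<ge>n. fst r i \<in> A)"

section \<open>Rays and finite cuts\<close>

lemma tends_mono: "tends r A \<Longrightarrow> A \<subseteq> B \<Longrightarrow> tends r B"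
  unfolding tends_def by blast

lemma tends_Int: "tends r A \<Longrightarrow> tends r B \<Longrightarrow> tends r (A \<inter> B)"
proof -
  assume "tends r A" "tends r B"
  then obtain m n where "\<forall>i\<ge>m. fst r i \<in> A" "\<forall>i\<ge>n. fst r i \<in> B" unfolding tends_def by blast
  then have "\<forall>i\<ge>max m n. fst r i \<in> A \<inter> B" by simp
  then show ?thesis unfolding tends_def by blast
qed

lemma not_tends_empty [simp]: "\<not> tends r {}"
  unfolding tends_def by auto

lemma raysD:
  assumes "r \<in> rays H"
  shows "inj (fst r)" "\<And>i. fst r i \<in> verts H" "\<And>i. snd r i \<in> edges H"
    "\<And>i. endpts H (snd r i) = {fst r i, fst r (Suc i)}"
  using assms unfolding rays_def by auto

lemma inj_ray_edges:
  assumes "r \<in> rays H"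
  shows "inj (snd r)"
proof (rule injI)
  fix i i' assume "snd r i = snd r i'"
  then have "{fst r i, fst r (Suc i)} = {fst r i', fst r (Suc i')}" using raysD(4)[OF assms] by metis
  then have "i = i' \<and> Suc i = Suc i' \<or> i = Suc i' \<and> Suc i = i'"
    using raysD(1)[OF assms] by (simp add: doubleton_eq_iff inj_eq)
  then show "i = i'" by auto
qed

lemma finite_bounded_index:
  assumes "inj f" "finite S"
  shows "\<exists>n::nat. \<forall>i\<ge>n. f i \<notin> S"
proof -
  have "finite {i. f i \<in> S}" using finite_vimageI[OF assms(2,1)] unfolding vimage_def .
  then obtain n where "\<forall>i\<in>{i. f i \<in> S}. i < n" using finite_nat_set_iff_bounded by blast
  then show ?thesis by (intro exI[of _ n]) (auto simp: not_less[symmetric])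
qed

lemma tends_avoid_finite:
  assumes "r \<in> rays H" "finite K" "tends r A"
  shows "tends r (A - K)"
proof -
  have "tends r (- K)" using finite_bounded_index[OF raysD(1)[OF assms(1)] assms(2)] unfolding tends_def by simp
  then show ?thesis using tends_Int[OF assms(3)] by (simp add: Diff_eq)
qed

lemma not_tends_finite: "r \<in> rays H \<Longrightarrow> finite K \<Longrightarrow> \<not> tends r K"
  using tends_avoid_finite[of r H K K] by auto

lemma rtrancl_links_component:
  assumes pq: "(p, q) \<in> (links \<epsilon> F)\<^sup>*" and "p \<in> C" and closed: "\<And>e. e \<in> F \<Longrightarrow> \<epsilon> e \<inter> C \<noteq> {} \<Longrightarrow> \<epsilon> e \<subseteq> C"
  shows "q \<in> C \<and> (p, q) \<in> (links \<epsilon> {e \<in> F. \<epsilon> e \<subseteq> C})\<^sup>*"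
  using pq
proof (induction rule: rtrancl_induct)
  case (step y z)
  obtain e where e: "e \<in> F" "\<epsilon> e = {y, z}" using step.hyps(2) unfolding links_def by blast
  have "\<epsilon> e \<subseteq> C" using closed[OF e(1)] e(2) step.IH by auto
  then have "(y, z) \<in> links \<epsilon> {e \<in> F. \<epsilon> e \<subseteq> C}" "z \<in> C" using e unfolding links_def by auto
  then show ?case using step.IH by (meson rtrancl.rtrancl_into_rtrancl)
qed (use assms(2) in simp)

context highly_connected_graph
begin

text \<open>A ray uses each edge at most once, so from some index on it misses the finite boundary
  of \<open>A\<close> and no longer changes sides.\<close>

lemma tends_region:
  assumes r: "r \<in> rays G" and A: "region A"
  shows "tends r A \<or> tends r (V - A)"
proof -
  note rD = raysD[OF r]
  have "finite (bd A)" using A unfolding region_def by simp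
  then obtain n where n: "\<forall>i\<ge>n. snd r i \<notin> bd A" using finite_bounded_index[OF inj_ray_edges[OF r]] by blast
  have iff: "fst r (n + i) \<in> A \<longleftrightarrow> fst r n \<in> A" for i
  proof (induction i)
    case (Suc i)
    have "snd r (n + i) \<notin> bd A" using n by simp
    then have "fst r (n + i) \<in> A \<longleftrightarrow> fst r (Suc (n + i)) \<in> A"
      using rD(3,4)[of "n + i"] unfolding bd_def by auto
    with Suc show ?case by simp
  qed simp
  have all: "fst r i \<in> A \<longleftrightarrow> fst r n \<in> A" if "i \<ge> n" for i using iff[of "i - n"] that by simp
  show ?thesis
  proof (cases "fst r n \<in> A")
    case True
    then show ?thesis using all unfolding tends_def by blast
  next
    case False
    then have "\<forall>i\<ge>n. fst r i \<in> V - A" using all rD(2) by blast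
    then show ?thesis unfolding tends_def by blast
  qed
qed

lemma tends_cell:
  assumes r: "r \<in> rays G" and C: "region_partition X C" and X: "tends r X"
  obtains A where "A \<in> C" "tends r A"
proof -
  have *: "(\<exists>A\<in>D. tends r A) \<or> tends r (V - \<Union>D)" if "finite D" "\<forall>A\<in>D. region A" for D
    using that
  proof (induction D)
    case empty
    then show ?case using raysD(2)[OF r] unfolding tends_def by simp
  next
    case (insert A D)
    then consider "\<exists>B\<in>D. tends r B" | "tends r (V - \<Union>D)" by blast
    then show ?case
    proof cases
      case 2
      have "V - \<Union>(insert A D) = (V - A) \<inter> (V - \<Union>D)" by blast
      moreover have "tends r A \<or> tends r (V - A)" using insert.prems by (intro tends_region[OF r]) simp
      ultimately show ?thesis using tends_Int[OF _ 2, of "V - A"] by auto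
    qed auto
  qed
  have "\<not> tends r (V - \<Union>C)"
  proof
    assume "tends r (V - \<Union>C)"
    then have "tends r (V - X)" using region_partitionD(2)[OF C] by simp
    from tends_Int[OF X this] show False by simp
  qed
  then show ?thesis using *[of C] region_partitionD(1,5)[OF C] that by blast
qed

lemma tends_unique:
  assumes C: "region_partition X C" and "A \<in> C" "B \<in> C" "tends r A" "tends r B"
  shows "A = B"
proof (rule ccontr)
  assume "A \<noteq> B"
  then have "A \<inter> B = {}" by (rule region_partitionD(6)[OF C assms(2,3)])
  with tends_Int[OF assms(4,5)] show False by simp
qed

lemma finite_connected_superset:
  assumes conn: "\<forall>p\<in>C. \<forall>q\<in>C. (p, q) \<in> (links \<epsilon> (inside C))\<^sup>*"
    and "finite N" "N \<subseteq> C"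
  shows "\<exists>W. finite W \<and> N \<subseteq> W \<and> W \<subseteq> C \<and> (\<forall>p\<in>W. \<forall>q\<in>W. (p, q) \<in> (links \<epsilon> (inside W))\<^sup>*)"
proof -
  have path: "\<exists>W. finite W \<and> W \<subseteq> C \<and> q \<in> W \<and> (\<forall>t\<in>W. (p, t) \<in> (links \<epsilon> (inside W))\<^sup>*)"
    if "(p, q) \<in> (links \<epsilon> (inside C))\<^sup>*" "p \<in> C" for p q
    using that(1)
  proof (induction rule: rtrancl_induct)
    case base
    then show ?case using that(2) by (intro exI[of _ "{p}"]) auto
  next
    case (step y z)
    obtain W where W: "finite W" "W \<subseteq> C" "y \<in> W" "\<forall>t\<in>W. (p, t) \<in> (links \<epsilon> (inside W))\<^sup>*" using step.IH by blast
    obtain e where e: "e \<in> inside C" "\<epsilon> e = {y, z}" using step.hyps(2) unfolding links_def by blast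
    have mono: "(links \<epsilon> (inside W))\<^sup>* \<subseteq> (links \<epsilon> (inside (insert z W)))\<^sup>*"
      by (intro rtrancl_mono links_mono inside_mono) blast
    have "(y, z) \<in> links \<epsilon> (inside (insert z W))" using e W(3) unfolding links_def inside_def by auto
    then have "(p, z) \<in> (links \<epsilon> (inside (insert z W)))\<^sup>*" using W(3,4) mono by (meson rtrancl.rtrancl_into_rtrancl subsetD)
    then have "\<forall>t\<in>insert z W. (p, t) \<in> (links \<epsilon> (inside (insert z W)))\<^sup>*" using W(4) mono by blast
    moreover have "insert z W \<subseteq> C" using W(2) e unfolding inside_def by auto
    ultimately show ?case using W(1) by (intro exI[of _ "insert z W"]) auto
  qed
  show ?thesis
  proof (cases "N = {}")
    case True
    then show ?thesis by (intro exI[of _ "{}"]) simp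
  next
    case False
    then obtain p where p: "p \<in> N" by blast
    have "\<forall>q\<in>N. \<exists>W. finite W \<and> W \<subseteq> C \<and> q \<in> W \<and> (\<forall>t\<in>W. (p, t) \<in> (links \<epsilon> (inside W))\<^sup>*)"
    proof
      fix q assume "q \<in> N"
      then have "p \<in> C" "q \<in> C" using p assms(3) by auto
      from path[OF conn[rule_format, OF this] this(1)]
      show "\<exists>W. finite W \<and> W \<subseteq> C \<and> q \<in> W \<and> (\<forall>t\<in>W. (p, t) \<in> (links \<epsilon> (inside W))\<^sup>*)" .
    qed
    then obtain W where W: "\<And>q. q \<in> N \<Longrightarrow> finite (W q)" "\<And>q. q \<in> N \<Longrightarrow> W q \<subseteq> C" "\<And>q. q \<in> N \<Longrightarrow> q \<in> W q"
      "\<And>q t. q \<in> N \<Longrightarrow> t \<in> W q \<Longrightarrow> (p, t) \<in> (links \<epsilon> (inside (W q)))\<^sup>*" by metis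
    let ?W = "\<Union>q\<in>N. W q"
    have "(p, t) \<in> (links \<epsilon> (inside ?W))\<^sup>*" if t: "t \<in> ?W" for t
    proof -
      obtain q where q: "q \<in> N" "t \<in> W q" using t by blast
      have "(links \<epsilon> (inside (W q)))\<^sup>* \<subseteq> (links \<epsilon> (inside ?W))\<^sup>*"
        by (intro rtrancl_mono links_mono inside_mono) (use q in blast)
      then show ?thesis using W(4)[OF q] by blast
    qed
    note pW = this
    have "(s, t) \<in> (links \<epsilon> (inside ?W))\<^sup>*" if "s \<in> ?W" "t \<in> ?W" for s t
      by (rule rtrancl_trans[OF rtrancl_links_sym[OF pW[OF that(1)]] pW[OF that(2)]])
    then have "\<forall>s\<in>?W. \<forall>t\<in>?W. (s, t) \<in> (links \<epsilon> (inside ?W))\<^sup>*" by blast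
    moreover have "finite ?W" "N \<subseteq> ?W" "?W \<subseteq> C" using W(1,2,3) assms(2) by auto
    ultimately show ?thesis by (intro exI[of _ ?W]) simp
  qed
qed

text \<open>\<open>C\<close> is the component of \<open>X - K\<close> that contains a tail of
  \<open>r\<close>. An edge inside \<open>X\<close> that leaves \<open>C\<close> has an end in
  \<open>K\<close>, so only finitely many vertices of \<open>C\<close> meet such edges. Joining them
  up inside \<open>C\<close> gives a finite connected \<open>W\<close> through which every
  connection within \<open>X\<close> from outside into \<open>C\<close> has to pass.\<close>

lemma finite_connected_separator:
  assumes X: "region X" and r: "r \<in> rays G" "tends r X" and K: "finite K" "K \<subseteq> X"
  shows "\<exists>C W. finite W \<and> W \<subseteq> X - K \<and> (\<forall>p\<in>W. \<forall>q\<in>W. (p, q) \<in> (links \<epsilon> (inside W))\<^sup>*) \<and>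
    tends r C \<and> C \<subseteq> X - K \<and> (\<forall>e\<in>inside (X - K). \<epsilon> e \<inter> C \<noteq> {} \<longrightarrow> \<epsilon> e \<subseteq> C) \<and>
    (\<forall>e\<in>inside X. \<not> \<epsilon> e \<subseteq> C \<longrightarrow> \<epsilon> e \<inter> C \<subseteq> W)"
proof -
  have XV: "X \<subseteq> V" using X unfolding region_def by simp
  have XK: "region (X - K)" using K XV by (intro region_Diff[OF X] region_finite) auto
  obtain n where n: "\<And>i. i \<ge> n \<Longrightarrow> fst r i \<in> X - K"
    using tends_avoid_finite[OF r(1) K(1) r(2)] unfolding tends_def by blast
  define C where "C = {q. (fst r n, q) \<in> (links \<epsilon> (inside (X - K)))\<^sup>*}"
  note C = component_region[OF XK n[OF order_refl] C_def]
  have start: "fst r n \<in> C" unfolding C_def by simp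
  have "fst r (n + i) \<in> C" for i
  proof (induction i)
    case (Suc i)
    have "snd r (n + i) \<in> inside (X - K)"
      using raysD(3,4)[OF r(1), of "n + i"] n[of "n + i"] n[of "Suc (n + i)"] unfolding inside_def by auto
    then show ?case using C(3)[of "snd r (n + i)"] Suc raysD(4)[OF r(1), of "n + i"] by auto
  qed (use start in simp)
  then have "fst r i \<in> C" if "i \<ge> n" for i using le_Suc_ex[OF that] by auto
  then have tC: "tends r C" unfolding tends_def by blast
  have connC: "(p, q) \<in> (links \<epsilon> (inside C))\<^sup>*" if "p \<in> C" "q \<in> C" for p q
  proof -
    have "(fst r n, t) \<in> (links \<epsilon> (inside C))\<^sup>*" if "t \<in> C" for t
    proof -
      have "(fst r n, t) \<in> (links \<epsilon> (inside (X - K)))\<^sup>*" using that unfolding C_def by simp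
      from rtrancl_links_component[OF this start C(3)]
      have "(fst r n, t) \<in> (links \<epsilon> {e \<in> inside (X - K). \<epsilon> e \<subseteq> C})\<^sup>*" by simp
      moreover have "{e \<in> inside (X - K). \<epsilon> e \<subseteq> C} \<subseteq> inside C" unfolding inside_def by auto
      ultimately show ?thesis by (rule subsetD[OF rtrancl_mono[OF links_mono], rotated])
    qed
    note pC = this
    show ?thesis by (rule rtrancl_trans[OF rtrancl_links_sym[OF pC[OF that(1)]] pC[OF that(2)]])
  qed
  define N where "N = {q \<in> C. \<exists>e\<in>inside X. q \<in> \<epsilon> e \<and> \<not> \<epsilon> e \<subseteq> C}"
  have "N \<subseteq> (\<Union>e\<in>{e \<in> E. \<epsilon> e \<inter> K \<noteq> {}}. \<epsilon> e)"
  proof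
    fix q assume "q \<in> N"
    then obtain e where e: "e \<in> inside X" "q \<in> \<epsilon> e" "\<not> \<epsilon> e \<subseteq> C" "q \<in> C" unfolding N_def by blast
    then have "e \<notin> inside (X - K)" using C(3) by blast
    then have "\<epsilon> e \<inter> K \<noteq> {}" "e \<in> E" using e(1) unfolding inside_def by auto
    then show "q \<in> (\<Union>e\<in>{e \<in> E. \<epsilon> e \<inter> K \<noteq> {}}. \<epsilon> e)" using e(2) by blast
  qed
  moreover have "finite (\<epsilon> e)" if "e \<in> E" for e using edge_two[OF that] by auto
  then have "finite (\<Union>e\<in>{e \<in> E. \<epsilon> e \<inter> K \<noteq> {}}. \<epsilon> e)" using finite_incident[of K] K XV by auto
  ultimately have finN: "finite N" by (rule finite_subset)
  have "N \<subseteq> C" unfolding N_def by blast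
  moreover have "\<forall>p\<in>C. \<forall>q\<in>C. (p, q) \<in> (links \<epsilon> (inside C))\<^sup>*" using connC by simp
  ultimately have "\<exists>W. finite W \<and> N \<subseteq> W \<and> W \<subseteq> C \<and> (\<forall>p\<in>W. \<forall>q\<in>W. (p, q) \<in> (links \<epsilon> (inside W))\<^sup>*)"
    by (intro finite_connected_superset finN)
  then obtain W where W: "finite W" "N \<subseteq> W" "W \<subseteq> C" "\<forall>p\<in>W. \<forall>q\<in>W. (p, q) \<in> (links \<epsilon> (inside W))\<^sup>*"
    by blast
  moreover have "\<forall>e\<in>inside X. \<not> \<epsilon> e \<subseteq> C \<longrightarrow> \<epsilon> e \<inter> C \<subseteq> W" using W(2) unfolding N_def by blast
  moreover have "\<forall>e\<in>inside (X - K). \<epsilon> e \<inter> C \<noteq> {} \<longrightarrow> \<epsilon> e \<subseteq> C" using C(3) by blast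
  ultimately show ?thesis using tC C(1) by (intro exI[of _ C] exI[of _ W]) auto
qed

text \<open>The root for \<open>link_avoiding_root\<close> is the new cell \<open>x\<close> of the
  ray, \<open>c\<close> measures the boundary edges of \<open>X\<close> at a cell, and the sets
  \<open>W i\<close> come from nested separators between \<open>{a, b}\<close> and the ray.\<close>

lemma link_cell:
  assumes s: "state P T" and X: "X \<in> P" and r: "r \<in> rays G" "tends r X"
    and ab: "a \<in> X" "b \<in> X" and i0: "i0 < j"
  obtains P' T' x where "state P' T'" "extends P T P' T'" "\<And>A. A \<in> P \<Longrightarrow> A \<noteq> X \<Longrightarrow> A \<in> P'"
    "x \<in> P'" "tends r x" "x \<subseteq> X" "a \<notin> x" "b \<notin> x" "(a, b) \<in> conn \<epsilon> P' {e \<in> T' i0. \<epsilon> e \<inter> x = {}}"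
proof -
  have solX: "solid X" using stateD(2)[OF s X] .
  have regX: "region X" using solid_region[OF solX] .
  have XV: "X \<subseteq> V" using regX unfolding region_def by simp
  define sep where "sep K C W \<longleftrightarrow> finite W \<and> W \<subseteq> X - K \<and> (\<forall>p\<in>W. \<forall>q\<in>W. (p, q) \<in> (links \<epsilon> (inside W))\<^sup>*) \<and>
    tends r C \<and> C \<subseteq> X - K \<and> (\<forall>e\<in>inside (X - K). \<epsilon> e \<inter> C \<noteq> {} \<longrightarrow> \<epsilon> e \<subseteq> C) \<and>
    (\<forall>e\<in>inside X. \<not> \<epsilon> e \<subseteq> C \<longrightarrow> \<epsilon> e \<inter> C \<subseteq> W)" for K C W
  have "\<forall>K. finite K \<and> K \<subseteq> X \<longrightarrow> (\<exists>C W. sep K C W)"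
    unfolding sep_def using finite_connected_separator[OF regX r] by blast
  then obtain Cf Wf where CW: "\<And>K. finite K \<Longrightarrow> K \<subseteq> X \<Longrightarrow> sep K (Cf K) (Wf K)" by metis
  \<comment> \<open>Each separator is absorbed into the set to be avoided before the next one is
    built, so all of them are disjoint and each separates \<open>a\<close> and \<open>b\<close> from
    the ray.\<close>
  define Ks where "Ks = rec_nat {a, b} (\<lambda>_ K. K \<union> Wf K)"
  have Ks0: "Ks 0 = {a, b}" and KsSuc: "Ks (Suc i) = Ks i \<union> Wf (Ks i)" for i unfolding Ks_def by simp_all
  have Ks: "finite (Ks i) \<and> Ks i \<subseteq> X" for i
  proof (induction i)
    case (Suc i)
    then show ?case using CW[of "Ks i"] unfolding KsSuc sep_def by auto
  qed (use ab Ks0 in auto)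
  have sepi: "sep (Ks i) (Cf (Ks i)) (Wf (Ks i))" for i using CW Ks by blast
  have Ksmono: "Ks i \<subseteq> Ks i'" if "i \<le> i'" for i i'
    using that by (induction rule: dec_induct) (auto simp: KsSuc)
  define m where "m = card (bd X)"
  let ?K = "Ks (Suc m)"
  have K: "finite ?K" "?K \<subseteq> X" "?K \<noteq> {}" using Ks[of "Suc m"] Ksmono[of 0 "Suc m"] Ks0 by auto
  \<comment> \<open>The vertices of all separators become singleton cells: the separators stay
    connected and disjoint in the quotient, and the cell of the ray misses them.\<close>
  obtain C where C: "region_partition X C" "\<And>A. A \<in> C \<Longrightarrow> solid A" "\<And>w. w \<in> ?K \<Longrightarrow> {w} \<in> C"
    using solid_partition_singletons[OF regX K] by blast
  note CD = region_partitionD[OF C(1)]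
  have abK: "a \<in> Ks i" "b \<in> Ks i" for i using Ksmono[of 0 i] Ks0 by auto
  have WK: "Wf (Ks i) \<subseteq> ?K" if "i < Suc m" for i
    using Ksmono[of "Suc i" "Suc m"] that KsSuc[of i] by auto
  obtain x where x: "x \<in> C" "tends r x" using tends_cell[OF r(1) C(1) r(2)] .
  have single: "A = {w}" if "A \<in> C" "w \<in> A" "w \<in> ?K" for A w
    using CD(6)[OF that(1) C(3)[OF that(3)]] that(2) by auto
  have xK: "x \<inter> ?K = {}"
  proof (rule ccontr)
    assume "x \<inter> ?K \<noteq> {}"
    then obtain w where "x = {w}" using single[OF x(1)] by blast
    then show False using not_tends_finite[OF r(1), of "{w}"] x(2) by simp
  qed
  let ?E = "crossing X C" and ?q = "quotient_ends C"
  \<comment> \<open>One separator more than \<open>X\<close> has boundary edges;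
    \<open>sum c C\<close> is at most \<open>m\<close>.\<close>
  define n where "n = Suc m"
  define W where "W i = (\<lambda>w. {w}) ` Wf (Ks i)" for i
  define c where "c Z = card {e \<in> bd X. \<epsilon> e \<inter> Z \<noteq> {}}" for Z
  have finbd: "finite (bd X)" using regX unfolding region_def by simp
  have single_edge: "?q e = {{p}, {q}} \<and> e \<in> ?E"
    if e: "e \<in> E" "\<epsilon> e = {p, q}" "p \<in> ?K" "q \<in> ?K" for e p q
  proof -
    have "p \<noteq> q" using edge_ends[OF e(1)] e(2) by (metis doubleton_eq_iff)
    have "A = {p} \<or> A = {q}" if "A \<in> C" "A \<inter> \<epsilon> e \<noteq> {}" for A using single[OF that(1)] that(2) e by auto
    then have "?q e = {{p}, {q}}" using C(3)[OF e(3)] C(3)[OF e(4)] e(2) unfolding quotient_ends_def by auto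
    moreover have "\<not> \<epsilon> e \<subseteq> A" if "A \<in> C" for A
    proof
      assume "\<epsilon> e \<subseteq> A"
      then have "A = {p}" "A = {q}" using single[OF that] e by auto
      then show False using \<open>p \<noteq> q\<close> by simp
    qed
    then have "e \<in> ?E" using e K(2) unfolding crossing_def inside_def by auto
    ultimately show ?thesis by simp
  qed
  obtain h0 where h0: "orientation ?q h0 ?E" "\<And>A. A \<noteq> {} \<Longrightarrow> A \<subseteq> C - {x} \<Longrightarrow> Suc j \<le> card (enters ?q h0 ?E A)"
    using quotient_orientation[OF solX C(1) x(1)] by blast
  \<comment> \<open>A boundary edge of the union of \<open>A\<close> either crosses in the quotient
    or leaves \<open>X\<close>, and those of the second kind are counted by \<open>c\<close>. The
    union is not \<open>V\<close> because it misses \<open>x\<close>.\<close>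
  have cut: "2 * Suc j \<le> card {e \<in> ?E. ?q e \<inter> A \<noteq> {} \<and> \<not> ?q e \<subseteq> A} + sum c A"
    if A: "A \<noteq> {}" "A \<subseteq> C - {x}" for A
  proof -
    let ?U = "\<Union>A"
    have finA: "finite A" using A(2) CD(1) finite_subset by blast
    have U: "region ?U" using A(2) CD(5) by (intro region_Union finA) blast
    obtain Z0 where "Z0 \<in> A" using A(1) by blast
    then have "?U \<noteq> {}" using A(2) CD(3)[of Z0] by blast
    moreover have "?U \<noteq> V"
    proof
      assume UV: "?U = V"
      have "x \<inter> Z = {}" if "Z \<in> A" for Z using CD(6)[OF x(1), of Z] A(2) that by blast
      then have "x \<inter> V = {}" using UV by blast
      then show False using CD(3,4)[OF x(1)] XV by blast
    qed
    ultimately have "2 * Suc j \<le> card (bd ?U)" using U by (intro card_bd_ge) (auto simp: region_def)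
    also have "bd ?U \<subseteq> {e \<in> ?E. ?q e \<inter> A \<noteq> {} \<and> \<not> ?q e \<subseteq> A} \<union> (\<Union>Z\<in>A. {e \<in> bd X. \<epsilon> e \<inter> Z \<noteq> {}})"
    proof
      fix e assume e: "e \<in> bd ?U"
      then obtain Z where Z: "Z \<in> A" "\<epsilon> e \<inter> Z \<noteq> {}" and eE: "e \<in> E" and nU: "\<not> \<epsilon> e \<subseteq> ?U" unfolding bd_def by blast
      have ZC: "Z \<in> C" "Z \<subseteq> X" using Z(1) A(2) CD(4) by auto
      show "e \<in> {e \<in> ?E. ?q e \<inter> A \<noteq> {} \<and> \<not> ?q e \<subseteq> A} \<union> (\<Union>Z\<in>A. {e \<in> bd X. \<epsilon> e \<inter> Z \<noteq> {}})"
      proof (cases "\<epsilon> e \<subseteq> X")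
        case True
        have "\<not> \<epsilon> e \<subseteq> B" if "B \<in> C" for B
        proof
          assume "\<epsilon> e \<subseteq> B"
          then have "B = Z" using CD(6)[OF that ZC(1)] Z(2) by blast
          then show False using \<open>\<epsilon> e \<subseteq> B\<close> Z(1) nU by blast
        qed
        then have eC: "e \<in> ?E" using True eE unfolding crossing_def inside_def by blast
        moreover have "Z \<in> ?q e" using Z(2) ZC(1) unfolding quotient_ends_def by blast
        moreover have "\<not> ?q e \<subseteq> A"
        proof
          assume "?q e \<subseteq> A"
          moreover obtain A' B' p q where "\<epsilon> e = {p, q}" "p \<in> A'" "q \<in> B'" "?q e = {A', B'}"
            using crossing_ends[OF C(1) eC] by metis
          ultimately show False using nU by auto
        qed
        ultimately show ?thesis using Z(1) by blast
      next
        case False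
        then have "e \<in> bd X" using eE Z(2) ZC(2) unfolding bd_def by blast
        then show ?thesis using Z by blast
      qed
    qed
    then have "card (bd ?U) \<le> card ({e \<in> ?E. ?q e \<inter> A \<noteq> {} \<and> \<not> ?q e \<subseteq> A} \<union> (\<Union>Z\<in>A. {e \<in> bd X. \<epsilon> e \<inter> Z \<noteq> {}}))"
      using finA finbd finite_crossing[OF C(1)] by (intro card_mono) auto
    also have "\<dots> \<le> card {e \<in> ?E. ?q e \<inter> A \<noteq> {} \<and> \<not> ?q e \<subseteq> A} + card (\<Union>Z\<in>A. {e \<in> bd X. \<epsilon> e \<inter> Z \<noteq> {}})"
      by (rule card_Un_le)
    also have "\<dots> \<le> card {e \<in> ?E. ?q e \<inter> A \<noteq> {} \<and> \<not> ?q e \<subseteq> A} + sum c A"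
      unfolding c_def by (intro add_left_mono card_UN_le finA)
    finally show ?thesis .
  qed
  have nlt: "sum c C < n"
  proof -
    have "{e \<in> bd X. \<epsilon> e \<inter> Z \<noteq> {}} \<inter> {e \<in> bd X. \<epsilon> e \<inter> Z' \<noteq> {}} = {}" if Z: "Z \<in> C" "Z' \<in> C" "Z \<noteq> Z'" for Z Z'
    proof -
      have False if e: "e \<in> bd X" "\<epsilon> e \<inter> Z \<noteq> {}" "\<epsilon> e \<inter> Z' \<noteq> {}" for e
      proof -
        obtain p q where pq: "\<epsilon> e = {p, q}" using edge_two[of e] e(1) unfolding bd_def by blast
        moreover have "\<epsilon> e \<inter> Z \<inter> Z' = {}" using CD(6)[OF Z] by blast
        ultimately have "\<epsilon> e \<subseteq> Z \<union> Z'" using e by auto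
        then have "\<epsilon> e \<subseteq> X" using CD(4) Z by blast
        then show False using e(1) unfolding bd_def by blast
      qed
      then show ?thesis by blast
    qed
    then have "card (\<Union>Z\<in>C. {e \<in> bd X. \<epsilon> e \<inter> Z \<noteq> {}}) = sum c C"
      unfolding c_def using CD(1) finbd by (intro card_UN_disjoint) auto
    moreover have "card (\<Union>Z\<in>C. {e \<in> bd X. \<epsilon> e \<inter> Z \<noteq> {}}) \<le> m" unfolding m_def using finbd by (intro card_mono) auto
    ultimately show ?thesis unfolding n_def by simp
  qed
  have aC: "{a} \<in> C - {x}" "{b} \<in> C - {x}" using C(3) abK[of "Suc m"] xK by auto
  have WC: "W i \<subseteq> C - {x}" if "i < n" for i
    using WK[of i] that C(3) xK unfolding W_def n_def by auto
  have Wd: "W i \<inter> W i' = {}" if "i < n" "i' < n" "i \<noteq> i'" for i i'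
  proof -
    have *: "Wf (Ks i) \<inter> Wf (Ks i') = {}" if "i < i'" for i i'
    proof -
      have "Wf (Ks i) \<subseteq> Ks i'" using Ksmono[of "Suc i" i'] that KsSuc[of i] by auto
      then show ?thesis using sepi[of i'] unfolding sep_def by blast
    qed
    have "Wf (Ks i) \<inter> Wf (Ks i') = {}" using *[of i i'] *[of i' i] \<open>i \<noteq> i'\<close> by (cases "i < i'") auto
    then show ?thesis unfolding W_def by auto
  qed
  have Wc: "(A, B) \<in> (links ?q {e \<in> ?E. ?q e \<subseteq> W i})\<^sup>*" if i: "i < n" and AB: "A \<in> W i" "B \<in> W i" for i A B
  proof -
    obtain p q where pq: "A = {p}" "B = {q}" "p \<in> Wf (Ks i)" "q \<in> Wf (Ks i)" using AB unfolding W_def by auto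
    have "(p, q) \<in> (links \<epsilon> (inside (Wf (Ks i))))\<^sup>*" using sepi[of i] pq(3,4) unfolding sep_def by blast
    then have "({p}, {q}) \<in> (links ?q {e \<in> ?E. ?q e \<subseteq> W i})\<^sup>*"
    proof (induction rule: rtrancl_induct)
      case (step y z)
      obtain e where e: "e \<in> E" "\<epsilon> e = {y, z}" "y \<in> Wf (Ks i)" "z \<in> Wf (Ks i)"
        using step.hyps(2) unfolding links_def inside_def by auto
      have "y \<in> ?K" "z \<in> ?K" using e(3,4) WK[of i] i unfolding n_def by auto
      then have "?q e = {{y}, {z}}" "e \<in> ?E" using single_edge[OF e(1,2)] by auto
      then have "({y}, {z}) \<in> links ?q {e \<in> ?E. ?q e \<subseteq> W i}" using e(3,4) unfolding links_def W_def by auto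
      with step.IH show ?case by (meson rtrancl.rtrancl_into_rtrancl)
    qed simp
    then show ?thesis unfolding pq .
  qed
  \<comment> \<open>The cell \<open>x\<close> lies in the component \<open>?C\<close>, and
    \<open>w\<close> does not. An edge from \<open>x\<close> to a cell outside \<open>?C\<close>
    would put a separator vertex into \<open>x\<close>, so the member \<open>Z0\<close> of
    \<open>B\<close> next to \<open>x\<close> lies in \<open>?C\<close>. On the way to
    \<open>w\<close> the set \<open>B\<close> leaves \<open>?C\<close>, and the leaving edge starts
    at a vertex of the separator, whose cell is a member of \<open>W i\<close>.\<close>
  have Ws: "B \<inter> W i \<noteq> {}"
    if i: "i < n" and B: "B \<subseteq> C - {x}" and w: "w \<in> {{a}, {b}}" "w \<in> B"
      and Bconn: "\<And>A. A \<in> B \<Longrightarrow> (A, w) \<in> (links ?q {e \<in> ?E. ?q e \<subseteq> B})\<^sup>*"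
      and e: "e \<in> ?E" "x \<in> ?q e" "?q e \<inter> B \<noteq> {}" for B w e i
  proof -
    let ?C = "Cf (Ks i)"
    have si: "Wf (Ks i) \<subseteq> ?K" "tends r ?C" "?C \<subseteq> X - Ks i"
      "\<And>e. e \<in> inside (X - Ks i) \<Longrightarrow> \<epsilon> e \<inter> ?C \<noteq> {} \<Longrightarrow> \<epsilon> e \<subseteq> ?C"
      "\<And>e. e \<in> inside X \<Longrightarrow> \<not> \<epsilon> e \<subseteq> ?C \<Longrightarrow> \<epsilon> e \<inter> ?C \<subseteq> Wf (Ks i)"
      using sepi[of i] WK[of i] i unfolding sep_def n_def by auto
    have KK: "Ks i \<subseteq> ?K" using Ksmono[of i "Suc m"] i unfolding n_def by simp
    \<comment> \<open>A solid cell is connected, so if it avoids \<open>?K\<close> it cannot lie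
      partly in the component \<open>?C\<close>; all other cells are singletons.\<close>
    have inC: "Z \<subseteq> ?C" if Z: "Z \<in> C" "Z \<inter> ?C \<noteq> {}" for Z
    proof (cases "Z \<inter> ?K = {}")
      case True
      obtain p where p: "p \<in> Z" "p \<in> ?C" using Z(2) by blast
      show ?thesis
      proof
        fix q assume "q \<in> Z"
        then have "(p, q) \<in> (links \<epsilon> (inside Z))\<^sup>*" using solid_connected[OF C(2)[OF Z(1)] p(1)] by blast
        moreover have "inside Z \<subseteq> inside (X - Ks i)" using CD(4)[OF Z(1)] True KK by (intro inside_mono) blast
        ultimately have "(p, q) \<in> (links \<epsilon> (inside (X - Ks i)))\<^sup>*"
          by (rule subsetD[OF rtrancl_mono[OF links_mono], rotated])
        from rtrancl_links_component[OF this p(2) si(4)] show "q \<in> ?C" by simp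
      qed
    next
      case False
      then obtain w where "Z = {w}" using single[OF Z(1)] by blast
      then show ?thesis using Z(2) by blast
    qed
    have "tends r (x \<inter> ?C)" using x(2) si(2) by (rule tends_Int)
    then have "x \<inter> ?C \<noteq> {}" by (metis not_tends_empty)
    then have xC: "x \<subseteq> ?C" using inC[OF x(1)] by blast
    obtain Z0 where Z0: "Z0 \<in> ?q e" "Z0 \<in> B" using e(3) by blast
    have edgeC: "\<exists>p\<in>A. \<exists>q\<in>A'. \<epsilon> f = {p, q} \<and> f \<in> inside X"
      if f: "f \<in> ?E" "?q f = {A, A'}" for f A A'
    proof -
      obtain A1 B1 p q where pq: "\<epsilon> f = {p, q}" "p \<in> A1" "q \<in> B1" "?q f = {A1, B1}"
        using crossing_ends[OF C(1) f(1)] by metis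
      have fX: "f \<in> inside X" using f(1) unfolding crossing_def by blast
      have "A1 = A \<and> B1 = A' \<or> A1 = A' \<and> B1 = A" using f(2) pq(4) by (auto simp: doubleton_eq_iff)
      then show ?thesis
      proof
        assume "A1 = A' \<and> B1 = A"
        moreover have "\<epsilon> f = {q, p}" using pq(1) by auto
        ultimately show ?thesis using pq fX by blast
      qed (use pq fX in blast)
    qed
    have leave: "\<exists>p\<in>A. p \<in> Wf (Ks i)" if f: "f \<in> ?E" "?q f = {A, A'}" and AA: "A \<subseteq> ?C" "A' \<inter> ?C = {}" for f A A'
    proof -
      obtain p q where pq: "p \<in> A" "q \<in> A'" "\<epsilon> f = {p, q}" "f \<in> inside X" using edgeC[OF f] by blast
      then have "\<not> \<epsilon> f \<subseteq> ?C" "p \<in> \<epsilon> f \<inter> ?C" using AA by auto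
      then show ?thesis using si(5)[OF pq(4)] pq(1) by blast
    qed
    have "Z0 \<subseteq> ?C"
    proof (rule ccontr)
      assume "\<not> Z0 \<subseteq> ?C"
      then have out: "Z0 \<inter> ?C = {}" using inC[of Z0] Z0(2) B by blast
      obtain A1 B1 where "?q e = {A1, B1}" using crossing_ends[OF C(1) e(1)] by metis
      moreover have "x \<noteq> Z0" using Z0(2) B by blast
      ultimately have "?q e = {x, Z0}" using e(2) Z0(1) by auto
      then obtain p where "p \<in> x" "p \<in> Wf (Ks i)" using leave[OF e(1) _ xC out] by blast
      then show False using si(1) xK by blast
    qed
    moreover have "\<not> w \<subseteq> ?C" using w(1) abK[of i] si(3) by auto
    ultimately obtain A A' where AA: "(A, A') \<in> links ?q {e \<in> ?E. ?q e \<subseteq> B}" "A \<subseteq> ?C" "\<not> A' \<subseteq> ?C"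
      using rtrancl_exit[OF Bconn[OF Z0(2)], of "{A. A \<subseteq> ?C}"] by blast
    then obtain f where f: "f \<in> ?E" "?q f = {A, A'}" and fB: "?q f \<subseteq> B" unfolding links_def by blast
    have f': "A \<in> B" "A' \<in> B" using fB unfolding f(2) by simp_all
    have "A' \<inter> ?C = {}" using inC[of A'] AA(3) f'(2) B by blast
    from leave[OF f AA(2) this] obtain p where p: "p \<in> A" "p \<in> Wf (Ks i)" by blast
    have "A = {p}" by (rule single) (use f'(1) B p si(1) in auto)
    then show ?thesis using f'(1) p(2) unfolding W_def by blast
  qed
  have "\<exists>h Q. orientation ?q h ?E \<and> Q \<subseteq> ?E \<and> (\<forall>e\<in>Q. x \<notin> ?q e) \<and> ({a}, {b}) \<in> (links ?q Q)\<^sup>* \<and>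
    (\<forall>A. A \<noteq> {} \<longrightarrow> A \<subseteq> C - {x} \<longrightarrow> j \<le> card (enters ?q h (?E - Q) A))"
    by (rule link_avoiding_root[where x = x and c = c and u = "{a}" and v = "{b}" and n = n and W = W])
      (fact quotient_multigraph[OF C(1)] h0 cut aC nlt WC Wd Wc Ws | blast)+
  then obtain h Q where hQ0: "orientation ?q h ?E \<and> Q \<subseteq> ?E \<and> (\<forall>e\<in>Q. x \<notin> ?q e) \<and>
    ({a}, {b}) \<in> (links ?q Q)\<^sup>* \<and>
    (\<forall>A. A \<noteq> {} \<longrightarrow> A \<subseteq> C - {x} \<longrightarrow> j \<le> card (enters ?q h (?E - Q) A))"
    by (elim exE)
  then have hQ: "orientation ?q h ?E" "Q \<subseteq> ?E" "\<And>e. e \<in> Q \<Longrightarrow> x \<notin> ?q e" "({a}, {b}) \<in> (links ?q Q)\<^sup>*"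
    "\<And>A. A \<noteq> {} \<Longrightarrow> A \<subseteq> C - {x} \<Longrightarrow> j \<le> card (enters ?q h (?E - Q) A)"
    by simp_all
  from quotient_packing[where n = j, OF C(1) x(1) Diff_subset hQ(1,5)]
  obtain F where F: "\<And>i. i < j \<Longrightarrow> F i \<subseteq> ?E - Q" "\<And>i i'. i < j \<Longrightarrow> i' < j \<Longrightarrow> i \<noteq> i' \<Longrightarrow> F i \<inter> F i' = {}"
    "\<And>i p q. i < j \<Longrightarrow> p \<in> X \<Longrightarrow> q \<in> X \<Longrightarrow> (p, q) \<in> conn \<epsilon> C (F i)"
    by metis
  \<comment> \<open>The linking edges \<open>Q\<close> are given to tree \<open>i0\<close> and
    protected by \<open>?L\<close> during the thinning; the packing itself uses only edges outside
    \<open>Q\<close>.\<close>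
  let ?F = "\<lambda>i. if i = i0 then F i \<union> Q else F i" and ?L = "\<lambda>i. if i = i0 then Q else {}"
  have F': "?F i \<subseteq> ?E" if "i < j" for i using F(1)[OF that] hQ(2) by auto
  have F'': "?F i \<inter> ?F i' = {}" if "i < j" "i' < j" "i \<noteq> i'" for i i'
    using F(1)[OF that(1)] F(1)[OF that(2)] F(2)[OF that] that(3) by auto
  have F3: "(p, q) \<in> conn \<epsilon> C (?F i)" if "i < j" "p \<in> X" "q \<in> X" for i p q
    by (rule conn_monoD[OF F(3)[OF that]]) auto
  have L': "?L i \<subseteq> ?F i" if "i < j" for i by auto
  let ?P = "P - {X} \<union> C"
  have "\<exists>T'. state ?P T' \<and> extends P T ?P T' \<and>
    (\<forall>i<j. conn \<epsilon> ?P (?L i) \<subseteq> conn \<epsilon> ?P (T' i \<inter> ?L i))"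
    by (rule extend_cell[where F = ?F and L = ?L and C = C]) (fact s X C F' F'' F3 L' | blast)+
  then obtain T' where T': "state ?P T'" "extends P T ?P T'"
    "\<forall>i<j. conn \<epsilon> ?P (?L i) \<subseteq> conn \<epsilon> ?P (T' i \<inter> ?L i)" by (elim exE conjE)
  have "(a, b) \<in> conn \<epsilon> C Q" using quotient_conn[OF C(1) hQ(2,4)] aC by blast
  then have "(a, b) \<in> conn \<epsilon> ?P Q" using conn_partition_mono[of C ?P \<epsilon> Q] by blast
  then have "(a, b) \<in> conn \<epsilon> ?P (T' i0 \<inter> Q)" using T'(3)[rule_format, OF i0] by auto
  moreover have "T' i0 \<inter> Q \<subseteq> {e \<in> T' i0. \<epsilon> e \<inter> x = {}}"
    using hQ(3) x(1) unfolding quotient_ends_def by blast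
  ultimately have "(a, b) \<in> conn \<epsilon> ?P {e \<in> T' i0. \<epsilon> e \<inter> x = {}}" by (rule conn_monoD)
  moreover have "x \<subseteq> X" using CD(4)[OF x(1)] .
  moreover have "a \<notin> x" "b \<notin> x" using xK abK[of "Suc m"] by auto
  ultimately show ?thesis using that[OF T'(1,2), of x] x by blast
qed

text \<open>The connection is cut at its first arrival in \<open>Y\<close>. The arrival is by an
  edge, because a cell that meets \<open>Y\<close> is \<open>Y\<close> itself.\<close>

lemma conn_first_entry:
  assumes "(y, z) \<in> conn \<epsilon> P T" "y \<notin> Y" and Y: "\<And>A. A \<in> P \<Longrightarrow> A = Y \<or> A \<inter> Y = {}"
  shows "(y, z) \<in> conn \<epsilon> (P - {Y}) {e \<in> T. \<epsilon> e \<inter> Y = {}} \<and> z \<notin> Y \<or>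
    (\<exists>a' a e. (y, a') \<in> conn \<epsilon> (P - {Y}) {e \<in> T. \<epsilon> e \<inter> Y = {}} \<and> e \<in> T \<and> \<epsilon> e = {a', a} \<and> a \<in> Y \<and> a' \<notin> Y)"
  using assms(1) unfolding conn_def[of \<epsilon> P T]
proof (induction rule: rtrancl_induct)
  case base
  then show ?case using assms(2) by simp
next
  case (step p q)
  let ?R = "conn \<epsilon> (P - {Y}) {e \<in> T. \<epsilon> e \<inter> Y = {}}"
  show ?case
  proof (cases "(y, p) \<in> ?R \<and> p \<notin> Y")
    case True
    from step.hyps(2) show ?thesis
    proof
      assume "(p, q) \<in> same P"
      then obtain A where A: "A \<in> P" "p \<in> A" "q \<in> A" unfolding same_def by blast
      have "A \<inter> Y = {}" using Y[OF A(1)] A(2) True by blast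
      then have "(p, q) \<in> ?R" using A by (intro conn_same[of A]) auto
      then have "(y, q) \<in> ?R" using True conn_trans[of y p] by blast
      then show ?thesis using A(3) \<open>A \<inter> Y = {}\<close> by blast
    next
      assume "(p, q) \<in> links \<epsilon> T"
      then obtain e where e: "e \<in> T" "\<epsilon> e = {p, q}" unfolding links_def by blast
      show ?thesis
      proof (cases "q \<in> Y")
        case True
        then show ?thesis using e \<open>(y, p) \<in> ?R \<and> p \<notin> Y\<close> by blast
      next
        case False
        then have "(p, q) \<in> ?R" using e True by (intro conn_edge[of e]) auto
        then have "(y, q) \<in> ?R" using True conn_trans[of y p] by blast
        then show ?thesis using False by blast
      qed
    qed
  next
    case False
    then show ?thesis using step.IH by blast
  qed
qed

lemma extends_singleton:
  assumes "state P T" "state P' T'" "extends P T P' T'" "{v} \<in> P"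
  shows "{v} \<in> P'"
proof -
  note P = region_partitionD[OF stateD(1)[OF assms(1)]] and P' = region_partitionD[OF stateD(1)[OF assms(2)]]
  have "v \<in> V" using P(4)[OF assms(4)] by simp
  then obtain B where B: "B \<in> P'" "v \<in> B" using P'(2) by blast
  have "B \<subseteq> {v}"
    using refines_cases[OF stateD(1)[OF assms(1)] stateD(1)[OF assms(2)] extendsD(1)[OF assms(3)] assms(4) B(1)] B(2) by blast
  then have "B = {v}" using B(2) by blast
  then show ?thesis using B(1) by simp
qed

text \<open>Isolating \<open>y\<close> and \<open>z\<close> keeps them out of the cell
  \<open>X\<close> of the ray. If their connection in tree \<open>i\<close> uses \<open>X\<close>,
  it is cut at its first entry \<open>a\<close> seen from \<open>y\<close> and its first entry
  \<open>b\<close> seen from \<open>z\<close>, and the gap is bridged by a link from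
  \<open>a\<close> to \<open>b\<close> that avoids the new cell of the ray.\<close>

lemma resolving_extension:
  assumes s0: "state P0 T0" and r: "r \<in> rays G" and yz: "y \<in> V" "z \<in> V" and i: "i < j"
  obtains P' T' x where "state P' T'" "extends P0 T0 P' T'" "{y} \<in> P'"
    "x \<in> P'" "tends r x" "y \<notin> x" "(y, z) \<in> conn \<epsilon> P' {e \<in> T' i. \<epsilon> e \<inter> x = {}}"
proof -
  obtain P1 T1 where s1: "state P1 T1" "extends P0 T0 P1 T1" "{y} \<in> P1" using isolate_vertex[OF s0 yz(1)] .
  obtain P T where s: "state P T" "extends P1 T1 P T" "{z} \<in> P" using isolate_vertex[OF s1(1) yz(2)] .
  have yP: "{y} \<in> P" by (rule extends_singleton[OF s1(1) s(1,2) s1(3)])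
  have ext: "extends P0 T0 P T" by (rule extends_trans[OF s0 s1(1) s1(2) s(2)])
  note sD = stateD[OF s(1)]
  note P = region_partitionD[OF sD(1)]
  have "tends r V" using raysD(2)[OF r] unfolding tends_def by blast
  then obtain X where X: "X \<in> P" "tends r X" using tends_cell[OF r sD(1)] by blast
  have nX: "v \<notin> X" if "{v} \<in> P" for v
  proof
    assume "v \<in> X"
    then have "X = {v}" using P(6)[OF X(1) that] by blast
    then show False using not_tends_finite[OF r, of "{v}"] X(2) by simp
  qed
  have yX: "y \<notin> X" "z \<notin> X" using nX yP s(3) by auto
  have disj: "A = X \<or> A \<inter> X = {}" if "A \<in> P" for A using P(6)[OF that X(1)] by blast
  let ?R = "conn \<epsilon> (P - {X}) {e \<in> T i. \<epsilon> e \<inter> X = {}}"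
  have yz': "(y, z) \<in> conn \<epsilon> P (T i)" using sD(6)[OF i yz] .
  show ?thesis
  proof (cases "(y, z) \<in> ?R")
    case True
    then have "(y, z) \<in> conn \<epsilon> P {e \<in> T i. \<epsilon> e \<inter> X = {}}" using conn_partition_mono[of "P - {X}" P] by blast
    then show ?thesis using that[OF s(1) ext yP X yX(1)] by blast
  next
    case False
    obtain a' a e where a: "(y, a') \<in> ?R" "e \<in> T i" "\<epsilon> e = {a', a}" "a \<in> X" "a' \<notin> X"
      using conn_first_entry[OF yz' yX(1) disj] False by blast
    have "(z, y) \<notin> ?R" using False by (auto dest: conn_sym)
    then obtain b' b f where b: "(z, b') \<in> ?R" "f \<in> T i" "\<epsilon> f = {b', b}" "b \<in> X" "b' \<notin> X"
      using conn_first_entry[OF conn_sym[OF yz'] yX(2) disj] by blast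
    have "\<exists>P' T' x. state P' T' \<and> extends P T P' T' \<and> (\<forall>A\<in>P. A \<noteq> X \<longrightarrow> A \<in> P') \<and> x \<in> P' \<and> tends r x \<and>
      x \<subseteq> X \<and> a \<notin> x \<and> b \<notin> x \<and> (a, b) \<in> conn \<epsilon> P' {e \<in> T' i. \<epsilon> e \<inter> x = {}}"
      by (rule link_cell[OF s(1) X(1) r X(2) a(4) b(4) i]) blast
    then obtain P' T' x where l: "state P' T'" "extends P T P' T'" "\<forall>A\<in>P. A \<noteq> X \<longrightarrow> A \<in> P'"
      "x \<in> P'" "tends r x" "x \<subseteq> X" "a \<notin> x" "b \<notin> x" "(a, b) \<in> conn \<epsilon> P' {e \<in> T' i. \<epsilon> e \<inter> x = {}}"
      by (elim exE conjE)
    let ?R' = "conn \<epsilon> P' {e \<in> T' i. \<epsilon> e \<inter> x = {}}"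
    have up: "(p, q) \<in> ?R'" if "(p, q) \<in> ?R" for p q
      using that
    proof (rule conn_least)
      show "(a, b) \<in> ?R'" if "A \<in> P - {X}" "a \<in> A" "b \<in> A" for A a b using that l(3) by (intro conn_same[of A]) auto
      show "(a, b) \<in> ?R'" if "e \<in> {e \<in> T i. \<epsilon> e \<inter> X = {}}" "\<epsilon> e = {a, b}" for e a b
        using that l(6) extendsD(2)[OF l(2) i] by (intro conn_edge[of e]) auto
    qed
    have "(a', a) \<in> ?R'" using a l(6,7) extendsD(2)[OF l(2) i] by (intro conn_edge[of e]) auto
    moreover have "(b', b) \<in> ?R'" using b l(6,8) extendsD(2)[OF l(2) i] by (intro conn_edge[of f]) auto
    ultimately have "(y, a) \<in> ?R'" "(z, b) \<in> ?R'" using conn_trans[OF up[OF a(1)]] conn_trans[OF up[OF b(1)]] by auto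
    then have "(y, z) \<in> ?R'" using conn_trans[OF conn_trans[OF _ l(9)] conn_sym] by blast
    moreover have "{y} \<in> P'" by (rule extends_singleton[OF s(1) l(1,2) yP])
    moreover have "extends P0 T0 P' T'" by (rule extends_trans[OF s0 s(1) ext l(2)])
    ultimately show ?thesis using that[OF l(1) _ _ l(4,5)] yX(1) l(6) by blast
  qed
qed

end

section \<open>Rays, components and ends\<close>

text \<open>Finite walks inside \<open>Z n\<close> are concatenated to an infinite walk. It meets
  each vertex only finitely often, since the sets eventually leave every vertex behind, and so its
  loops can be erased. The graph is arbitrary because both \<open>G\<close> and the limit trees need
  such rays.\<close>

lemma ray_through_nested_sets:
  assumes sub: "Z 0 \<subseteq> verts H" and dec: "\<And>n. Z (Suc n) \<subseteq> Z n" and ne: "\<And>n. Z n \<noteq> {}"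
    and vanish: "\<And>v. \<exists>n. v \<notin> Z n"
    and conn: "\<And>n p q. p \<in> Z n \<Longrightarrow> q \<in> Z n \<Longrightarrow> (p, q) \<in> (links (endpts H) {e \<in> edges H. endpts H e \<subseteq> Z n})\<^sup>*"
  obtains r where "r \<in> rays H" "\<And>n. tends r (Z n)"
proof -
  let ?R = "\<lambda>n. links (endpts H) {e \<in> edges H. endpts H e \<subseteq> Z n}"
  have anti: "Z n \<subseteq> Z m" if "m \<le> n" for m n using that by (induction rule: dec_induct) (use dec in auto)
  define v where "v n = (SOME p. p \<in> Z n)" for n
  have v: "v n \<in> Z n" for n unfolding v_def using ne[of n] by (simp add: some_in_eq)
  have "\<exists>k g. g 0 = v n \<and> g k = v (Suc n) \<and> (\<forall>i<k. (g i, g (Suc i)) \<in> ?R n)" for n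
  proof -
    have "(v n, v (Suc n)) \<in> (?R n)\<^sup>*" using v dec by (intro conn) auto
    then obtain k where "(v n, v (Suc n)) \<in> ?R n ^^ k" using rtrancl_imp_relpow by blast
    then show ?thesis unfolding relpow_fun_conv by blast
  qed
  then obtain k where "\<forall>n. \<exists>g. g 0 = v n \<and> g (k n) = v (Suc n) \<and> (\<forall>i<k n. (g i, g (Suc i)) \<in> ?R n)"
    using choice[of "\<lambda>n k. \<exists>g. g 0 = v n \<and> g k = v (Suc n) \<and> (\<forall>i<k. (g i, g (Suc i)) \<in> ?R n)"] by blast
  then obtain g where gg: "\<forall>n. g n 0 = v n \<and> g n (k n) = v (Suc n) \<and> (\<forall>i<k n. (g n i, g n (Suc i)) \<in> ?R n)"
    using choice[of "\<lambda>n g. g 0 = v n \<and> g (k n) = v (Suc n) \<and> (\<forall>i<k n. (g i, g (Suc i)) \<in> ?R n)"] by blast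
  have g: "g n 0 = v n" "g n (k n) = v (Suc n)" for n using gg by simp_all
  have g3: "(g n i, g n (Suc i)) \<in> ?R n" if "i < k n" for n i using gg that by simp
  have gZ: "g n i \<in> Z n" if "i \<le> k n" for n i
    using that
  proof (induction i)
    case (Suc i)
    then show ?case using g3[of i n] unfolding links_def by auto
  qed (simp add: g(1) v)
  define nx where "nx = (\<lambda>(n, i). if i < k n then (n, Suc i) else (Suc n, 0))"
  define st where "st t = (nx ^^ t) (0, 0)" for t
  define w where "w t = g (fst (st t)) (snd (st t))" for t
  have stS: "st (Suc t) = nx (st t)" for t unfolding st_def by simp
  have snd_le: "snd (st t) \<le> k (fst (st t))" for t
  proof (induction t)
    case (Suc t)
    then show ?case unfolding stS nx_def by (auto split: prod.split)
  qed (simp add: st_def)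
  have wZ: "w t \<in> Z (fst (st t))" for t unfolding w_def using gZ snd_le by simp
  have step: "w (Suc t) = w t \<or> (w t, w (Suc t)) \<in> ?R (fst (st t))" for t
  proof (cases "snd (st t) < k (fst (st t))")
    case True
    then show ?thesis using g3[OF True] unfolding w_def stS nx_def by (simp add: split_beta)
  next
    case False
    then have "snd (st t) = k (fst (st t))" using snd_le[of t] by simp
    then show ?thesis using g(1,2) unfolding w_def stS nx_def by (simp add: split_beta)
  qed
  have fst_mono: "fst (st t) \<le> fst (st t')" if "t \<le> t'" for t t'
    using that
  proof (induction rule: dec_induct)
    case (step m)
    then show ?case unfolding stS nx_def by (auto simp: split_beta)
  qed simp
  have reach: "\<exists>t. st t = (N, 0)" for N
  proof (induction N)
    case 0
    then show ?case by (intro exI[of _ 0]) (simp add: st_def)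
  next
    case (Suc N)
    then obtain t where t: "st t = (N, 0)" by blast
    have "st (t + i) = (N, i)" if "i \<le> k N" for i
      using that by (induction i) (simp_all add: t stS nx_def)
    then have "st (t + k N) = (N, k N)" by simp
    then have "st (Suc (t + k N)) = (Suc N, 0)" unfolding stS nx_def by simp
    then show ?case by blast
  qed
  have late: "\<exists>t0. \<forall>t\<ge>t0. w t \<in> Z N" for N
  proof -
    obtain t0 where t0: "st t0 = (N, 0)" using reach by blast
    have "w t \<in> Z N" if "t \<ge> t0" for t
      using fst_mono[OF that] anti[of N "fst (st t)"] wZ[of t] unfolding t0 by auto
    then show ?thesis by blast
  qed
  have fin: "finite {t. w t = p}" for p
  proof -
    obtain n where "p \<notin> Z n" using vanish by blast
    moreover obtain t0 where "\<forall>t\<ge>t0. w t \<in> Z n" using late by blast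
    ultimately have "{t. w t = p} \<subseteq> {..<t0}" by (auto simp: not_less[symmetric])
    then show ?thesis using finite_subset by blast
  qed
  \<comment> \<open>loop erasure: always continue from the last visit of the walk \<open>w\<close> to the current vertex\<close>
  define last where "last t = Max {t'. w t' = w t}" for t
  have last: "w (last t) = w t" "t \<le> last t" "\<And>t'. last t < t' \<Longrightarrow> w t' \<noteq> w t" for t
  proof -
    have "last t \<in> {t'. w t' = w t}" unfolding last_def by (rule Max_in[OF fin]) blast
    then show "w (last t) = w t" by simp
    show "t \<le> last t" unfolding last_def by (rule Max_ge[OF fin]) simp
    show "w t' \<noteq> w t" if "last t < t'" for t'
    proof
      assume "w t' = w t"
      then have "t' \<le> last t" unfolding last_def by (intro Max_ge[OF fin]) simp
      with that show False by simp
    qed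
  qed
  define \<sigma> where "\<sigma> = rec_nat (last 0) (\<lambda>_ t. last (Suc t))"
  have \<sigma>S: "\<sigma> (Suc n) = last (Suc (\<sigma> n))" for n unfolding \<sigma>_def by simp
  have \<sigma>_last: "w t \<noteq> w (\<sigma> n)" if "\<sigma> n < t" for n t
  proof -
    obtain t0 where "\<sigma> n = last t0" by (cases n) (auto simp: \<sigma>_def)
    then show ?thesis using last(1,3)[of t0] that by simp
  qed
  have "\<sigma> n < \<sigma> (Suc n)" for n unfolding \<sigma>S using last(2)[of "Suc (\<sigma> n)"] by simp
  then have mono: "strict_mono \<sigma>" by (simp add: strict_mono_Suc_iff)
  define x where "x n = w (\<sigma> n)" for n
  have "\<exists>e. e \<in> edges H \<and> endpts H e = {x n, x (Suc n)}" for n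
  proof -
    have "x (Suc n) = w (Suc (\<sigma> n))" unfolding x_def \<sigma>S using last(1) by simp
    moreover have "w (Suc (\<sigma> n)) \<noteq> w (\<sigma> n)" by (rule \<sigma>_last) simp
    ultimately have "(x n, x (Suc n)) \<in> ?R (fst (st (\<sigma> n)))" using step[of "\<sigma> n"] unfolding x_def by auto
    then show ?thesis unfolding links_def by blast
  qed
  then obtain f where f: "\<And>n. f n \<in> edges H \<and> endpts H (f n) = {x n, x (Suc n)}" by metis
  have "x n \<noteq> x m" if "n < m" for n m
    unfolding x_def using \<sigma>_last[of n "\<sigma> m"] strict_monoD[OF mono that] by metis
  then have "inj x" by (metis injI linorder_neqE_nat)
  moreover have "x n \<in> verts H" for n unfolding x_def using wZ[of "\<sigma> n"] anti[of 0 "fst (st (\<sigma> n))"] sub by auto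
  ultimately have "(x, f) \<in> rays H" using f unfolding rays_def by simp
  moreover have "tends (x, f) (Z n)" for n
  proof -
    obtain t0 where t0: "\<forall>t\<ge>t0. w t \<in> Z n" using late by blast
    have "x i \<in> Z n" if "i \<ge> t0" for i
      unfolding x_def using t0 strict_mono_imp_increasing[OF mono, of i] that by simp
    then show ?thesis unfolding tends_def by auto
  qed
  ultimately show ?thesis by (rule that)
qed

section \<open>Components and equivalence of rays\<close>

definition component_of :: "('v, 'e) mgraph \<Rightarrow> 'v \<Rightarrow> ('v, 'e) mgraph" where
  "component_of H p = \<lparr>verts = {q \<in> verts H. (p, q) \<in> (adjacency H)\<^sup>*},
    edges = {e \<in> edges H. endpts H e \<subseteq> {q \<in> verts H. (p, q) \<in> (adjacency H)\<^sup>*}}, endpts = endpts H\<rparr>"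

lemma adjacency_rtrancl_sym: "(p, q) \<in> (adjacency H)\<^sup>* \<Longrightarrow> (q, p) \<in> (adjacency H)\<^sup>*"
  unfolding adjacency_eq by (rule rtrancl_links_sym)

lemma component_of_connected:
  assumes H: "multigraph H" and p: "p \<in> verts H"
  shows "subgraph (component_of H p) H" "connected_graph (component_of H p)" "p \<in> verts (component_of H p)"
proof -
  let ?C = "component_of H p"
  show "p \<in> verts ?C" using p unfolding component_of_def by simp
  show "subgraph ?C H"
    using H unfolding subgraph_def multigraph_def component_of_def by auto
  have reach: "(p, q) \<in> (adjacency ?C)\<^sup>*" if q: "q \<in> verts ?C" for q
  proof -
    have "(p, q) \<in> (links (endpts H) (edges H))\<^sup>*" using q unfolding component_of_def adjacency_eq by simp
    then have "q \<in> verts ?C \<and> (p, q) \<in> (links (endpts H) {e \<in> edges H. endpts H e \<subseteq> verts ?C})\<^sup>*"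
    proof (rule rtrancl_links_component)
      show "p \<in> verts ?C" by fact
      fix e assume e: "e \<in> edges H" "endpts H e \<inter> verts ?C \<noteq> {}"
      have sub: "endpts H e \<subseteq> verts H" "card (endpts H e) = 2" using H e(1) unfolding multigraph_def by auto
      obtain a where a: "a \<in> endpts H e" "(p, a) \<in> (adjacency H)\<^sup>*" using e(2) unfolding component_of_def by auto
      have "(p, b) \<in> (adjacency H)\<^sup>*" if b: "b \<in> endpts H e" for b
      proof (cases "a = b")
        case False
        have "finite (endpts H e)" using sub(2) card.infinite by fastforce
        then have "endpts H e = {a, b}" using card_subset_eq[of "endpts H e" "{a, b}"] a(1) b sub(2) False by auto
        then have "(a, b) \<in> adjacency H" using e(1) unfolding adjacency_def by auto
        with a(2) show ?thesis by (rule rtrancl.rtrancl_into_rtrancl)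
      qed (use a in simp)
      then show "endpts H e \<subseteq> verts ?C" using sub(1) unfolding component_of_def by auto
    qed
    then show ?thesis unfolding adjacency_eq component_of_def by simp
  qed
  show "connected_graph ?C"
    unfolding connected_graph_def
  proof (intro conjI ballI)
    show "verts ?C \<noteq> {}" using \<open>p \<in> verts ?C\<close> by blast
    fix a b assume "a \<in> verts ?C" "b \<in> verts ?C"
    then show "(a, b) \<in> (adjacency ?C)\<^sup>*" by (intro rtrancl_trans[OF adjacency_rtrancl_sym[OF reach] reach])
  qed
qed

lemma connected_subgraph_component_of:
  assumes "subgraph D H" "connected_graph D" "p \<in> verts D"
  shows "subgraph D (component_of H p)"
proof -
  have "adjacency D \<subseteq> adjacency H" using assms(1) unfolding subgraph_def adjacency_def by auto
  then have "(adjacency D)\<^sup>* \<subseteq> (adjacency H)\<^sup>*" by (rule rtrancl_mono)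
  then have "verts D \<subseteq> verts (component_of H p)"
    using assms unfolding subgraph_def connected_graph_def component_of_def by auto
  then show ?thesis
    using assms(1) unfolding subgraph_def component_of_def multigraph_def by (auto, blast+)
qed

lemma component_eq_component_of:
  assumes "multigraph H" "component C H" "p \<in> verts C"
  shows "C = component_of H p"
proof -
  have C: "subgraph C H" "connected_graph C" "\<And>D. subgraph D H \<Longrightarrow> connected_graph D \<Longrightarrow> subgraph C D \<Longrightarrow> D = C"
    using assms(2) unfolding component_def by auto
  have "p \<in> verts H" using C(1) assms(3) unfolding subgraph_def by auto
  then show ?thesis
    using C(3)[OF component_of_connected(1,2)[OF assms(1)] connected_subgraph_component_of[OF C(1,2) assms(3)]] by simp
qed

lemma component_component_of:
  assumes "multigraph H" "p \<in> verts H"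
  shows "component (component_of H p) H"
  unfolding component_def
proof (intro conjI allI impI)
  note C = component_of_connected[OF assms]
  show "subgraph (component_of H p) H" "connected_graph (component_of H p)" using C by auto
  fix D assume D: "subgraph D H \<and> connected_graph D \<and> subgraph (component_of H p) D"
  then have pD: "p \<in> verts D" using C(3) unfolding subgraph_def by auto
  have "subgraph D (component_of H p)" by (rule connected_subgraph_component_of) (use D pD in auto)
  then show "D = component_of H p" using D unfolding subgraph_def by (intro mgraph.equality) auto
qed

lemma multigraph_delete_edges: "multigraph H \<Longrightarrow> multigraph (delete_edges H S)"
  unfolding multigraph_def delete_edges_def by auto

lemma component_containing_tail:
  assumes H: "multigraph H" and r: "r \<in> rays H" "tends r A" and S: "{e \<in> edges H. endpts H e \<inter> A \<noteq> {} \<and> \<not> endpts H e \<subseteq> A} \<subseteq> S"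
    and S': "\<And>e. e \<in> S \<Longrightarrow> \<not> endpts H e \<subseteq> A"
  obtains C n where "component C (delete_edges H S)" "verts C \<subseteq> A" "tail n r \<in> rays C"
proof -
  let ?H = "delete_edges H S"
  have H': "multigraph ?H" by (rule multigraph_delete_edges[OF H])
  obtain n where n: "\<And>i. i \<ge> n \<Longrightarrow> fst r i \<in> A" using r(2) unfolding tends_def by blast
  note rD = raysD[OF r(1)]
  let ?p = "fst r n" and ?C = "component_of (delete_edges H S) (fst r n)"
  have p: "?p \<in> verts ?H" using rD(2) unfolding delete_edges_def by simp
  have "verts ?C \<subseteq> A"
  proof
    fix q assume "q \<in> verts ?C"
    then have "(?p, q) \<in> (adjacency ?H)\<^sup>*" unfolding component_of_def by simp
    then show "q \<in> A" using n[OF order_refl]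
      by (rule rtrancl_closed_induct) (use S in \<open>auto simp: adjacency_def delete_edges_def\<close>)
  qed
  moreover have edge: "snd r i \<in> edges ?H" if "i \<ge> n" for i
  proof -
    have "endpts H (snd r i) \<subseteq> A" using rD(4)[of i] n[OF that] n[of "Suc i"] that by auto
    then show ?thesis using rD(3) S' unfolding delete_edges_def by auto
  qed
  have reach: "(?p, fst r (n + i)) \<in> (adjacency ?H)\<^sup>*" for i
  proof (induction i)
    case (Suc i)
    have "(fst r (n + i), fst r (n + Suc i)) \<in> adjacency ?H"
      using edge[of "n + i"] rD(4)[of "n + i"] unfolding adjacency_def delete_edges_def by auto
    with Suc show ?case by (rule rtrancl.rtrancl_into_rtrancl)
  qed simp
  have inC: "fst r i \<in> verts ?C" if "i \<ge> n" for i
    using reach[of "i - n"] rD(2)[of i] that unfolding component_of_def by (simp add: delete_edges_def)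
  have "tail n r \<in> rays ?C"
  proof -
    have "inj (\<lambda>i. fst r (i + n))"
    proof (rule injI)
      fix a b assume "fst r (a + n) = fst r (b + n)"
      then have "a + n = b + n" by (rule injD[OF rD(1)])
      then show "a = b" by simp
    qed
    moreover have "snd r (i + n) \<in> edges ?C \<and> endpts ?C (snd r (i + n)) = {fst r (i + n), fst r (Suc i + n)}" for i
    proof -
      have "endpts H (snd r (i + n)) \<subseteq> verts ?C" using rD(4)[of "i + n"] inC[of "i + n"] inC[of "Suc (i + n)"] by simp
      then show ?thesis using edge[of "i + n"] rD(4)[of "i + n"] unfolding component_of_def by (simp add: delete_edges_def)
    qed
    ultimately show ?thesis using inC unfolding tail_def rays_def by simp
  qed
  ultimately show ?thesis using that component_component_of[OF H' p] by blast
qed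

text \<open>A component is determined by any of its vertices, so a set that stays connected without
  \<open>S\<close> and catches tails of both rays forces their components to agree.\<close>

lemma ray_equivI:
  assumes H: "multigraph H" and r: "r \<in> rays H" "s \<in> rays H"
    and A: "\<And>S. finite S \<Longrightarrow> \<exists>A. tends r A \<and> tends s A \<and>
      (\<forall>p\<in>A. \<forall>q\<in>A. (p, q) \<in> (links (endpts H) (edges H - S))\<^sup>*)"
  shows "(r, s) \<in> ray_equiv H"
proof -
  have False if S: "finite S" and sep: "separates H S r s" for S
  proof -
    let ?H = "delete_edges H S"
    have H': "multigraph ?H" by (rule multigraph_delete_edges[OF H])
    obtain C D m n where CD: "component C ?H" "component D ?H" "C \<noteq> D" "tail m r \<in> rays C" "tail n s \<in> rays D"
      using sep unfolding separates_def by blast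
    obtain A where A: "tends r A" "tends s A" "\<forall>p\<in>A. \<forall>q\<in>A. (p, q) \<in> (links (endpts H) (edges H - S))\<^sup>*"
      using A[OF S] by blast
    obtain m' n' where m'n': "\<forall>i\<ge>m'. fst r i \<in> A" "\<forall>i\<ge>n'. fst s i \<in> A" using A(1,2) unfolding tends_def by blast
    let ?p = "fst r (m' + m)" and ?q = "fst s (n' + n)"
    have "?p \<in> verts C" "?q \<in> verts D" using raysD(2)[OF CD(4), of m'] raysD(2)[OF CD(5), of n'] unfolding tail_def by auto
    moreover from this have C: "C = component_of ?H ?p" and D: "D = component_of ?H ?q"
      using component_eq_component_of[OF H'] CD(1,2) by auto
    moreover have "(?p, ?q) \<in> (adjacency ?H)\<^sup>*"
      using A(3) m'n' unfolding adjacency_eq delete_edges_def by simp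
    ultimately have "?q \<in> verts C" unfolding component_of_def by simp
    then have "C = component_of ?H ?q" using component_eq_component_of[OF H' CD(1)] by blast
    then show False using CD(3) D by simp
  qed
  then show ?thesis using r unfolding ray_equiv_def by blast
qed

lemma ray_equiv_refl:
  assumes H: "multigraph H" and r: "r \<in> rays H"
  shows "(r, r) \<in> ray_equiv H"
proof -
  have False if sep: "separates H S r r" for S
  proof -
    let ?H = "delete_edges H S"
    obtain C D m n where CD: "component C ?H" "component D ?H" "C \<noteq> D" "tail m r \<in> rays C" "tail n r \<in> rays D"
      using sep unfolding separates_def by blast
    have "fst r (m + n) \<in> verts C" "fst r (m + n) \<in> verts D"
      using raysD(2)[OF CD(4), of n] raysD(2)[OF CD(5), of m] unfolding tail_def by (simp_all add: add.commute)
    then have "C = D" using component_eq_component_of[OF multigraph_delete_edges[OF H]] CD(1,2) by metis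
    with CD(3) show False ..
  qed
  then show ?thesis using r unfolding ray_equiv_def by blast
qed

context highly_connected_graph
begin

text \<open>Deleting the finite boundary of \<open>A\<close> confines tails on different sides to
  different components.\<close>

lemma ray_equiv_tends:
  assumes rs: "(r, s) \<in> ray_equiv G" and A: "region A"
  shows "tends r A \<longleftrightarrow> tends s A"
proof (rule ccontr)
  have r: "r \<in> rays G" "s \<in> rays G" using rs unfolding ray_equiv_def by auto
  have bdE: "bd A \<subseteq> E" "finite (bd A)" using A unfolding region_def bd_def by auto
  have nsep: "\<not> separates G (bd A) r s" using rs bdE unfolding ray_equiv_def by blast
  assume "\<not> (tends r A \<longleftrightarrow> tends s A)"
  then obtain B B' where B: "B = A \<and> B' = V - A \<or> B = V - A \<and> B' = A" "tends r B" "tends s B'"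
    using tends_region[OF r(1) A] tends_region[OF r(2) A] by blast
  have cut: "{e \<in> E. \<epsilon> e \<inter> D \<noteq> {} \<and> \<not> \<epsilon> e \<subseteq> D} \<subseteq> bd A" "\<And>e. e \<in> bd A \<Longrightarrow> \<not> \<epsilon> e \<subseteq> D"
    if "D = A \<or> D = V - A" for D
    using that multi unfolding bd_def multigraph_def by auto
  have AV: "B = A \<or> B = V - A" "B' = A \<or> B' = V - A" "B \<inter> B' = {}" using B(1) by auto
  obtain C m where C: "component C (delete_edges G (bd A))" "verts C \<subseteq> B" "tail m r \<in> rays C"
    using component_containing_tail[OF multi r(1) B(2) cut[OF AV(1)]] .
  obtain D n where D: "component D (delete_edges G (bd A))" "verts D \<subseteq> B'" "tail n s \<in> rays D"
    using component_containing_tail[OF multi r(2) B(3) cut[OF AV(2)]] .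
  have "fst (tail m r) 0 \<in> verts C" using raysD(2)[OF C(3)] .
  then have "C \<noteq> D" using C(2) D(2) AV(3) by blast
  then show False using nsep C D unfolding separates_def by blast
qed

end

section \<open>The limit trees\<close>

context highly_connected_graph
begin

text \<open>Starting outside \<open>x\<close> keeps the whole connection outside \<open>x\<close>;
  for two vertices of \<open>x\<close> the cell itself would count as a connection.\<close>

definition resolved :: "'v set set \<Rightarrow> (nat \<Rightarrow> 'e set) \<Rightarrow> ('v, 'e) ray \<Rightarrow> nat \<Rightarrow> 'v \<Rightarrow> 'v \<Rightarrow> bool" where
  "resolved P T r i y z \<longleftrightarrow>
    (\<exists>x\<in>P. tends r x \<and> y \<notin> x \<and> (y, z) \<in> conn \<epsilon> P {e \<in> T i. \<epsilon> e \<inter> x = {}})"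

end

text \<open>\<open>res\<close> speaks of a single stage only; its effect on later stages is carried
  over by the connectedness of the later trees inside older cells.\<close>

locale limit_graph = highly_connected_graph G j for G :: "('v, 'e) mgraph" and j +
  fixes P :: "nat \<Rightarrow> 'v set set" and T :: "nat \<Rightarrow> nat \<Rightarrow> 'e set"
  assumes st: "\<And>n. state (P n) (T n)" and ext: "\<And>m n. m \<le> n \<Longrightarrow> extends (P m) (T m) (P n) (T n)"
    and iso: "\<And>v. v \<in> V \<Longrightarrow> \<exists>n. \<forall>m\<ge>n. {v} \<in> P m"
    and res: "\<And>r i y z. r \<in> rays G \<Longrightarrow> i < j \<Longrightarrow> y \<in> V \<Longrightarrow> z \<in> V \<Longrightarrow> \<exists>n. resolved (P n) (T n) r i y z"

context highly_connected_graph
begin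

section \<open>The sequence of stages\<close>

lemma state_initial: "state {V} (\<lambda>_. {})"
proof -
  have "region_partition V {V}" by (rule region_partitionI) (use V_nonempty region_V in auto)
  moreover have "(p, q) \<in> conn \<epsilon> {V} {}" if "p \<in> V" "q \<in> V" for p q using that by (intro conn_same[of V]) auto
  moreover have "indep \<epsilon> {V} {}" unfolding indep_def by simp
  ultimately show ?thesis using solid_V unfolding state_def by auto
qed

text \<open>A task consists of a representative ray of an end, a tree and two vertices, so there are
  countably many. Settling a task for the representative settles it for every equivalent ray,
  because equivalent rays tend to the same cells.\<close>

lemma limit_sequence:
  assumes count: "countable (graph_ends G)"
  shows "\<exists>P T. limit_graph G j P T"
proof -
  define rep where "rep \<omega> = (SOME r. r \<in> rays G \<and> \<omega> = ray_equiv G `` {r})" for \<omega>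
  have rep: "rep \<omega> \<in> rays G \<and> \<omega> = ray_equiv G `` {rep \<omega>}" if "\<omega> \<in> graph_ends G" for \<omega>
    unfolding rep_def by (rule someI_ex) (use that in \<open>auto simp: graph_ends_def quotient_def\<close>)
  define Tk where "Tk = (rep ` graph_ends G) \<times> {..<j} \<times> V \<times> V"
  have cTk: "countable Tk" unfolding Tk_def using count countable_V by (intro countable_SIGMA) auto
  define task where "task = from_nat_into Tk"
  define vert where "vert = from_nat_into V"
  have vert: "range vert = V" unfolding vert_def by (rule range_from_nat_into[OF V_nonempty countable_V])
  \<comment> \<open>The guard \<open>task n \<in> Tk\<close> covers the case that \<open>Tk\<close>
    is empty, as it is for \<open>j = 0\<close>.\<close>
  define good where "good n S \<longleftrightarrow> {vert n} \<in> fst S \<and>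
    (case task n of (r, i, y, z) \<Rightarrow> task n \<in> Tk \<longrightarrow> resolved (fst S) (snd S) r i y z)" for n S
  have "\<exists>S. \<forall>n. state (fst (S n)) (snd (S n)) \<and>
    extends (fst (S n)) (snd (S n)) (fst (S (Suc n))) (snd (S (Suc n))) \<and> good n (S (Suc n))"
  proof -
    have "\<exists>S. \<forall>n. (\<lambda>n S. state (fst S) (snd S)) n (S n) \<and>
      (\<lambda>n S S'. extends (fst S) (snd S) (fst S') (snd S') \<and> good n S') n (S n) (S (Suc n))"
    proof (rule dependent_nat_choice)
      show "\<exists>S. state (fst S) (snd S)" using state_initial by (intro exI[of _ "({V}, \<lambda>_. {})"]) simp
      fix S :: "'v set set \<times> (nat \<Rightarrow> 'e set)" and n
      assume s: "state (fst S) (snd S)"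
      have "vert n \<in> V" using vert by auto
      obtain P1 T1 where 1: "state P1 T1" "extends (fst S) (snd S) P1 T1" "{vert n} \<in> P1"
        using isolate_vertex[OF s \<open>vert n \<in> V\<close>] .
      show "\<exists>S'. state (fst S') (snd S') \<and> extends (fst S) (snd S) (fst S') (snd S') \<and> good n S'"
      proof (cases "task n \<in> Tk")
        case False
        then show ?thesis using 1 unfolding good_def by (intro exI[of _ "(P1, T1)"]) (simp split: prod.split)
      next
        case True
        obtain r i y z where t: "task n = (r, i, y, z)" by (cases "task n") auto
        then have tt: "r \<in> rays G" "y \<in> V" "z \<in> V" "i < j" using True rep unfolding Tk_def by auto
        obtain P' T' x where 2: "state P' T'" "extends P1 T1 P' T'" "{y} \<in> P'"
          "x \<in> P'" "tends r x" "y \<notin> x" "(y, z) \<in> conn \<epsilon> P' {e \<in> T' i. \<epsilon> e \<inter> x = {}}"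
          using resolving_extension[OF 1(1) tt] .
        have "extends (fst S) (snd S) P' T'" by (rule extends_trans[OF s 1(1) 1(2) 2(2)])
        moreover have "{vert n} \<in> P'" by (rule extends_singleton[OF 1(1) 2(1) 2(2) 1(3)])
        ultimately show ?thesis
          using 2 t unfolding good_def resolved_def by (intro exI[of _ "(P', T')"]) auto
      qed
    qed
    then show ?thesis by simp
  qed
  then obtain S where S: "\<And>n. state (fst (S n)) (snd (S n))"
    "\<And>n. extends (fst (S n)) (snd (S n)) (fst (S (Suc n))) (snd (S (Suc n)))" "\<And>n. good n (S (Suc n))"
    by blast
  have "limit_graph G j (\<lambda>n. fst (S n)) (\<lambda>n. snd (S n))"
  proof unfold_locales
    show ext: "extends (fst (S m)) (snd (S m)) (fst (S n)) (snd (S n))" if "m \<le> n" for m n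
      using that
    proof (induction rule: dec_induct)
      case base
      show ?case by (rule extends_refl)
    next
      case (step n)
      show ?case by (rule extends_trans[OF S(1) S(1) step.IH S(2)])
    qed
    show "\<exists>n. \<forall>m\<ge>n. {v} \<in> fst (S m)" if v: "v \<in> V" for v
    proof -
      obtain n where "v = vert n" using v vert by auto
      then have "{v} \<in> fst (S (Suc n))" using S(3)[of n] unfolding good_def by simp
      then have "{v} \<in> fst (S m)" if "m \<ge> Suc n" for m
        using extends_singleton[OF S(1) S(1) ext[OF that]] by blast
      then show ?thesis by blast
    qed
    show "\<exists>n. resolved (fst (S n)) (snd (S n)) r i y z"
      if r: "r \<in> rays G" and "i < j" "y \<in> V" "z \<in> V" for r i y z
    proof -
      define \<omega> where "\<omega> = ray_equiv G `` {r}"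
      have \<omega>: "\<omega> \<in> graph_ends G" using r unfolding \<omega>_def graph_ends_def by (rule quotientI)
      have "r \<in> \<omega>" using ray_equiv_refl[OF multi r] unfolding \<omega>_def by simp
      then have rr: "(rep \<omega>, r) \<in> ray_equiv G" using rep[OF \<omega>] by auto
      have "(rep \<omega>, i, y, z) \<in> Tk" using \<omega> that unfolding Tk_def by auto
      then obtain n where n: "task n = (rep \<omega>, i, y, z)" "task n \<in> Tk"
        using from_nat_into_surj[OF cTk] unfolding task_def by metis
      then have "resolved (fst (S (Suc n))) (snd (S (Suc n))) (rep \<omega>) i y z" using S(3)[of n] unfolding good_def by simp
      moreover have "tends (rep \<omega>) x \<longleftrightarrow> tends r x" if "x \<in> fst (S (Suc n))" for x
        by (rule ray_equiv_tends[OF rr region_partitionD(5)[OF stateD(1)[OF S(1)] that]])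
      ultimately have "resolved (fst (S (Suc n))) (snd (S (Suc n))) r i y z" unfolding resolved_def by blast
      then show ?thesis by blast
    qed
  qed (fact S(1))
  then show ?thesis by blast
qed

end

context limit_graph
begin

section \<open>Finiteness of separating edges and connectedness of the limits\<close>

lemmas part = stateD(1)[OF st]
lemmas cells = region_partitionD[OF part]

lemma T_mono: "i < j \<Longrightarrow> m \<le> n \<Longrightarrow> T m i \<subseteq> T n i"
  using extendsD(2)[OF ext] .

lemma eventually_singletons: "finite K \<Longrightarrow> K \<subseteq> V \<Longrightarrow> \<exists>n. \<forall>m\<ge>n. \<forall>v\<in>K. {v} \<in> P m"
proof (induction K rule: finite_induct)
  case (insert v K)
  then obtain n where n: "\<forall>m\<ge>n. \<forall>v\<in>K. {v} \<in> P m" by blast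
  obtain n' where n': "\<forall>m\<ge>n'. {v} \<in> P m" using iso insert.prems by blast
  have "\<forall>m\<ge>max n n'. \<forall>w\<in>insert v K. {w} \<in> P m" using n n' by auto
  then show ?case by blast
qed simp

lemma conn_earlier_stage:
  assumes "i < j" "m \<le> n" "(y, z) \<in> conn \<epsilon> (P n) (T n i - D)"
  shows "(y, z) \<in> conn \<epsilon> (P m) (T m i - D)"
  using assms(3) extendsD(1)[OF ext[OF assms(2)]]
proof (rule conn_coarsen)
  fix e assume "e \<in> T n i - D"
  then show "e \<in> T m i - D \<or> (\<exists>A\<in>P m. \<epsilon> e \<subseteq> A)" using extendsD(3)[OF ext[OF assms(2)] assms(1)] by blast
qed

text \<open>The edges of the path from \<open>y\<close> to \<open>z\<close> in the tree of stage \<open>n\<close>.\<close>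

definition Sep :: "nat \<Rightarrow> 'v \<Rightarrow> 'v \<Rightarrow> nat \<Rightarrow> 'e set" where
  "Sep i y z n = {e \<in> T n i. (y, z) \<notin> conn \<epsilon> (P n) (T n i - {e})}"

lemma Sep_mono: "i < j \<Longrightarrow> m \<le> n \<Longrightarrow> Sep i y z m \<subseteq> Sep i y z n"
  using T_mono[of i m n] conn_earlier_stage[of i m n y z] unfolding Sep_def by blast

text \<open>Each vertex is eventually a cell of its own, so cells that never become singletons leave
  every vertex behind.\<close>

lemma nested_cells_ray:
  assumes Z: "\<And>n. Z n \<in> P n" "\<And>n. Z (Suc n) \<subseteq> Z n" and big: "\<And>n v. Z n \<noteq> {v}"
  obtains r where "r \<in> rays G" "\<And>n. tends r (Z n)"
proof -
  have van: "\<exists>n. v \<notin> Z n" for v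
  proof (cases "v \<in> V")
    case True
    then obtain n where "{v} \<in> P n" using iso by blast
    from cells(6)[OF Z(1)[of n] this] have "Z n \<inter> {v} = {}" using big by simp
    then show ?thesis by blast
  next
    case False
    then show ?thesis using cells(4)[OF Z(1)[of 0]] by blast
  qed
  have con: "(p, q) \<in> (links \<epsilon> {e \<in> E. \<epsilon> e \<subseteq> Z n})\<^sup>*" if "p \<in> Z n" "q \<in> Z n" for n p q
    using solid_connected[OF stateD(2)[OF st Z(1)] that] unfolding inside_def .
  have Z0: "Z 0 \<subseteq> V" "\<And>n. Z n \<noteq> {}" using cells(4)[OF Z(1)] cells(3)[OF Z(1)] by auto
  have "\<exists>r\<in>rays G. \<forall>n. tends r (Z n)"
    by (rule ray_through_nested_sets[of Z G]) (fact van con Z0 Z(2) | blast)+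
  then show ?thesis using that by blast
qed

text \<open>The old connection consists of tree edges and cells outside \<open>Z\<close>. Later
  trees keep these edges and connect these cells by edges inside them, so the connection persists
  without any edge inside \<open>Z\<close>.\<close>

lemma resolved_not_separated:
  assumes i: "i < j" and Z: "Z \<in> P n" "y \<notin> Z" "(y, z) \<in> conn \<epsilon> (P n) {e \<in> T n i. \<epsilon> e \<inter> Z = {}}"
    and yV: "y \<in> V" and nm: "n \<le> m" and e: "e \<in> E" "\<epsilon> e \<subseteq> Z"
  shows "(y, z) \<in> conn \<epsilon> (P m) (T m i - {e})"
proof -
  have ne: "\<epsilon> e \<noteq> {}" using edge_two[OF e(1)] by auto
  have "(y, z) \<in> conn \<epsilon> {B \<in> P n. B \<subseteq> V - Z} {e \<in> T n i. \<epsilon> e \<inter> Z = {}}"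
  proof (rule conn_restrict[OF Z(3)])
    show "y \<in> V - Z" using yV Z(2) by blast
    show "B \<subseteq> V - Z \<or> B \<inter> (V - Z) = {}" if "B \<in> P n" for B
      using cells(4)[OF that] cells(6)[OF that Z(1)] by blast
    show "\<epsilon> f \<subseteq> V - Z" if "f \<in> {e \<in> T n i. \<epsilon> e \<inter> Z = {}}" for f
      using that stateD(4)[OF st i] multi unfolding multigraph_def by blast
  qed
  then show ?thesis
  proof (rule conn_least)
    fix B a b assume B: "B \<in> {B \<in> P n. B \<subseteq> V - Z}" "a \<in> B" "b \<in> B"
    then have "(a, b) \<in> conn \<epsilon> (P m) (T m i \<inter> inside B)" using extendsD(4)[OF ext[OF nm] i] by blast
    moreover have "e \<notin> inside B" using B(1) e(2) ne unfolding inside_def by blast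
    ultimately show "(a, b) \<in> conn \<epsilon> (P m) (T m i - {e})" by (elim conn_monoD) blast
  next
    fix f a b assume f: "f \<in> {e \<in> T n i. \<epsilon> e \<inter> Z = {}}" "\<epsilon> f = {a, b}"
    then have "f \<in> T m i - {e}" using T_mono[OF i nm] e(2) ne by blast
    then show "(a, b) \<in> conn \<epsilon> (P m) (T m i - {e})" using f(2) by (rule conn_edge)
  qed
qed

text \<open>Koenig's argument: only finitely many edges cross \<open>P n\<close>, so infinitely many
  separating edges leave infinitely many inside one cell, and such cells can be chosen decreasing.
  They define a ray. At the stage where \<open>y\<close> and \<open>z\<close> are resolved for this
  ray, its cell can contain no separating edge at all.\<close>

lemma finite_Sep:
  assumes i: "i < j" and yz: "y \<in> V" "z \<in> V"
  shows "finite (\<Union>n. Sep i y z n)"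
proof (rule ccontr)
  let ?S = "\<Union>n. Sep i y z n"
  assume inf: "infinite ?S"
  define big where "big Z \<longleftrightarrow> infinite {e \<in> ?S. \<epsilon> e \<subseteq> Z}" for Z
  have SE: "?S \<subseteq> E" using stateD(4)[OF st i] unfolding Sep_def by blast
  have split: "\<exists>Z'\<in>P n. Z' \<subseteq> Z \<and> big Z'" if Z: "big Z" "\<And>B. B \<in> P n \<Longrightarrow> B \<subseteq> Z \<or> B \<inter> Z = {}" for Z n
  proof (rule ccontr)
    assume neg: "\<not> (\<exists>Z'\<in>P n. Z' \<subseteq> Z \<and> big Z')"
    have "{e \<in> ?S. \<epsilon> e \<subseteq> Z} \<subseteq> crossing V (P n) \<union> (\<Union>B\<in>{B \<in> P n. B \<subseteq> Z}. {e \<in> ?S. \<epsilon> e \<subseteq> B})"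
    proof
      fix e assume e: "e \<in> {e \<in> ?S. \<epsilon> e \<subseteq> Z}"
      then have eE: "e \<in> E" using SE by blast
      show "e \<in> crossing V (P n) \<union> (\<Union>B\<in>{B \<in> P n. B \<subseteq> Z}. {e \<in> ?S. \<epsilon> e \<subseteq> B})"
      proof (cases "\<exists>B\<in>P n. \<epsilon> e \<subseteq> B")
        case True
        then obtain B where B: "B \<in> P n" "\<epsilon> e \<subseteq> B" by blast
        moreover have "\<epsilon> e \<noteq> {}" using edge_two[OF eE] by auto
        ultimately have "B \<subseteq> Z" using Z(2)[OF B(1)] e by blast
        then show ?thesis using B e by blast
      next
        case False
        then show ?thesis using eE multi unfolding crossing_def inside_def multigraph_def by blast
      qed
    qed
    moreover have "finite (crossing V (P n) \<union> (\<Union>B\<in>{B \<in> P n. B \<subseteq> Z}. {e \<in> ?S. \<epsilon> e \<subseteq> B}))"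
      using neg cells(1) finite_crossing[OF part] unfolding big_def by auto
    ultimately show False using Z(1) finite_subset unfolding big_def by blast
  qed
  have "\<exists>Z. \<forall>n. (Z n \<in> P n \<and> big (Z n)) \<and> Z (Suc n) \<subseteq> Z n"
  proof (rule dependent_nat_choice)
    have "{e \<in> ?S. \<epsilon> e \<subseteq> V} = ?S" using SE multi unfolding multigraph_def by blast
    then have "big V" using inf unfolding big_def by simp
    then show "\<exists>Z. Z \<in> P 0 \<and> big Z" using split[of V 0] cells(4) by blast
    fix Z n assume Z: "Z \<in> P n \<and> big Z"
    have "\<exists>Z'\<in>P (Suc n). Z' \<subseteq> Z \<and> big Z'"
    proof (rule split)
      show "big Z" using Z by blast
      show "B \<subseteq> Z \<or> B \<inter> Z = {}" if "B \<in> P (Suc n)" for B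
        using refines_cases[OF part part extendsD(1)[OF ext[of n "Suc n"]] _ that] Z by simp
    qed
    then show "\<exists>Z'. (Z' \<in> P (Suc n) \<and> big Z') \<and> Z' \<subseteq> Z" by blast
  qed
  then obtain Z where Z: "\<And>n. Z n \<in> P n" "\<And>n. big (Z n)" "\<And>n. Z (Suc n) \<subseteq> Z n" by blast
  have "Z n \<noteq> {v}" for n v
  proof
    assume Zn: "Z n = {v}"
    have "\<not> \<epsilon> e \<subseteq> {v}" if "e \<in> E" for e
    proof -
      obtain p q where "\<epsilon> e = {p, q}" "p \<noteq> q" using edge_ends[OF \<open>e \<in> E\<close>] by metis
      then show ?thesis by auto
    qed
    then have "{e \<in> ?S. \<epsilon> e \<subseteq> Z n} = {}" unfolding Zn using SE by blast
    then show False using Z(2)[of n] unfolding big_def by (metis finite.emptyI)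
  qed
  then obtain r where r: "r \<in> rays G" "\<And>n. tends r (Z n)" using nested_cells_ray[OF Z(1,3)] by blast
  obtain n x where x: "x \<in> P n" "tends r x" "y \<notin> x" "(y, z) \<in> conn \<epsilon> (P n) {e \<in> T n i. \<epsilon> e \<inter> x = {}}"
    using res[OF r(1) i yz] unfolding resolved_def by blast
  have "x = Z n" by (rule tends_unique[OF part x(1) Z(1) x(2) r(2)])
  have "{e \<in> ?S. \<epsilon> e \<subseteq> Z n} = {}"
  proof (rule ccontr)
    assume "{e \<in> ?S. \<epsilon> e \<subseteq> Z n} \<noteq> {}"
    then obtain e m where e: "e \<in> Sep i y z m" "\<epsilon> e \<subseteq> Z n" by blast
    then have "e \<in> Sep i y z (max m n)" using Sep_mono[OF i, of m "max m n"] by auto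
    moreover have "e \<in> E" using e(1) SE by blast
    ultimately show False
      using resolved_not_separated[OF i x(1,3,4) yz(1), of "max m n" e] e(2) \<open>x = Z n\<close> unfolding Sep_def by simp
  qed
  then show False using Z(2)[of n] unfolding big_def by (metis finite.emptyI)
qed

lemma tree_edge_ends: "i < j \<Longrightarrow> e \<in> T n i \<Longrightarrow> \<exists>p q. \<epsilon> e = {p, q}"
  using edge_two stateD(4)[OF st] by blast

text \<open>Take a stage at which \<open>y\<close> and all ends of separating edges are singleton
  cells. A minimal connection modulo that stage consists of separating edges, so its passages
  through cells are trivial and its edges alone join \<open>y\<close> to \<open>z\<close>.\<close>

lemma limit_connected:
  assumes i: "i < j" and yz: "y \<in> V" "z \<in> V"
  shows "\<exists>n. (y, z) \<in> (links \<epsilon> (T n i))\<^sup>*"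
proof -
  let ?S = "\<Union>n. Sep i y z n"
  have SE: "?S \<subseteq> E" using stateD(4)[OF st i] unfolding Sep_def by blast
  define K where "K = insert y (\<Union>e\<in>?S. \<epsilon> e)"
  have "finite (\<epsilon> e)" if "e \<in> ?S" for e
  proof -
    have "e \<in> E" using that SE by blast
    then show ?thesis using edge_two by fastforce
  qed
  then have "finite K" unfolding K_def using finite_Sep[OF i yz] by blast
  moreover have "K \<subseteq> V" unfolding K_def using yz SE multi unfolding multigraph_def by blast
  ultimately have "\<exists>n. \<forall>m\<ge>n. \<forall>v\<in>K. {v} \<in> P m" by (rule eventually_singletons)
  then obtain n where n: "\<And>v. v \<in> K \<Longrightarrow> {v} \<in> P n" by blast
  have "\<exists>J. J \<subseteq> T n i \<and> (y, z) \<in> conn \<epsilon> (P n) J \<and> (\<forall>e\<in>J. (y, z) \<notin> conn \<epsilon> (P n) (T n i - {e}))"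
    by (rule conn_minimal_subset_separates[OF stateD(5)[OF st i] order_refl stateD(3)[OF st i] _ stateD(6)[OF st i yz]])
      (fact tree_edge_ends[OF i] | blast)+
  then obtain J where J: "J \<subseteq> T n i" "(y, z) \<in> conn \<epsilon> (P n) J"
    "\<And>e. e \<in> J \<Longrightarrow> (y, z) \<notin> conn \<epsilon> (P n) (T n i - {e})" by blast
  have JS: "J \<subseteq> ?S" using J(1,3) unfolding Sep_def by blast
  have "z \<in> K \<and> (y, z) \<in> (links \<epsilon> J)\<^sup>*"
    using J(2) unfolding conn_def
  proof (induction rule: rtrancl_induct)
    case base
    then show ?case unfolding K_def by simp
  next
    case (step a b)
    from step.hyps(2) show ?case
    proof
      assume "(a, b) \<in> same (P n)"
      then obtain A where A: "A \<in> P n" "a \<in> A" "b \<in> A" unfolding same_def by blast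
      have "A = {a}" using cells(6)[OF A(1) n[of a]] A(2) step.IH by blast
      then show ?thesis using A step.IH by simp
    next
      assume ab: "(a, b) \<in> links \<epsilon> J"
      then obtain e where "e \<in> J" "\<epsilon> e = {a, b}" unfolding links_def by blast
      then have "b \<in> K" using JS unfolding K_def by blast
      moreover have "(y, b) \<in> (links \<epsilon> J)\<^sup>*" using step.IH ab by (blast intro: rtrancl_into_rtrancl)
      ultimately show ?thesis by blast
    qed
  qed
  then have "(y, z) \<in> (links \<epsilon> (T n i))\<^sup>*" using rtrancl_mono[OF links_mono[OF J(1)]] by blast
  then show ?thesis by blast
qed

text \<open>Every edge of a minimal path from \<open>y\<close> to \<open>z\<close> also separates
  them modulo \<open>P m\<close>. At stage \<open>m\<close> the tree already connects them modulo
  \<open>P m\<close> by edges inside \<open>Z\<close>, so each separating edge must be among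
  these.\<close>

lemma limit_cell_connected:
  assumes i: "i < j" and Z: "Z \<in> P n" "y \<in> Z" "z \<in> Z"
  shows "(y, z) \<in> (links \<epsilon> ((\<Union>n. T n i) \<inter> inside Z))\<^sup>*"
proof -
  have yz: "y \<in> V" "z \<in> V" using cells(4)[OF Z(1)] Z by auto
  obtain n' where n': "(y, z) \<in> (links \<epsilon> (T n' i))\<^sup>*" using limit_connected[OF i yz] by blast
  define m where "m = max n n'"
  have mm: "n \<le> m" "n' \<le> m" unfolding m_def by auto
  have "(y, z) \<in> (links \<epsilon> (T m i))\<^sup>*" using n' rtrancl_mono[OF links_mono[OF T_mono[OF i mm(2)]]] by blast
  then have yz0: "(y, z) \<in> conn \<epsilon> {} (T m i)" unfolding conn_def same_def by simp
  have "\<exists>J. J \<subseteq> T m i \<and> (y, z) \<in> conn \<epsilon> {} J \<and> (\<forall>e\<in>J. (y, z) \<notin> conn \<epsilon> (P m) (T m i - {e}))"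
    by (rule conn_minimal_subset_separates[OF stateD(5)[OF st i] empty_subsetI stateD(3)[OF st i] _ yz0])
      (fact tree_edge_ends[OF i] | blast)+
  then obtain J where J: "J \<subseteq> T m i" "(y, z) \<in> conn \<epsilon> {} J"
    "\<And>e. e \<in> J \<Longrightarrow> (y, z) \<notin> conn \<epsilon> (P m) (T m i - {e})" by blast
  have "(y, z) \<in> conn \<epsilon> (P m) (T m i \<inter> inside Z)" using extendsD(4)[OF ext[OF mm(1)] i Z] .
  then have "e \<in> inside Z" if "e \<in> J" for e
    using J(3)[OF that] conn_monoD[of y z \<epsilon> "P m" "T m i \<inter> inside Z" "T m i - {e}"] by blast
  then have "J \<subseteq> (\<Union>n. T n i) \<inter> inside Z" using J(1) by blast
  moreover have "(y, z) \<in> (links \<epsilon> J)\<^sup>*" using J(2) unfolding conn_def same_def by simp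
  ultimately show ?thesis using rtrancl_mono[OF links_mono] by blast
qed

section \<open>The limits as end faithful spanning trees\<close>

definition limit_tree :: "nat \<Rightarrow> ('v, 'e) mgraph" where
  "limit_tree i = \<lparr>verts = V, edges = (\<Union>n. T n i), endpts = \<epsilon>\<rparr>"

lemma limit_tree_sel [simp]:
  "verts (limit_tree i) = V" "edges (limit_tree i) = (\<Union>n. T n i)" "endpts (limit_tree i) = \<epsilon>"
  unfolding limit_tree_def by simp_all

lemma limit_tree_subgraph:
  assumes i: "i < j"
  shows "subgraph (limit_tree i) G"
proof -
  have sub: "(\<Union>n. T n i) \<subseteq> E" using stateD(4)[OF st i] by blast
  then have "multigraph (limit_tree i)" using multi unfolding multigraph_def by (metis limit_tree_sel subsetD)
  with sub show ?thesis unfolding subgraph_def by simp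
qed

text \<open>A cycle has finitely many edges, so all of them are present at one stage; there the
  others join the ends of the first one, against independence.\<close>

lemma limit_tree_acyclic:
  assumes i: "i < j"
  shows "\<not> cycle (limit_tree i) vs es"
proof
  assume "cycle (limit_tree i) vs es"
  then have c: "2 \<le> length vs" "length es = length vs" "distinct es" "set es \<subseteq> (\<Union>n. T n i)"
    "\<And>l. l < length vs \<Longrightarrow> \<epsilon> (es ! l) = {vs ! l, vs ! (Suc l mod length vs)}"
    unfolding cycle_def by auto
  have "\<exists>n. F \<subseteq> T n i" if "finite F" "F \<subseteq> (\<Union>n. T n i)" for F
    using that
  proof (induction F)
    case (insert e F)
    then obtain n m where "F \<subseteq> T n i" "e \<in> T m i" by auto
    then have "insert e F \<subseteq> T (max m n) i" using T_mono[OF i, of n "max m n"] T_mono[OF i, of m "max m n"] by auto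
    then show ?case by blast
  qed simp
  then obtain n where n: "set es \<subseteq> T n i" using c(4) by blast
  let ?e = "es ! 0" and ?N = "length vs"
  have e: "?e \<in> T n i" "\<epsilon> ?e = {vs ! 0, vs ! 1}" 
  proof -
    have "0 < ?N" "1 < ?N" using c(1) by linarith+
    then show "?e \<in> T n i" "\<epsilon> ?e = {vs ! 0, vs ! 1}"
      using subsetD[OF n nth_mem[of 0 es]] c(2) c(5)[of 0] by simp_all
  qed
  have other: "es ! l \<in> T n i - {?e}" if "0 < l" "l < ?N" for l
  proof -
    have "l < length es" "0 < length es" using that c(2) by auto
    then show ?thesis using subsetD[OF n nth_mem[of l es]] nth_eq_iff_index_eq[OF c(3), of l 0] that(1) by simp
  qed
  have path: "(vs ! 1, vs ! Suc l) \<in> conn \<epsilon> (P n) (T n i - {?e})" if "Suc l < ?N" for l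
    using that
  proof (induction l)
    case (Suc l)
    have "(vs ! Suc l, vs ! Suc (Suc l)) \<in> conn \<epsilon> (P n) (T n i - {?e})"
      using Suc.prems c(5)[of "Suc l"] other[of "Suc l"] by (intro conn_edge[of "es ! Suc l"]) auto
    then show ?case using conn_trans Suc by (meson Suc_lessD)
  qed simp
  obtain l where "?N = 2 + l" using le_Suc_ex[OF c(1)] by blast
  then have l: "?N = Suc (Suc l)" by simp
  have "(vs ! Suc l, vs ! 0) \<in> conn \<epsilon> (P n) (T n i - {?e})"
    using c(5)[of "Suc l"] other[of "Suc l"] l by (intro conn_edge[of "es ! Suc l"]) auto
  moreover have "(vs ! 1, vs ! Suc l) \<in> conn \<epsilon> (P n) (T n i - {?e})" using l by (intro path) simp
  ultimately have "(vs ! 1, vs ! 0) \<in> conn \<epsilon> (P n) (T n i - {?e})" by (rule conn_trans[rotated])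
  then have "(vs ! 0, vs ! 1) \<in> conn \<epsilon> (P n) (T n i - {?e})" by (rule conn_sym)
  then show False using stateD(5)[OF st i, of n] e unfolding indep_def by blast
qed

lemma limit_tree_spanning:
  assumes i: "i < j"
  shows "spanning_tree (limit_tree i) G"
proof -
  have sub: "subgraph (limit_tree i) G" by (rule limit_tree_subgraph[OF i])
  have "(y, z) \<in> (links \<epsilon> (\<Union>n. T n i))\<^sup>*" if "y \<in> V" "z \<in> V" for y z
  proof -
    obtain n where "(y, z) \<in> (links \<epsilon> (T n i))\<^sup>*" using limit_connected[OF i \<open>y \<in> V\<close> \<open>z \<in> V\<close>] by blast
    moreover have "T n i \<subseteq> (\<Union>n. T n i)" by blast
    ultimately show ?thesis using rtrancl_mono[OF links_mono] by blast
  qed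
  then have "connected_graph (limit_tree i)"
    unfolding connected_graph_def adjacency_eq using V_nonempty by simp
  then show ?thesis
    using sub limit_tree_acyclic[OF i] unfolding spanning_tree_def tree_def subgraph_def by simp
qed

lemma ray_cells:
  assumes r: "r \<in> rays G"
  obtains Z where "\<And>n. Z n \<in> P n" "\<And>n. tends r (Z n)" "\<And>n. Z (Suc n) \<subseteq> Z n" "\<And>v. v \<in> V \<Longrightarrow> \<exists>n. \<forall>m\<ge>n. v \<notin> Z m"
proof -
  have "tends r V" using raysD(2)[OF r] unfolding tends_def by blast
  then have "\<exists>A. A \<in> P n \<and> tends r A" for n using tends_cell[OF r part] by metis
  then obtain Z where Z: "\<And>n. Z n \<in> P n \<and> tends r (Z n)" by metis
  have "Z (Suc n) \<subseteq> Z n" for n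
  proof -
    have "Z (Suc n) \<in> P (Suc n)" using Z by simp
    then obtain B where B: "B \<in> P n" "Z (Suc n) \<subseteq> B"
      using extendsD(1)[OF ext[of n "Suc n"]] unfolding refines_def by auto
    then have "tends r B" using Z tends_mono by blast
    then have "B = Z n" using tends_unique[OF part B(1)] Z by blast
    then show ?thesis using B(2) by simp
  qed
  moreover have "\<exists>n. \<forall>m\<ge>n. v \<notin> Z m" if v: "v \<in> V" for v
  proof -
    obtain n where n: "\<forall>m\<ge>n. {v} \<in> P m" using iso[OF v] by blast
    have "v \<notin> Z m" if "m \<ge> n" for m
    proof
      assume "v \<in> Z m"
      moreover have "{v} \<in> P m" using n that by simp
      ultimately have "Z m = {v}" using cells(6)[of "Z m" m "{v}"] Z by blast
      then show False using not_tends_finite[OF r, of "{v}"] Z[of m] by simp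
    qed
    then show ?thesis by blast
  qed
  ultimately show ?thesis using Z that by blast
qed

lemma cells_avoid_finite:
  fixes Z :: "nat \<Rightarrow> 'v set"
  assumes avoid: "\<And>v. v \<in> V \<Longrightarrow> \<exists>n. \<forall>m\<ge>n. v \<notin> Z m" and "finite S"
  shows "\<exists>n. S \<inter> inside (Z n) = {}"
proof -
  have "\<exists>n. \<forall>m\<ge>n. S \<inter> inside (Z m) = {}"
    using \<open>finite S\<close>
  proof (induction S)
    case (insert e S)
    then obtain n where n: "\<forall>m\<ge>n. S \<inter> inside (Z m) = {}" by blast
    have "\<exists>n'. \<forall>m\<ge>n'. e \<notin> inside (Z m)"
    proof (cases "e \<in> E")
      case True
      then obtain p q where pq: "\<epsilon> e = {p, q}" "p \<in> V" using edge_ends by metis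
      obtain n' where n': "\<forall>m\<ge>n'. p \<notin> Z m" using avoid[OF pq(2)] by blast
      have "e \<notin> inside (Z m)" if "m \<ge> n'" for m using n' that pq(1) unfolding inside_def by simp
      then show ?thesis by blast
    qed (auto simp: inside_def)
    then obtain n' where "\<forall>m\<ge>n'. e \<notin> inside (Z m)" by blast
    then have "insert e S \<inter> inside (Z m) = {}" if "m \<ge> n + n'" for m using n that by auto
    then show ?case by blast
  qed simp
  then show ?thesis by blast
qed

text \<open>The cells \<open>Z n\<close> of an end leave every finite edge set \<open>S\<close>
  behind and are connected both in \<open>G\<close> and in the tree. Connectedness in the tree
  yields a tree ray tending to all of them, and connectedness in \<open>G\<close> puts it into the
  end. For two tree rays of the end, connectedness in the tree again prevents \<open>S\<close> from
  separating them.\<close>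

lemma limit_tree_end_faithful:
  assumes i: "i < j"
  shows "end_faithful (limit_tree i) G"
proof -
  let ?H = "limit_tree i"
  have sub: "subgraph ?H G" by (rule limit_tree_subgraph[OF i])
  then have H: "multigraph ?H" unfolding subgraph_def by blast
  have raysH: "r \<in> rays G" if "r \<in> rays ?H" for r
  proof -
    have "(\<Union>n. T n i) \<subseteq> E" using stateD(4)[OF st i] by blast
    then show ?thesis using that unfolding rays_def by (auto dest: subsetD)
  qed
  have ends: "\<exists>x\<in>rays G. \<omega> = ray_equiv G `` {x}" if "\<omega> \<in> graph_ends G" for \<omega>
    using that unfolding graph_ends_def quotient_def by blast
  have "\<exists>r\<in>rays ?H. r \<in> \<omega>" if \<omega>: "\<omega> \<in> graph_ends G" for \<omega>
  proof -
    obtain x where x: "x \<in> rays G" "\<omega> = ray_equiv G `` {x}" using ends[OF \<omega>] by blast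
    obtain Z where Z: "\<And>n. Z n \<in> P n" "\<And>n. tends x (Z n)" "\<And>n. Z (Suc n) \<subseteq> Z n" "\<And>v. v \<in> V \<Longrightarrow> \<exists>n. \<forall>m\<ge>n. v \<notin> Z m"
      using ray_cells[OF x(1)] by blast
    have "\<exists>r\<in>rays ?H. \<forall>n. tends r (Z n)"
    proof (rule ray_through_nested_sets[of Z ?H])
      show "Z 0 \<subseteq> verts ?H" using cells(4)[OF Z(1)[of 0]] by simp
      show "Z (Suc n) \<subseteq> Z n" "Z n \<noteq> {}" for n using Z(3) cells(3)[OF Z(1)] by auto
      show "\<exists>n. v \<notin> Z n" for v using Z(4)[of v] cells(4)[OF Z(1)[of 0]] by (cases "v \<in> V") auto
      show "(p, q) \<in> (links (endpts ?H) {e \<in> edges ?H. endpts ?H e \<subseteq> Z n})\<^sup>*" if "p \<in> Z n" "q \<in> Z n" for n p q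
      proof -
        have sub: "(\<Union>n. T n i) \<inter> inside (Z n) \<subseteq> {e \<in> edges ?H. endpts ?H e \<subseteq> Z n}" unfolding inside_def by auto
        from subsetD[OF rtrancl_mono[OF links_mono[OF sub]] limit_cell_connected[OF i Z(1) that]]
        show ?thesis by simp
      qed
    qed blast
    then obtain r where r: "r \<in> rays ?H" "\<And>n. tends r (Z n)" by blast
    have "(x, r) \<in> ray_equiv G"
    proof (rule ray_equivI[OF multi x(1) raysH[OF r(1)]])
      fix S :: "'e set" assume "finite S"
      then obtain n where n: "S \<inter> inside (Z n) = {}" using cells_avoid_finite[OF Z(4)] by blast
      have "inside (Z n) \<subseteq> E - S" using n unfolding inside_def by auto
      from subsetD[OF rtrancl_mono[OF links_mono[OF this]] solid_connected[OF stateD(2)[OF st Z(1)]]]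
      have "\<forall>p\<in>Z n. \<forall>q\<in>Z n. (p, q) \<in> (links \<epsilon> (E - S))\<^sup>*" by blast
      then show "\<exists>A. tends x A \<and> tends r A \<and> (\<forall>p\<in>A. \<forall>q\<in>A. (p, q) \<in> (links \<epsilon> (E - S))\<^sup>*)" using Z(2) r(2) by blast
    qed
    then show ?thesis using r(1) x(2) by blast
  qed
  moreover have "\<exists>\<omega>\<in>graph_ends ?H. r \<in> \<omega> \<and> s \<in> \<omega>"
    if r: "r \<in> rays ?H" and s: "s \<in> rays ?H" and \<omega>: "\<omega> \<in> graph_ends G" "r \<in> \<omega>" "s \<in> \<omega>" for r s \<omega>
  proof -
    obtain x where x: "x \<in> rays G" "\<omega> = ray_equiv G `` {x}" using ends[OF \<omega>(1)] by blast
    have xr: "(x, r) \<in> ray_equiv G" "(x, s) \<in> ray_equiv G" using x(2) \<omega>(2,3) by auto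
    obtain Z where Z: "\<And>n. Z n \<in> P n" "\<And>n. tends x (Z n)" "\<And>n. Z (Suc n) \<subseteq> Z n" "\<And>v. v \<in> V \<Longrightarrow> \<exists>n. \<forall>m\<ge>n. v \<notin> Z m"
      using ray_cells[OF x(1)] by blast
    have tZ: "tends r (Z n)" "tends s (Z n)" for n
      using ray_equiv_tends[OF xr(1) cells(5)[OF Z(1)]] ray_equiv_tends[OF xr(2) cells(5)[OF Z(1)]] Z(2) by blast+
    have "(r, s) \<in> ray_equiv ?H"
    proof (rule ray_equivI[OF H r s])
      fix S :: "'e set" assume "finite S"
      then obtain n where n: "S \<inter> inside (Z n) = {}" using cells_avoid_finite[OF Z(4)] by blast
      have "(\<Union>n. T n i) \<inter> inside (Z n) \<subseteq> edges ?H - S" using n by auto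
      from subsetD[OF rtrancl_mono[OF links_mono[OF this]] limit_cell_connected[OF i Z(1)]]
      have "\<forall>p\<in>Z n. \<forall>q\<in>Z n. (p, q) \<in> (links (endpts ?H) (edges ?H - S))\<^sup>*" by simp
      then show "\<exists>A. tends r A \<and> tends s A \<and> (\<forall>p\<in>A. \<forall>q\<in>A. (p, q) \<in> (links (endpts ?H) (edges ?H - S))\<^sup>*)"
        using tZ by blast
    qed
    moreover have "(r, r) \<in> ray_equiv ?H" by (rule ray_equiv_refl[OF H r])
    moreover have "ray_equiv ?H `` {r} \<in> graph_ends ?H" using r unfolding graph_ends_def by (rule quotientI)
    ultimately show ?thesis by blast
  qed
  ultimately show ?thesis using sub unfolding end_faithful_def by blast
qed

lemma limit_trees_disjoint:
  assumes "i < j" "i' < j" "i \<noteq> i'"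
  shows "edges (limit_tree i) \<inter> edges (limit_tree i') = {}"
proof -
  have False if e: "e \<in> T n i" "e \<in> T n' i'" for e n n'
  proof -
    have "e \<in> T (max n n') i" "e \<in> T (max n n') i'"
      using e T_mono[OF assms(1), of n "max n n'"] T_mono[OF assms(2), of n' "max n n'"] by auto
    then show False using stateD(7)[OF st assms] by blast
  qed
  then show ?thesis by auto
qed

text \<open>Edge disjointness alone would not distinguish two trees without edges; this gives the
  packing its cardinality.\<close>

lemma limit_tree_nonempty:
  assumes "i < j"
  shows "edges (limit_tree i) \<noteq> {}"
proof
  assume empty: "edges (limit_tree i) = {}"
  have "y = z" if "y \<in> V" "z \<in> V" for y z
    using limit_connected[OF assms that] empty unfolding links_def by auto
  then have "\<exists>y. V \<subseteq> {y}" by blast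
  then have "finite V" using finite_subset by blast
  then show False using locfin unfolding locally_finite_def by simp
qed

end

theorem theorem1p4:
  fixes G :: "('v, 'e) mgraph" and k :: nat
  assumes "k \<ge> 1"
    and "multigraph G"
    and "locally_finite G"
    and "edge_connected (2 * k) G"
    and "countable (graph_ends G)"
  shows "\<exists>\<T>. end_faithful_spanning_tree_packing G \<T> \<and> finite \<T> \<and> card \<T> = k - 1"
proof -
  have k: "2 * Suc (k - 1) = 2 * k" using assms(1) by simp
  interpret highly_connected_graph G "k - 1"
    by unfold_locales (use assms(2,3,4) k in auto)
  obtain P T where "limit_graph G (k - 1) P T" using limit_sequence[OF assms(5)] by blast
  then interpret limit_graph G "k - 1" P T .
  let ?\<T> = "limit_tree ` {..<k - 1}"
  have "inj_on limit_tree {..<k - 1}"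
  proof (rule inj_onI)
    fix i i' assume ii: "i \<in> {..<k - 1}" "i' \<in> {..<k - 1}" "limit_tree i = limit_tree i'"
    show "i = i'"
    proof (rule ccontr)
      assume "i \<noteq> i'"
      then have "edges (limit_tree i) \<inter> edges (limit_tree i') = {}" using ii by (intro limit_trees_disjoint) auto
      then show False using limit_tree_nonempty[of i] ii by (metis Int_absorb lessThan_iff)
    qed
  qed
  then have "card ?\<T> = k - 1" by (simp add: card_image)
  moreover have "end_faithful_spanning_tree_packing G ?\<T>"
    unfolding end_faithful_spanning_tree_packing_def
  proof (intro conjI ballI impI)
    fix A assume "A \<in> ?\<T>"
    then show "spanning_tree A G" "end_faithful A G" using limit_tree_spanning limit_tree_end_faithful by auto
    fix B assume "B \<in> ?\<T>" "A \<noteq> B"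
    with \<open>A \<in> ?\<T>\<close> obtain i i' where "A = limit_tree i" "B = limit_tree i'" "i < k - 1" "i' < k - 1" "i \<noteq> i'" by auto
    then show "edges A \<inter> edges B = {}" using limit_trees_disjoint by blast
  qed
  ultimately show ?thesis by blast
qed

end
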